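(* If $G$ is a planar graph with girth at least $11$, then $\chi_{\mathsf{pcf}}(G) \le 4$.
   Context: A proper conflict-free (PCF) coloring of a graph $G$ is a proper vertex coloring of $G$ such that every non-isolated vertex $v$ has some color that appears exactly once among the colors of the neighbors of $v$. The PCF chromatic number $\chi_{\mathsf{pcf}}(G)$ is the minimum number of colors in a PCF coloring of $G$. The girth of $G$ is the length of a shortest cycle in $G$ (infinite if $G$ is acyclic). *)

theory Defs
  imports "HOL-Analysis.Analysis" "Graph_Theory.Graph_Theory"
begin

text \<open>
  Finite simple graphs are the instances of the locale \<^locale>\<open>graph\<close>: finite symmetric digraphs
  without loops and without parallel arcs, an undirected edge being a pair of opposite arcs.
\<close>

definition edges :: "('a, 'b) pre_digraph \<Rightarrow> 'a set set" where
  "edges G = {{u, v} | u v. u \<rightarrow>\<^bsub>G\<^esub> v}"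

text \<open>
  A plane drawing places the vertices at distinct points of the plane, identified with
  \<^typ>\<open>complex\<close>, and draws each edge as a Jordan arc between its ends whose interior contains
  neither a vertex nor a point of another edge.
\<close>

definition plane_drawing ::
    "('a, 'b) pre_digraph \<Rightarrow> ('a \<Rightarrow> complex) \<Rightarrow> ('a set \<Rightarrow> real \<Rightarrow> complex) \<Rightarrow> bool" where
  "plane_drawing G pt \<gamma> \<longleftrightarrow>
     inj_on pt (verts G) \<and>
     (\<forall>e \<in> edges G. arc (\<gamma> e) \<and> {pathstart (\<gamma> e), pathfinish (\<gamma> e)} = pt ` e) \<and>
     (\<forall>e \<in> edges G. (path_image (\<gamma> e) - pt ` e) \<inter> pt ` verts G = {}) \<and>
     (\<forall>e \<in> edges G. \<forall>f \<in> edges G. e \<noteq> f \<longrightarrow>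
        (path_image (\<gamma> e) - pt ` e) \<inter> path_image (\<gamma> f) = {})"

definition planar :: "('a, 'b) pre_digraph \<Rightarrow> bool" where
  "planar G \<longleftrightarrow> (\<exists>pt \<gamma>. plane_drawing G pt \<gamma>)"

text \<open>
  In a symmetric digraph every edge traversed back and forth is a \<^const>\<open>pre_digraph.cycle\<close>
  of length 2; the cycles of the undirected graph are those of length at least 3. The infimum of
  the empty set is \<open>\<infinity>\<close>, the girth of an acyclic graph.
\<close>

definition girth :: "('a, 'b) pre_digraph \<Rightarrow> enat" where
  "girth G = Inf {enat (length p) | p. pre_digraph.cycle G p \<and> 3 \<le> length p}"

definition proper_coloring :: "('a, 'b) pre_digraph \<Rightarrow> ('a \<Rightarrow> 'c) \<Rightarrow> bool" where
  "proper_coloring G c \<longleftrightarrow> (\<forall>u v. u \<rightarrow>\<^bsub>G\<^esub> v \<longrightarrow> c u \<noteq> c v)"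

definition pcf_coloring :: "('a, 'b) pre_digraph \<Rightarrow> ('a \<Rightarrow> 'c) \<Rightarrow> bool" where
  "pcf_coloring G c \<longleftrightarrow> proper_coloring G c \<and>
     (\<forall>v \<in> verts G. (\<exists>u. v \<rightarrow>\<^bsub>G\<^esub> u) \<longrightarrow> (\<exists>k. \<exists>!u. v \<rightarrow>\<^bsub>G\<^esub> u \<and> c u = k))"

text \<open>
  For a finite graph the infimum is an attained minimum, since an injective coloring is proper
  conflict-free; colors in \<^typ>\<open>nat\<close> are no restriction.
\<close>

definition pcf_chromatic_number :: "('a, 'b) pre_digraph \<Rightarrow> enat" where
  "pcf_chromatic_number G =
     Inf {enat (card (c ` verts G)) | c :: 'a \<Rightarrow> nat. pcf_coloring G c}"

end

theory Submission
  imports Defs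
begin

text \<open>
  Counting. A plane graph of girth at least 11 satisfies \<open>9 e + 11 \<le> 11 v\<close>. In a minimal
  counterexample every edge off a cycle \<open>C\<close> leads to an ear of \<open>C\<close>, since otherwise the graph splits
  at a single vertex. An ear inside \<open>C\<close> divides the interior of \<open>C\<close> (theta curve), which gives by
  induction \<open>9 e\<^sub>i + 11 \<le> |C| + 11 v\<^sub>i\<close> for the numbers of edges and vertices inside \<open>C\<close>; and if the
  interior of \<open>C\<close> is maximal, Janiszewski's theorem excludes an ear outside \<open>C\<close>.

  Colouring. In a minimal graph without a 4-colouring, delete a vertex \<open>u\<close> together with the paths of
  vertices of degree 2 (threads) starting at \<open>u\<close>. A colouring of the rest enters only through the
  colour \<open>c\<close> of the end of each thread and one colour \<open>t\<close> forbidden to the last thread vertex, the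
  unique colour at that end; an end of degree 3 forbids nothing, because its two remaining neighbours
  have different colours. This bounds the number of vertices of degree 2 near \<open>u\<close>, and sending charge
  \<open>2/9\<close> from \<open>u\<close> to every thread vertex (and \<open>1/27\<close> to 3-vertices all of whose threads have one
  vertex) shows that the average degree is at least \<open>22/9\<close>, contradicting the count.
\<close>

section \<open>Paths and cycles\<close>

text \<open>Faces are never defined. For a cycle with empty interior the inequality
  \<open>9 e + 11 <= |C| + 11 v\<close> is the girth bound, and adding it up over the two inner
  cycles of a theta gives exactly the same inequality for the outer one: Euler's formula as a
  recursion. Euler's formula would allow 22 for the 11 in \<open>9 e + 11 <= 11 v\<close> once there
  is a cycle; 11 is the constant that is tight for one vertex and survives gluing two graphs at a
  vertex. Against average degree 22/9, that is \<open>9 e >= 11 v\<close>, any positive constant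
  suffices.

  In the colouring half the obstacle is that restoring a deleted vertex can destroy the unique
  colour at its neighbours, while a vertex of degree 2 forces its two neighbours to differ. Both
  effects are confined to single threads and their ends, so that extending a colouring becomes a
  finite question about four colours. Girth enters here a second time: threads of length at most 3
  from one vertex never meet, not even at their ends. Charges are integers in units of 1/27, where
  22/9 is 66 and 2/9 is 6.\<close>

fun pedges :: "'a list \<Rightarrow> 'a set set" where
  "pedges (x # y # zs) = insert {x, y} (pedges (y # zs))"
| "pedges _ = {}"

definition cedges :: "'a list \<Rightarrow> 'a set set" where
  "cedges xs = insert {last xs, hd xs} (pedges xs)"

lemma pedges_append: "pedges (xs @ a # ys) = pedges (xs @ [a]) \<union> pedges (a # ys)"
proof (induction xs)
  case (Cons x xs)
  then show ?case by (cases xs) auto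
qed simp

lemma pedges_rev: "pedges (rev xs) = pedges xs"
proof (induction xs rule: pedges.induct)
  case (1 x y zs)
  have "pedges (rev (x # y # zs)) = pedges (rev zs @ [y]) \<union> pedges [y, x]"
    using pedges_append[of "rev zs" y "[x]"] by simp
  also have "\<dots> = pedges (x # y # zs)" using 1 by (auto simp: insert_commute)
  finally show ?case .
qed auto

lemma Union_pedges: "2 \<le> length xs \<Longrightarrow> \<Union> (pedges xs) = set xs"
proof (induction xs rule: pedges.induct)
  case (1 x y zs)
  then show ?case by (cases zs) auto
qed auto

lemma pedges_subset: "e \<in> pedges xs \<Longrightarrow> e \<subseteq> set xs"
  by (induction xs rule: pedges.induct) auto

lemma finite_pedges: "finite (pedges xs)"
  by (induction xs rule: pedges.induct) auto

lemma card_pedges: "distinct xs \<Longrightarrow> card (pedges xs) = length xs - 1"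
proof (induction xs rule: pedges.induct)
  case (1 x y zs)
  have "{x, y} \<notin> pedges (y # zs)" using 1(2) pedges_subset[of "{x,y}" "y # zs"] by auto
  then show ?case using 1 by (simp add: finite_pedges)
qed auto

text \<open>A path that uses the edge between its own ends is that edge. This is what separates the
  edge sets of two internally disjoint paths, and an ear from its cycle.\<close>

lemma pedges_ends:
  assumes "{a, b} \<in> pedges (a # ps @ [b])" "distinct (a # ps @ [b])"
  shows "ps = []"
proof (cases ps)
  case (Cons p qs)
  then have "{a,b} = {a,p} \<or> {a,b} \<in> pedges (p # qs @ [b])" using assms by simp
  then show ?thesis using assms(2) Cons pedges_subset[of "{a,b}" "p # qs @ [b]"] by (auto simp: doubleton_eq_iff)
qed auto

lemma rtranclp_distinct_path:
  assumes "R\<^sup>*\<^sup>* x y"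
  shows "\<exists>xs. xs \<noteq> [] \<and> hd xs = x \<and> last xs = y \<and> distinct xs \<and> successively R xs"
  using assms
proof (induction rule: rtranclp_induct)
  case base
  show ?case by (rule exI[of _ "[x]"]) simp
next
  case (step y z)
  then obtain xs where xs: "xs \<noteq> []" "hd xs = x" "last xs = y" "distinct xs" "successively R xs" by blast
  show ?case
  proof (cases "z \<in> set xs")
    case True
    then obtain us vs where "xs = us @ z # vs" by (meson split_list)
    then show ?thesis using xs
      by (intro exI[of _ "us @ [z]"]) (auto simp: successively_append_iff hd_append split: if_splits)
  next
    case False
    then show ?thesis using xs step(2)
      by (intro exI[of _ "xs @ [z]"]) (auto simp: successively_append_iff)
  qed
qed

locale sgraph =
  fixes E :: "'a \<Rightarrow> 'a \<Rightarrow> bool"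
  assumes sym: "E u v \<Longrightarrow> E v u" and irrefl: "\<not> E v v"
begin

definition nbrs :: "'a set \<Rightarrow> 'a \<Rightarrow> 'a set" where
  "nbrs S v = {u \<in> S. E v u}"

definition edg :: "'a set \<Rightarrow> 'a set set" where
  "edg S = {{u, v} | u v. u \<in> S \<and> v \<in> S \<and> E u v}"

definition gpath :: "'a set \<Rightarrow> 'a list \<Rightarrow> bool" where
  "gpath S xs \<longleftrightarrow> xs \<noteq> [] \<and> set xs \<subseteq> S \<and> distinct xs \<and> successively E xs"

definition cyc :: "'a set \<Rightarrow> 'a list \<Rightarrow> bool" where
  "cyc S xs \<longleftrightarrow> gpath S xs \<and> 3 \<le> length xs \<and> E (last xs) (hd xs)"

lemma successively_rev_E: "successively E (rev xs) \<longleftrightarrow> successively E xs"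
proof -
  have "(\<lambda>x y. E y x) = E" using sym by blast
  then show ?thesis unfolding successively_rev by (rule arg_cong)
qed

lemma gpath_rev: "gpath S (rev xs) \<longleftrightarrow> gpath S xs"
  unfolding gpath_def successively_rev_E by simp

lemma edg_iff: "{u, v} \<in> edg S \<longleftrightarrow> u \<in> S \<and> v \<in> S \<and> E u v"
proof
  assume "{u, v} \<in> edg S"
  then obtain x y where "{u, v} = {x, y}" "x \<in> S" "y \<in> S" "E x y" unfolding edg_def by blast
  then show "u \<in> S \<and> v \<in> S \<and> E u v" using sym[of x y] by (auto simp: doubleton_eq_iff)
qed (auto simp: edg_def)

lemma edg_E:
  assumes "e \<in> edg S"
  obtains u v where "e = {u, v}" "u \<in> S" "v \<in> S" "E u v" "u \<noteq> v"
  using assms irrefl unfolding edg_def by blast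

lemma edg_mono: "S \<subseteq> T \<Longrightarrow> edg S \<subseteq> edg T"
  unfolding edg_def by blast

lemma finite_edg: "finite S \<Longrightarrow> finite (edg S)"
  by (rule finite_subset[of _ "Pow S"]) (auto simp: edg_def)

lemma pedges_edg: "set xs \<subseteq> S \<Longrightarrow> successively E xs \<Longrightarrow> pedges xs \<subseteq> edg S"
  by (induction xs rule: pedges.induct) (auto simp: edg_iff)

lemma cedges_edg: "cyc S xs \<Longrightarrow> cedges xs \<subseteq> edg S"
  using pedges_edg[of xs S] last_in_set[of xs] hd_in_set[of xs]
  unfolding cyc_def gpath_def cedges_def by (simp add: edg_iff subset_iff)

lemma pedges_snoc: "xs \<noteq> [] \<Longrightarrow> pedges (xs @ [a]) = insert {last xs, a} (pedges xs)"
  by (induction xs rule: pedges.induct) auto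

lemma cyc_rotate:
  assumes "cyc S (us @ a # vs)"
  shows "cyc S (a # vs @ us)" "cedges (a # vs @ us) = cedges (us @ a # vs)"
proof -
  show "cyc S (a # vs @ us)"
  proof (cases "us = []")
    case False
    have s: "successively E (us @ a # vs)" "E (last (us @ a # vs)) (hd (us @ a # vs))"
      using assms by (auto simp: cyc_def gpath_def)
    have 1: "successively E us" "successively E (a # vs)" "E (last us) a"
      using s(1)[unfolded successively_append_iff] False by auto
    have 2: "E (last (a # vs)) (hd us)" using s(2) False by simp
    have "successively E ((a # vs) @ us)"
      unfolding successively_append_iff using 1(1,2) 2 by simp
    then show ?thesis using assms 1(3) False by (auto simp: cyc_def gpath_def)
  qed (use assms in simp)
  show "cedges (a # vs @ us) = cedges (us @ a # vs)"
  proof (cases us)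
    case (Cons x ws)
    have e1: "pedges ((a # vs) @ us) = pedges (a # vs @ [x]) \<union> pedges us"
      using pedges_append[of "a # vs" x ws] Cons by simp
    have e2: "pedges (a # vs @ [x]) = insert {last (a # vs), x} (pedges (a # vs))"
      using pedges_snoc[of "a # vs" x] by simp
    have e3: "pedges (us @ [a]) = insert {last us, a} (pedges us)"
      using pedges_snoc[of us a] Cons by simp
    have e4: "cedges (us @ a # vs) = insert {last (a # vs), x} (pedges (us @ [a]) \<union> pedges (a # vs))"
      unfolding cedges_def pedges_append[of us a vs] using Cons by simp
    have e5: "cedges (a # vs @ us) = insert {last us, a} (pedges ((a # vs) @ us))"
      unfolding cedges_def using Cons by simp
    show ?thesis unfolding e5 e1 e2 e4 e3 by auto
  qed simp
qed

text \<open>The list is rotated to begin at \<open>a\<close>; the part after \<open>b\<close> is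
  then read backwards so that both paths run from \<open>a\<close> to \<open>b\<close>.\<close>

lemma cyc_split:
  assumes "cyc S C" "a \<in> set C" "b \<in> set C" "a \<noteq> b"
  obtains ps qs where "gpath S (a # ps @ [b])" "gpath S (a # qs @ [b])"
    "distinct (a # b # ps @ qs)" "set C = {a, b} \<union> set ps \<union> set qs" "length C = 2 + length ps + length qs"
    "cedges C = pedges (a # ps @ [b]) \<union> pedges (a # qs @ [b])"
proof -
  obtain us vs where C: "C = us @ a # vs" using assms(2) by (meson split_list)
  let ?D = "a # vs @ us"
  have D: "cyc S ?D" "cedges ?D = cedges C" "set ?D = set C" "length ?D = length C"
    using cyc_rotate[of S us a vs] assms(1) C by auto
  have "b \<in> set (vs @ us)" using assms D(3) by auto
  then obtain ps qs where pq: "vs @ us = ps @ b # qs" by (meson split_list)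
  have Dc: "gpath S (a # ps @ b # qs)" "E (last (b # qs)) a" using D(1) pq by (auto simp: cyc_def)
  have 1: "gpath S (a # ps @ [b])" using Dc(1)
    by (auto simp: gpath_def successively_append_iff successively_Cons hd_append split: if_splits)
  have "gpath S (b # qs @ [a])" using Dc
    by (auto simp: gpath_def successively_append_iff successively_Cons hd_append split: if_splits)
  then have 2: "gpath S (a # rev qs @ [b])" using gpath_rev[of S "b # qs @ [a]"] by simp
  have "pedges (a # rev qs @ [b]) = pedges (b # qs @ [a])" using pedges_rev[of "b # qs @ [a]"] by simp
  also have "\<dots> = insert {last (b # qs), a} (pedges (b # qs))"
    using pedges_snoc[of "b # qs" a] by simp
  finally have 3: "cedges C = pedges (a # ps @ [b]) \<union> pedges (a # rev qs @ [b])"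
    using D(2) pq pedges_append[of "a # ps" b qs] by (auto simp: cedges_def)
  show ?thesis
    by (rule that[of ps "rev qs"]) (use 1 2 3 D(3,4) Dc pq in \<open>auto simp: gpath_def\<close>)
qed

lemma cyc_join:
  assumes "gpath S (a # ps @ [b])" "gpath S (a # qs @ [b])"
    "distinct (a # b # ps @ qs)" "ps \<noteq> [] \<or> qs \<noteq> []"
  shows "cyc S (a # ps @ b # rev qs)"
    "cedges (a # ps @ b # rev qs) = pedges (a # ps @ [b]) \<union> pedges (a # qs @ [b])"
proof -
  have 2: "gpath S (b # rev qs @ [a])" using assms(2) gpath_rev[of S "a # qs @ [b]"] by simp
  show "cyc S (a # ps @ b # rev qs)"
    unfolding cyc_def
  proof (intro conjI)
    show "gpath S (a # ps @ b # rev qs)" using assms(1) 2 assms(3)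
      by (auto simp: gpath_def successively_append_iff successively_Cons hd_append split: if_splits)
    show "3 \<le> length (a # ps @ b # rev qs)" using assms(4) by (cases ps; cases qs) auto
    show "E (last (a # ps @ b # rev qs)) (hd (a # ps @ b # rev qs))" using 2
      by (auto simp: gpath_def successively_append_iff successively_Cons last_rev split: if_splits)
  qed
  have "pedges (a # qs @ [b]) = pedges (b # rev qs @ [a])" using pedges_rev[of "a # qs @ [b]"] by simp
  also have "\<dots> = insert {last (b # rev qs), a} (pedges (b # rev qs))"
  using pedges_snoc[of "b # rev qs" a] by simp
  finally show "cedges (a # ps @ b # rev qs) = pedges (a # ps @ [b]) \<union> pedges (a # qs @ [b])"
    using pedges_append[of "a # ps" b "rev qs"] by (auto simp: cedges_def)
qed

lemma card_cedges:
  assumes "cyc S C"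
  shows "card (cedges C) = length C"
proof -
  have l: "length C \<ge> 3" "distinct C" using assms by (auto simp: cyc_def gpath_def)
  then obtain a ps b where C: "C = a # ps @ [b]" "ps \<noteq> []"
  proof -
    assume that: "\<And>a ps b. C = a # ps @ [b] \<Longrightarrow> ps \<noteq> [] \<Longrightarrow> thesis"
    obtain a D where 1: "C = a # D" using l(1) by (cases C) auto
    obtain ps b where 2: "D = ps @ [b]" using l(1) 1 by (cases D rule: rev_exhaust) auto
    show ?thesis by (rule that[of a ps b]) (use 1 2 l in auto)
  qed
  have "{b, a} \<notin> pedges C" using pedges_ends[of a b ps] C l by (auto simp: insert_commute)
  then show ?thesis using C l card_pedges[of C] finite_pedges[of C] by (simp add: cedges_def)
qed

lemma finite_cycs: "finite S \<Longrightarrow> finite {C. cyc S C}"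
  by (rule finite_subset[OF _ finite_subset_distinct[of S]]) (auto simp: cyc_def gpath_def)

text \<open>All neighbours of the first vertex of a longest path lie on that path. One of them is
  not its successor and closes a cycle.\<close>

lemma min_degree_two_imp_cyc:
  assumes "finite S" "S \<noteq> {}" "\<And>v. v \<in> S \<Longrightarrow> 2 \<le> card (nbrs S v)"
  shows "\<exists>C. cyc S C"
proof -
  obtain s where "s \<in> S" using assms by blast
  then have "gpath S [s]" by (simp add: gpath_def)
  then have "\<exists>xs. gpath S xs \<and> (\<forall>ys. gpath S ys \<longrightarrow> length ys \<le> length xs)"
    using assms(1)
    by (intro ex_has_greatest_nat[of "gpath S" "[s]" length "Suc (card S)"])
      (auto simp: gpath_def less_Suc_eq_le dest: distinct_card intro: card_mono simp flip: distinct_card)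
  then obtain xs where xs: "gpath S xs" "\<And>ys. gpath S ys \<Longrightarrow> length ys \<le> length xs" by blast
  obtain x zs where x: "xs = x # zs" using xs(1) by (cases xs) (auto simp: gpath_def)
  have nx: "nbrs S x \<subseteq> set zs"
  proof
    fix y assume y: "y \<in> nbrs S x"
    show "y \<in> set zs"
    proof (rule ccontr)
      assume "y \<notin> set zs"
      then have "gpath S (y # xs)" using y xs(1) x irrefl[of x] sym[of x y]
        by (auto simp: gpath_def nbrs_def)
      then show False using xs(2)[of "y # xs"] by simp
    qed
  qed
  have "x \<in> S" using xs(1) x by (simp add: gpath_def)
  then have "\<not> nbrs S x \<subseteq> {hd zs}" using assms(3)[of x] card_mono[of "{hd zs}" "nbrs S x"] by auto
  then obtain y where y: "y \<in> nbrs S x" "y \<noteq> hd zs" by blast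
  then obtain us vs where zs: "zs = us @ y # vs" using nx by (meson split_list subsetD)
  have "us \<noteq> []" using y zs by auto
  then have "cyc S (x # us @ [y])"
    using xs(1) x zs y sym[of x y] length_greater_0_conv[of us]
    by (auto simp: cyc_def gpath_def successively_append_iff successively_Cons nbrs_def hd_append Suc_le_eq)
  then show ?thesis by blast
qed

end

section \<open>Plane graphs\<close>

locale plane_graph = sgraph E for E :: "'a \<Rightarrow> 'a \<Rightarrow> bool" +
  fixes V :: "'a set" and pt :: "'a \<Rightarrow> complex" and \<gamma> :: "'a set \<Rightarrow> real \<Rightarrow> complex"
  assumes finite_V: "finite V"
    and inj_pt: "inj_on pt V"
    and arc_edge: "e \<in> edg V \<Longrightarrow> arc (\<gamma> e)"
    and ends_edge: "e \<in> edg V \<Longrightarrow> {pathstart (\<gamma> e), pathfinish (\<gamma> e)} = pt ` e"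
    and edge_verts: "e \<in> edg V \<Longrightarrow> (path_image (\<gamma> e) - pt ` e) \<inter> pt ` V = {}"
    and edge_disj: "e \<in> edg V \<Longrightarrow> f \<in> edg V \<Longrightarrow> e \<noteq> f \<Longrightarrow>
       (path_image (\<gamma> e) - pt ` e) \<inter> path_image (\<gamma> f) = {}"
begin

definition img :: "'a set set \<Rightarrow> complex set" where
  "img F = (\<Union>e\<in>F. path_image (\<gamma> e))"

text \<open>One point represents the open edge: an open edge is connected and avoids the curve of
  every cycle that does not contain it, so the side of this point is the side of the whole open
  edge.\<close>

definition mid :: "'a set \<Rightarrow> complex" where
  "mid e = \<gamma> e (1/2)"

lemma img_Un: "img (F \<union> F') = img F \<union> img F'"
  by (auto simp: img_def)

lemma pt_in_edge:
  assumes "e \<in> edg V" "v \<in> e"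
  shows "pt v \<in> path_image (\<gamma> e)"
proof -
  have "pt v \<in> {pathstart (\<gamma> e), pathfinish (\<gamma> e)}" using ends_edge[OF assms(1)] assms(2) by simp
  then show ?thesis using pathstart_in_path_image[of "\<gamma> e"] pathfinish_in_path_image[of "\<gamma> e"] by auto
qed

lemma edg_subset: "e \<in> edg V \<Longrightarrow> e \<subseteq> V"
  by (auto simp: edg_def)

lemma pt_in_img_iff:
  assumes "F \<subseteq> edg V" "v \<in> V"
  shows "pt v \<in> img F \<longleftrightarrow> v \<in> \<Union> F"
proof
  assume "pt v \<in> img F"
  then obtain e where e: "e \<in> F" "pt v \<in> path_image (\<gamma> e)" by (auto simp: img_def)
  then have "pt v \<in> pt ` e" using edge_verts[of e] assms by blast
  then have "v \<in> e" using inj_pt assms edg_subset[of e] e by (auto simp: inj_on_def)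
  then show "v \<in> \<Union> F" using e by blast
next
  assume "v \<in> \<Union> F"
  then show "pt v \<in> img F" using pt_in_edge assms by (auto simp: img_def)
qed

lemma img_Int:
  assumes "F \<subseteq> edg V" "F' \<subseteq> edg V" "F \<inter> F' = {}"
  shows "img F \<inter> img F' = pt ` (\<Union> F \<inter> \<Union> F')"
proof
  show "img F \<inter> img F' \<subseteq> pt ` (\<Union> F \<inter> \<Union> F')"
  proof
    fix p assume "p \<in> img F \<inter> img F'"
    then obtain e f where ef: "e \<in> F" "f \<in> F'" "p \<in> path_image (\<gamma> e)" "p \<in> path_image (\<gamma> f)"
      by (auto simp: img_def)
    have ne: "e \<noteq> f" and ee: "e \<in> edg V" "f \<in> edg V" using ef assms by auto
    have "p \<in> pt ` e" using edge_disj[OF ee ne] ef by blast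
    moreover have "p \<in> pt ` f" using edge_disj[OF ee(2,1)] ne ef by blast
    ultimately have "p \<in> pt ` (e \<inter> f)"
      using inj_pt edg_subset[OF ee(1)] edg_subset[OF ee(2)] inj_on_image_Int[of pt V e f] by blast
    then show "p \<in> pt ` (\<Union> F \<inter> \<Union> F')" using ef by blast
  qed
  show "pt ` (\<Union> F \<inter> \<Union> F') \<subseteq> img F \<inter> img F'"
  proof
    fix p assume "p \<in> pt ` (\<Union> F \<inter> \<Union> F')"
    then obtain v e f where "p = pt v" "v \<in> e" "e \<in> F" "v \<in> f" "f \<in> F'" by blast
    then show "p \<in> img F \<inter> img F'"
      using pt_in_edge[of e v] pt_in_edge[of f v] assms(1,2) unfolding img_def by blast
  qed
qed

lemma edge_interior:
  assumes "e \<in> edg V"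
  shows "path_image (\<gamma> e) - pt ` e = \<gamma> e ` {0<..<1}"
proof -
  have a: "inj_on (\<gamma> e) {0..1}" using arc_edge[OF assms] by (simp add: arc_def)
  have "pt ` e = \<gamma> e ` {0, 1}" using ends_edge[OF assms] by (simp add: pathstart_def pathfinish_def)
  then have "path_image (\<gamma> e) - pt ` e = \<gamma> e ` ({0..1} - {0, 1})"
    unfolding path_image_def by (subst inj_on_image_set_diff[OF a]) auto
  moreover have "{0..1} - {0, 1} = {0<..<1::real}" by auto
  ultimately show ?thesis by simp
qed

lemma mid_interior:
  assumes "e \<in> edg V"
  shows "mid e \<in> path_image (\<gamma> e) - pt ` e"
  unfolding edge_interior[OF assms] mid_def by auto

lemma mid_in_img_iff:
  assumes "F \<subseteq> edg V" "e \<in> edg V"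
  shows "mid e \<in> img F \<longleftrightarrow> e \<in> F"
proof
  assume "mid e \<in> img F"
  then obtain f where f: "f \<in> F" "mid e \<in> path_image (\<gamma> f)" by (auto simp: img_def)
  then have "f = e" using edge_disj[OF assms(2), of f] mid_interior[OF assms(2)] assms by blast
  then show "e \<in> F" using f by simp
next
  assume "e \<in> F"
  then show "mid e \<in> img F" using mid_interior[OF assms(2)] by (auto simp: img_def)
qed

text \<open>Only one end is added, because the other one may lie on the cycle whose sides are
  compared.\<close>

lemma connected_half_edge:
  assumes "e \<in> edg V" "v \<in> e"
  shows "topological_space_class.connected (insert (pt v) (path_image (\<gamma> e) - pt ` e))"
proof -
  have c: "continuous_on {0..1} (\<gamma> e)" using arc_edge[OF assms(1)] by (simp add: arc_def path_def)
  have "pt v \<in> {\<gamma> e 0, \<gamma> e 1}" using ends_edge[OF assms(1)] assms(2)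
    by (auto simp: pathstart_def pathfinish_def)
  then consider "pt v = \<gamma> e 0" | "pt v = \<gamma> e 1" by blast
  then show ?thesis
  proof cases
    case 1
    have "{0..<1::real} = insert 0 {0<..<1}" by auto
    then have "insert (pt v) (path_image (\<gamma> e) - pt ` e) = \<gamma> e ` {0..<1}"
      unfolding edge_interior[OF assms(1)] using 1 by simp
    then show ?thesis
      by (simp only:) (rule connected_continuous_image, rule continuous_on_subset[OF c], auto)
  next
    case 2
    have "{0<..1::real} = insert 1 {0<..<1}" by auto
    then have "insert (pt v) (path_image (\<gamma> e) - pt ` e) = \<gamma> e ` {0<..1}"
      unfolding edge_interior[OF assms(1)] using 2 by simp
    then show ?thesis
      by (simp only:) (rule connected_continuous_image, rule continuous_on_subset[OF c], auto)
  qed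
qed

text \<open>The first edge meets the rest of the path in a single point, so the arcs concatenate to
  an arc. An edge drawn against the direction of the path is reversed first.\<close>

lemma gpath_arc:
  assumes "gpath V xs" "2 \<le> length xs"
  shows "\<exists>g. arc g \<and> pathstart g = pt (hd xs) \<and> pathfinish g = pt (last xs) \<and> path_image g = img (pedges xs)"
  using assms
proof (induction xs rule: pedges.induct)
  case (1 x y zs)
  have xy: "{x, y} \<in> edg V" using "1.prems" by (auto simp: gpath_def edg_iff)
  have "\<exists>g. arc g \<and> pathstart g = pt x \<and> pathfinish g = pt y \<and> path_image g = path_image (\<gamma> {x, y})"
  proof (cases "pathstart (\<gamma> {x,y}) = pt x \<and> pathfinish (\<gamma> {x,y}) = pt y")
    case True
    then show ?thesis using arc_edge[OF xy] by blast
  next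
    case False
    then have "pathstart (\<gamma> {x,y}) = pt y \<and> pathfinish (\<gamma> {x,y}) = pt x"
      using ends_edge[OF xy] by (auto simp: doubleton_eq_iff)
    then show ?thesis using arc_edge[OF xy]
      by (intro exI[of _ "reversepath (\<gamma> {x,y})"]) (auto simp: arc_reversepath)
  qed
  then obtain g where g: "arc g" "pathstart g = pt x" "pathfinish g = pt y" "path_image g = path_image (\<gamma> {x, y})"
    by blast
  show ?case
  proof (cases zs)
    case Nil
    then show ?thesis using g by (auto simp: img_def)
  next
    case (Cons z ws)
    have gp: "gpath V (y # zs)" using "1.prems" Cons by (auto simp: gpath_def)
    then obtain h where h: "arc h" "pathstart h = pt y" "pathfinish h = pt (last (y # zs))"
      "path_image h = img (pedges (y # zs))" using "1.IH" Cons by auto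
    have sub: "pedges (y # zs) \<subseteq> edg V" using gp pedges_edg[of "y # zs" V] unfolding gpath_def by blast
    have xn: "x \<notin> set (y # zs)" using "1.prems" by (auto simp: gpath_def)
    have "img {{x,y}} \<inter> img (pedges (y # zs)) = pt ` (\<Union> {{x,y}} \<inter> \<Union> (pedges (y # zs)))"
      using xy sub xn pedges_subset[of "{x,y}" "y # zs"] by (intro img_Int) auto
    also have "\<Union> (pedges (y # zs)) = set (y # zs)" by (rule Union_pedges) (simp add: Cons)
    also have "\<Union> {{x,y}} \<inter> set (y # zs) = {y}" using xn by auto
    finally have "path_image g \<inter> path_image h \<subseteq> {pathstart h}" using g h by (simp add: img_def)
    then have "arc (g +++ h)" using arc_join g h by metis
    moreover have "path_image (g +++ h) = img (pedges (x # y # zs))"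
      using g h by (simp add: path_image_join) (simp add: img_def)
    ultimately show ?thesis using g h
      by (intro exI[of _ "g +++ h"]) (simp del: pedges.simps)
  qed
qed auto

section \<open>Theta curves and the sides of a cycle\<close>

text \<open>The last three conditions let at most one of the paths be a single edge. Hence the three
  edge sets are disjoint and any two of the paths form a cycle.\<close>

definition theta :: "'a set \<Rightarrow> 'a \<Rightarrow> 'a \<Rightarrow> 'a list \<Rightarrow> 'a list \<Rightarrow> 'a list \<Rightarrow> bool" where
  "theta S a b ps qs rs \<longleftrightarrow> gpath S (a # ps @ [b]) \<and> gpath S (a # qs @ [b]) \<and> gpath S (a # rs @ [b]) \<and>
     distinct (a # b # ps @ qs @ rs) \<and> (ps \<noteq> [] \<or> qs \<noteq> []) \<and> (ps \<noteq> [] \<or> rs \<noteq> []) \<and> (qs \<noteq> [] \<or> rs \<noteq> [])"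

text \<open>A common edge has both ends in \<open>{a, b}\<close>, so it is the edge between
  \<open>a\<close> and \<open>b\<close>, and then neither path has an inner vertex.\<close>

lemma two_paths_edges:
  assumes "gpath S (a # ps @ [b])" "gpath S (a # qs @ [b])"
    "distinct (a # b # ps @ qs)" "ps \<noteq> [] \<or> qs \<noteq> []"
  shows "pedges (a # ps @ [b]) \<inter> pedges (a # qs @ [b]) = {}"
proof (rule ccontr)
  assume "\<not> ?thesis"
  then obtain e where e: "e \<in> pedges (a # ps @ [b])" "e \<in> pedges (a # qs @ [b])" by blast
  have sub: "e \<subseteq> {a, b}" using pedges_subset[OF e(1)] pedges_subset[OF e(2)] assms(3) by auto
  have "e \<in> edg S" using e(1) assms(1) pedges_edg[of "a # ps @ [b]" S] by (auto simp: gpath_def)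
  then obtain u v where "e = {u,v}" "u \<noteq> v" by (rule edg_E)
  then have "e = {a, b}" using sub by blast
  then show False using pedges_ends[of a b ps] pedges_ends[of a b qs] e assms by (auto simp: gpath_def)
qed

lemma two_paths_curve:
  assumes "gpath V (a # ps @ [b])" "gpath V (a # qs @ [b])"
    "distinct (a # b # ps @ qs)" "ps \<noteq> [] \<or> qs \<noteq> []"
  shows "img (pedges (a # ps @ [b])) \<inter> img (pedges (a # qs @ [b])) = {pt a, pt b}"
proof -
  have "img (pedges (a # ps @ [b])) \<inter> img (pedges (a # qs @ [b])) =
    pt ` (\<Union> (pedges (a # ps @ [b])) \<inter> \<Union> (pedges (a # qs @ [b])))"
    using assms(1,2) pedges_edg[of "a # ps @ [b]" V] pedges_edg[of "a # qs @ [b]" V] two_paths_edges[OF assms]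
    by (intro img_Int) (auto simp only: gpath_def)
  also have "\<Union> (pedges (a # ps @ [b])) \<inter> \<Union> (pedges (a # qs @ [b])) = {a, b}"
    using assms(3) by (subst (1 2) Union_pedges) auto
  finally show ?thesis by simp
qed

lemma gpath_mono: "gpath S xs \<Longrightarrow> S \<subseteq> T \<Longrightarrow> gpath T xs"
  by (auto simp: gpath_def)

lemma cyc_mono: "cyc S xs \<Longrightarrow> S \<subseteq> T \<Longrightarrow> cyc T xs"
  by (auto simp: cyc_def gpath_def)

lemma cyc_curve:
  assumes "cyc V C"
  shows "\<exists>g. simple_path g \<and> pathfinish g = pathstart g \<and> path_image g = img (cedges C)"
proof -
  have l: "3 \<le> length C" "distinct C" using assms by (auto simp: cyc_def gpath_def)
  then have ne: "C \<noteq> []" by auto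
  have ab: "hd C \<in> set C" "last C \<in> set C" "hd C \<noteq> last C"
    using l ne nth_eq_iff_index_eq[of C 0 "length C - 1"]
    by (auto simp: hd_conv_nth[OF ne] last_conv_nth[OF ne])
  obtain ps qs where s: "gpath V (hd C # ps @ [last C])" "gpath V (hd C # qs @ [last C])"
    "distinct (hd C # last C # ps @ qs)" "length C = 2 + length ps + length qs"
    "cedges C = pedges (hd C # ps @ [last C]) \<union> pedges (hd C # qs @ [last C])"
    using cyc_split[OF assms ab] by metis
  let ?a = "hd C" and ?b = "last C"
  have ne: "ps \<noteq> [] \<or> qs \<noteq> []" using s(4) l by auto
  obtain g where g: "arc g" "pathstart g = pt ?a" "pathfinish g = pt ?b" "path_image g = img (pedges (?a # ps @ [?b]))"
    using gpath_arc[OF s(1)] by auto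
  obtain h where h: "arc h" "pathstart h = pt ?a" "pathfinish h = pt ?b" "path_image h = img (pedges (?a # qs @ [?b]))"
    using gpath_arc[OF s(2)] by auto
  have "path_image g \<inter> path_image h = {pt ?a, pt ?b}"
    using two_paths_curve[OF s(1-3) ne] g h by simp
  then have "simple_path (g +++ reversepath h)"
    using g h by (intro simple_path_join_loop) (auto simp: arc_reversepath)
  then show ?thesis using g h s(5)
    by (intro exI[of _ "g +++ reversepath h"]) (simp add: path_image_join img_Un)
qed

definition Vin :: "'a set \<Rightarrow> 'a list \<Rightarrow> 'a set" where
  "Vin S C = {v \<in> S. pt v \<in> inside (img (cedges C))}"

definition Ein :: "'a set \<Rightarrow> 'a list \<Rightarrow> 'a set set" where
  "Ein S C = {e \<in> edg S. mid e \<in> inside (img (cedges C))}"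

lemma theta_inside:
  assumes th: "theta V a b ps qs rs"
    and C: "img (cedges C) = img (pedges (a # ps @ [b])) \<union> img (pedges (a # qs @ [b]))"
    and C1: "img (cedges C1) = img (pedges (a # ps @ [b])) \<union> img (pedges (a # rs @ [b]))"
    and C2: "img (cedges C2) = img (pedges (a # qs @ [b])) \<union> img (pedges (a # rs @ [b]))"
    and meets: "img (pedges (a # rs @ [b])) \<inter> inside (img (cedges C)) \<noteq> {}"
  shows "inside (img (cedges C1)) \<inter> inside (img (cedges C2)) = {}"
    and "inside (img (cedges C)) =
      inside (img (cedges C1)) \<union> inside (img (cedges C2)) \<union> (img (pedges (a # rs @ [b])) - {pt a, pt b})"
proof -
  have t: "gpath V (a # ps @ [b])" "gpath V (a # qs @ [b])" "gpath V (a # rs @ [b])" using th by (auto simp: theta_def)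
  have ab: "pt a \<noteq> pt b" using t(1) inj_pt by (auto simp: gpath_def inj_on_def)
  obtain g1 where g1: "arc g1" "pathstart g1 = pt a" "pathfinish g1 = pt b" "path_image g1 = img (pedges (a # ps @ [b]))"
    using gpath_arc[OF t(1)] by auto
  obtain g2 where g2: "arc g2" "pathstart g2 = pt a" "pathfinish g2 = pt b" "path_image g2 = img (pedges (a # qs @ [b]))"
    using gpath_arc[OF t(2)] by auto
  obtain g where g: "arc g" "pathstart g = pt a" "pathfinish g = pt b" "path_image g = img (pedges (a # rs @ [b]))"
    using gpath_arc[OF t(3)] by auto
  have p: "path_image g1 \<inter> path_image g2 = {pt a, pt b}" "path_image g1 \<inter> path_image g = {pt a, pt b}"
    "path_image g2 \<inter> path_image g = {pt a, pt b}"
    unfolding g1(4) g2(4) g(4)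
    by (rule two_paths_curve; use th in \<open>auto simp: theta_def\<close>)+
  have m: "path_image g \<inter> inside (path_image g1 \<union> path_image g2) \<noteq> {}"
    using meets unfolding C g1(4) g2(4) g(4) .
  note split = split_inside_simple_closed_curve[OF arc_imp_simple_path[OF g1(1)] g1(2,3) arc_imp_simple_path[OF g2(1)] g2(2,3)
      arc_imp_simple_path[OF g(1)] g(2,3) ab p m]
  show "inside (img (cedges C1)) \<inter> inside (img (cedges C2)) = {}"
    unfolding C1 C2 g1(4)[symmetric] g2(4)[symmetric] g(4)[symmetric] by (rule split)
  show "inside (img (cedges C)) =
      inside (img (cedges C1)) \<union> inside (img (cedges C2)) \<union> (img (pedges (a # rs @ [b])) - {pt a, pt b})"
    unfolding C C1 C2 g1(4)[symmetric] g2(4)[symmetric] g(4)[symmetric] by (rule split) simp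
qed

text \<open>The interior of \<open>C\<close> is connected and misses the curves of \<open>C1\<close>
  and \<open>C2\<close>. If it lay inside neither, it would lie outside both, and neither curve
  would separate a point of it from a point far away. The two curves meet exactly in the third path,
  which is connected, so by Janiszewski's theorem their union does not separate the two points
  either; but this union contains the curve of \<open>C\<close>.\<close>

lemma theta_outside:
  assumes th: "theta V a b ps qs rs" and cyc: "cyc V C" "cyc V C1" "cyc V C2"
    and C: "img (cedges C) = img (pedges (a # ps @ [b])) \<union> img (pedges (a # qs @ [b]))"
    and C1: "img (cedges C1) = img (pedges (a # ps @ [b])) \<union> img (pedges (a # rs @ [b]))"
    and C2: "img (cedges C2) = img (pedges (a # qs @ [b])) \<union> img (pedges (a # rs @ [b]))"
    and dis: "img (pedges (a # rs @ [b])) \<inter> inside (img (cedges C)) = {}"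
  shows "inside (img (cedges C)) \<subseteq> inside (img (cedges C1)) \<or> inside (img (cedges C)) \<subseteq> inside (img (cedges C2))"
proof (rule ccontr)
  assume contra: "\<not> ?thesis"
  obtain g where g: "simple_path g" "pathfinish g = pathstart g" "path_image g = img (cedges C)"
    using cyc_curve[OF cyc(1)] by blast
  obtain g1 where g1: "simple_path g1" "pathfinish g1 = pathstart g1" "path_image g1 = img (cedges C1)"
    using cyc_curve[OF cyc(2)] by blast
  obtain g2 where g2: "simple_path g2" "pathfinish g2 = pathstart g2" "path_image g2 = img (cedges C2)"
    using cyc_curve[OF cyc(3)] by blast
  note J = Jordan_inside_outside[OF g(1,2), unfolded g(3)]
  note J1 = Jordan_inside_outside[OF g1(1,2), unfolded g1(3)]
  note J2 = Jordan_inside_outside[OF g2(1,2), unfolded g2(3)]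
  let ?I = "inside (img (cedges C))"
  have conI: "topological_space_class.connected ?I" using J by blast
  have d: "?I \<inter> img (cedges C) = {}" by (simp add: inside_no_overlap)
  have out: "?I \<subseteq> outside (img (cedges D))"
    if "?I \<inter> img (cedges D) = {}" "\<not> ?I \<subseteq> inside (img (cedges D))"
      "open (inside (img (cedges D)))" "open (outside (img (cedges D)))"
      "inside (img (cedges D)) \<union> outside (img (cedges D)) = - img (cedges D)"
      "inside (img (cedges D)) \<inter> outside (img (cedges D)) = {}" for D
    using connectedD[OF conI that(3,4)] that by blast
  have d1: "?I \<inter> img (cedges C1) = {}" and d2: "?I \<inter> img (cedges C2) = {}"
    using d dis unfolding C1 C2 by (auto simp only: C)
  have o1: "?I \<subseteq> outside (img (cedges C1))" using contra d1 J1 by (intro out) blast+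
  have o2: "?I \<subseteq> outside (img (cedges C2))" using contra d2 J2 by (intro out) blast+
  obtain x where x: "x \<in> ?I" using J by blast
  have "bounded (?I \<union> img (cedges C) \<union> inside (img (cedges C1)) \<union> img (cedges C1) \<union> inside (img (cedges C2)) \<union> img (cedges C2))"
    using J J1 J2 bounded_simple_path_image[OF g(1)] bounded_simple_path_image[OF g1(1)] bounded_simple_path_image[OF g2(1)]
    unfolding g(3) g1(3) g2(3) by auto
  then obtain y where y: "y \<notin> ?I \<union> img (cedges C) \<union> inside (img (cedges C1)) \<union> img (cedges C1) \<union> inside (img (cedges C2)) \<union> img (cedges C2)"
    using not_bounded_UNIV[where 'a=complex] by (metis UNIV_eq_I)
  have y1: "y \<in> outside (img (cedges C1))" using y J1 by blast
  have y2: "y \<in> outside (img (cedges C2))" using y J2 by blast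
  have cc: "connected_component (- T) x y" if "topological_space_class.connected (outside T)" "x \<in> outside T" "y \<in> outside T" for T :: "complex set"
    using that outside_no_overlap[of T] unfolding connected_component_def by blast
  have "connected_component (- (img (cedges C1) \<union> img (cedges C2))) x y"
  proof (rule Janiszewski)
    show "compact (img (cedges C1))" using compact_simple_path_image[OF g1(1)] g1(3) by simp
    show "closed (img (cedges C2))" using closed_simple_path_image[OF g2(1)] g2(3) by simp
    have t: "gpath V (a # ps @ [b])" "gpath V (a # qs @ [b])" "gpath V (a # rs @ [b])"
      "distinct (a # b # ps @ qs)" "ps \<noteq> [] \<or> qs \<noteq> []" using th by (auto simp: theta_def)
    obtain h where h: "arc h" "pathstart h = pt a" "pathfinish h = pt b" "path_image h = img (pedges (a # rs @ [b]))"
      using gpath_arc[OF t(3)] by auto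
    have "{pt a, pt b} \<subseteq> img (pedges (a # rs @ [b]))"
      using h by (metis empty_subsetI insert_subset pathfinish_in_path_image pathstart_in_path_image)
    then have "img (cedges C1) \<inter> img (cedges C2) = img (pedges (a # rs @ [b]))"
      unfolding C1 C2 using two_paths_curve[OF t(1,2,4,5)] by blast
    then show "topological_space_class.connected (img (cedges C1) \<inter> img (cedges C2))" using connected_arc_image[OF h(1)] h(4) by simp
    show "connected_component (- img (cedges C1)) x y" using J1 o1 x y1 by (intro cc) blast+
    show "connected_component (- img (cedges C2)) x y" using J2 o2 x y2 by (intro cc) blast+
  qed
  then obtain K where K: "topological_space_class.connected K" "K \<subseteq> - (img (cedges C1) \<union> img (cedges C2))" "x \<in> K" "y \<in> K"
    unfolding connected_component_def by blast
  have "K \<subseteq> - img (cedges C)" using K(2) unfolding C C1 C2 by blast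
  then have "K \<inter> ?I \<inter> outside (img (cedges C)) = {} \<and> K \<subseteq> ?I \<union> outside (img (cedges C))" using J by blast
  then have "K \<inter> ?I = {} \<or> K \<inter> outside (img (cedges C)) = {}"
    using connectedD[OF K(1), of ?I "outside (img (cedges C))"] J by auto
  moreover have "y \<in> outside (img (cedges C))" using y J by blast
  ultimately show False using K(3,4) x by blast
qed

text \<open>The half edge at \<open>u\<close> is connected and misses the curve because
  \<open>u\<close> is off the cycle; \<open>v\<close> may be on it.\<close>

lemma side_step:
  assumes C: "cyc V C" and \<Omega>: "\<Omega> = inside (img (cedges C)) \<or> \<Omega> = outside (img (cedges C))"
    and e: "{u, v} \<in> edg V" "u \<notin> set C"
  shows "mid {u, v} \<in> \<Omega> \<longleftrightarrow> pt u \<in> \<Omega>"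
proof -
  have ce: "cedges C \<subseteq> edg V" by (rule cedges_edg[OF C])
  have "set C \<noteq> {}" using C by (auto simp: cyc_def gpath_def)
  then have cs: "f \<subseteq> set C" if "f \<in> cedges C" for f
    using that pedges_subset[of f C] unfolding cedges_def by auto
  have en: "{u, v} \<notin> cedges C" using e(2) cs by blast
  let ?K = "insert (pt u) (path_image (\<gamma> {u,v}) - pt ` {u,v})"
  have con: "topological_space_class.connected ?K" by (rule connected_half_edge[OF e(1)]) simp
  have "pt u \<notin> img (cedges C)" using pt_in_img_iff[OF ce, of u] e cs by (auto simp: edg_iff)
  moreover have "(path_image (\<gamma> {u,v}) - pt ` {u,v}) \<inter> img (cedges C) = {}"
  proof -
    have "(path_image (\<gamma> {u,v}) - pt ` {u,v}) \<inter> path_image (\<gamma> f) = {}" if "f \<in> cedges C" for f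
      using edge_disj[OF e(1), of f] that ce en by auto
    then show ?thesis unfolding img_def by blast
  qed
  ultimately have KC: "?K \<subseteq> - img (cedges C)" by blast
  obtain g where g: "simple_path g" "pathfinish g = pathstart g" "path_image g = img (cedges C)"
    using cyc_curve[OF C] by blast
  note J = Jordan_inside_outside[OF g(1,2), unfolded g(3)]
  have "?K \<inter> inside (img (cedges C)) = {} \<or> ?K \<inter> outside (img (cedges C)) = {}"
    using connectedD[OF con, of "inside (img (cedges C))" "outside (img (cedges C))"] J KC by blast
  moreover have "mid {u,v} \<in> ?K" "pt u \<in> ?K" using mid_interior[OF e(1)] by blast+
  moreover have "?K \<subseteq> inside (img (cedges C)) \<union> outside (img (cedges C))" using J KC by blast
  ultimately show ?thesis using \<Omega> by blast
qed

section \<open>Ears of a cycle\<close>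

text \<open>\<open>X\<close> is a union of components off the cycle that are attached to it in at
  most one vertex. Then \<open>X \<union> N\<close> and \<open>S - X\<close> carry all edges and
  share at most one vertex. This is the only obstruction to finding ears.\<close>

definition isolable :: "'a set \<Rightarrow> 'a list \<Rightarrow> bool" where
  "isolable S C \<longleftrightarrow> (\<exists>X N. X \<noteq> {} \<and> X \<subseteq> S - set C \<and> N \<subseteq> set C \<and> card N \<le> 1 \<and>
     (\<forall>x\<in>X. \<forall>y\<in>S. E x y \<longrightarrow> y \<in> X \<union> N))"

lemma edg_other: "e \<in> edg S \<Longrightarrow> v \<in> e \<Longrightarrow> \<exists>u. e = {v, u}"
  by (metis edg_E insert_iff insert_commute singletonD)

text \<open>A chord is an ear by itself. Otherwise \<open>e\<close> has an end \<open>x\<close> off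
  the cycle; the component \<open>X\<close> of \<open>x\<close> off the cycle is attached to it in
  two vertices, since it would be isolable otherwise, and a path through \<open>X\<close> joins
  them. By \<open>side_step\<close> the side of \<open>e\<close> is passed on to all of
  \<open>X\<close> and to the edges at it.\<close>

lemma ear:
  assumes S: "S \<subseteq> V" and C: "cyc S C" and no: "\<not> isolable S C"
    and \<Omega>: "\<Omega> = inside (img (cedges C)) \<or> \<Omega> = outside (img (cedges C))"
    and e: "e \<in> edg S" "mid e \<in> \<Omega>"
  obtains a b rs where "a \<in> set C" "b \<in> set C" "a \<noteq> b" "gpath S (a # rs @ [b])" "set rs \<inter> set C = {}"
    "pedges (a # rs @ [b]) \<inter> cedges C = {}" "\<And>f. f \<in> pedges (a # rs @ [b]) \<Longrightarrow> mid f \<in> \<Omega>"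
proof -
  have CV: "cyc V C" by (rule cyc_mono[OF C S])
  have ce: "cedges C \<subseteq> edg V" by (rule cedges_edg[OF CV])
  have eV: "e \<in> edg V" using e(1) edg_mono[OF S] by blast
  have Cn: "set C \<noteq> {}" "set C \<subseteq> S" using C by (auto simp: cyc_def gpath_def)
  have cs: "f \<subseteq> set C" if "f \<in> cedges C" for f
    using that pedges_subset[of f C] Cn unfolding cedges_def by auto
  have \<Omega>d: "\<Omega> \<inter> img (cedges C) = {}" using \<Omega> inside_no_overlap outside_no_overlap by blast
  then have en: "e \<notin> cedges C" using mid_in_img_iff[OF ce eV] e(2) by blast
  show ?thesis
  proof (cases "e \<subseteq> set C")
    case True
    obtain a b where ab: "e = {a, b}" "a \<in> S" "b \<in> S" "E a b" "a \<noteq> b" using e(1) by (rule edg_E)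
    show ?thesis
      by (rule that[of a b "[]"]) (use ab True en e in \<open>auto simp: gpath_def\<close>)
  next
    case False
    then obtain x where x: "x \<in> e" "x \<notin> set C" by blast
    then obtain y where y: "e = {x, y}" using edg_other[OF e(1)] by blast
    have xS: "x \<in> S" using e(1) y by (simp add: edg_iff)
    have px: "pt x \<in> \<Omega>" using side_step[OF CV \<Omega>, of x y] x y e eV by simp
    define R where "R = (\<lambda>u v. E u v \<and> v \<in> S - set C)"
    define X where "X = {z. R\<^sup>*\<^sup>* x z}"
    have X: "z \<in> S - set C \<and> pt z \<in> \<Omega>" if "z \<in> X" for z
      using that unfolding X_def mem_Collect_eq
    proof (induction rule: rtranclp_induct)
      case base
      then show ?case using x xS px by simp
    next
      case (step u v)
      then have uv: "E u v" "v \<in> S - set C" "u \<in> S - set C" by (auto simp: R_def)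
      then have "{u, v} \<in> edg V" "{v, u} \<in> edg V" using S sym by (auto simp: edg_iff)
      then show ?case using side_step[OF CV \<Omega>, of u v] side_step[OF CV \<Omega>, of v u] uv step by (auto simp: insert_commute)
    qed
    define N where "N = {z \<in> set C. \<exists>w\<in>X. E w z}"
    have closed: "\<forall>w\<in>X. \<forall>z\<in>S. E w z \<longrightarrow> z \<in> X \<union> N"
    proof (intro ballI impI)
      fix w z assume wz: "w \<in> X" "z \<in> S" "E w z"
      show "z \<in> X \<union> N"
      proof (cases "z \<in> set C")
        case False
        then have "R w z" using wz by (simp add: R_def)
        then show ?thesis using wz(1) unfolding X_def by (simp add: rtranclp.rtrancl_into_rtrancl)
      qed (use wz N_def in blast)
    qed
    have "x \<in> X" by (simp add: X_def)
    then have Xp: "X \<noteq> {}" "X \<subseteq> S - set C" "N \<subseteq> set C" using X N_def by blast+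
    have "\<not> card N \<le> 1"
    proof
      assume "card N \<le> 1"
      then have "isolable S C" unfolding isolable_def using Xp closed by (intro exI[of _ X] exI[of _ N] conjI)
      then show False using no by contradiction
    qed
    moreover have "finite N" unfolding N_def by simp
    ultimately obtain a b where ab: "a \<in> N" "b \<in> N" "a \<noteq> b"
      by (metis One_nat_def card_le_Suc0_iff_eq)
    obtain xa xb where xab: "xa \<in> X" "E xa a" "xb \<in> X" "E xb b" using ab by (auto simp: N_def)
    have Rsym: "R v u" if "R u v" "u \<in> S - set C" for u v using that sym by (auto simp: R_def)
    have "R\<^sup>*\<^sup>* z x" if "z \<in> X" for z
      using that unfolding X_def mem_Collect_eq
    proof (induction rule: rtranclp_induct)
      case (step u v)
      then have "u \<in> X" by (simp add: X_def)
      then have "R v u" using Rsym[of u v] step X by blast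
      then show ?case using step by (meson converse_rtranclp_into_rtranclp)
    qed simp
    then have "R\<^sup>*\<^sup>* xa xb" using xab(1,3) unfolding X_def by (meson mem_Collect_eq rtranclp_trans)
    then obtain rs where rs: "rs \<noteq> []" "hd rs = xa" "last rs = xb" "distinct rs" "successively R rs"
      using rtranclp_distinct_path by metis
    have rsX: "set rs \<subseteq> X"
    proof -
      have "hd rs \<in> X \<Longrightarrow> successively R rs \<Longrightarrow> set rs \<subseteq> X" if "rs \<noteq> []" for rs
        using that
      proof (induction rs rule: induct_list012)
        case (3 u v zs)
        then have "R u v" "u \<in> X" by simp_all
        then have "v \<in> X" unfolding X_def by (simp add: rtranclp.rtrancl_into_rtrancl)
        then show ?case using 3 by simp
      qed auto
      then show ?thesis using rs xab by blast
    qed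
    have sE: "successively E rs" using rs(5) by (rule successively_mono) (simp add: R_def)
    have abC: "a \<in> set C" "b \<in> set C" using ab by (auto simp: N_def)
    have rsC: "set rs \<subseteq> S" "set rs \<inter> set C = {}" using rsX X by blast+
    have gp: "gpath S (a # rs @ [b])"
      using sE rs abC rsC xab Cn ab sym[OF xab(2)] unfolding gpath_def
      by (auto simp: successively_append_iff successively_Cons)
    \<comment> \<open>Every edge of the ear has an end off the cycle: the only exception could be
      the edge between \<open>a\<close> and \<open>b\<close>, which is not on a path with inner
      vertices.\<close>
    have nosub: "\<exists>u v. f = {u, v} \<and> u \<in> set rs" if f: "f \<in> pedges (a # rs @ [b])" for f
    proof -
      have "f \<in> edg S" using f gp pedges_edg[of "a # rs @ [b]" S] unfolding gpath_def by blast
      then obtain u v where uv: "f = {u, v}" "u \<noteq> v" by (rule edg_E)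
      have "f \<noteq> {a, b}" using pedges_ends[of a b rs] f gp rs(1) by (auto simp: gpath_def)
      moreover have "f \<subseteq> set (a # rs @ [b])" by (rule pedges_subset[OF f])
      ultimately have "u \<in> set rs \<or> v \<in> set rs" using uv by auto
      then show ?thesis using uv by (metis insert_commute)
    qed
    show ?thesis
    proof (rule that[OF abC ab(3) gp rsC(2)])
      show "pedges (a # rs @ [b]) \<inter> cedges C = {}" using nosub cs rsC(2) by blast
      fix f assume f: "f \<in> pedges (a # rs @ [b])"
      then obtain u v where uv: "f = {u, v}" "u \<in> set rs" using nosub by blast
      have "f \<in> edg V" using f gp pedges_edg[of "a # rs @ [b]" S] edg_mono[OF S] unfolding gpath_def by blast
      then show "mid f \<in> \<Omega>" using side_step[OF CV \<Omega>, of u v] uv rsX X rsC by blast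
    qed
  qed
qed

lemma ear_theta:
  assumes S: "S \<subseteq> V" and C: "cyc S C" and no: "\<not> isolable S C"
    and \<Omega>: "\<Omega> = inside (img (cedges C)) \<or> \<Omega> = outside (img (cedges C))"
    and e: "e \<in> edg S" "mid e \<in> \<Omega>"
  obtains a b ps qs rs C1 C2 where "theta S a b ps qs rs" "cyc S C1" "cyc S C2"
    "cedges C = pedges (a # ps @ [b]) \<union> pedges (a # qs @ [b])"
    "cedges C1 = pedges (a # ps @ [b]) \<union> pedges (a # rs @ [b])"
    "cedges C2 = pedges (a # qs @ [b]) \<union> pedges (a # rs @ [b])"
    "length C = 2 + length ps + length qs"
    "length C1 = 2 + length ps + length rs" "length C2 = 2 + length qs + length rs"
    "\<And>f. f \<in> pedges (a # rs @ [b]) \<Longrightarrow> mid f \<in> \<Omega>"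
proof -
  obtain a b rs where r: "a \<in> set C" "b \<in> set C" "a \<noteq> b" "gpath S (a # rs @ [b])" "set rs \<inter> set C = {}"
    "pedges (a # rs @ [b]) \<inter> cedges C = {}" "\<And>f. f \<in> pedges (a # rs @ [b]) \<Longrightarrow> mid f \<in> \<Omega>"
    using ear[OF assms] by metis
  obtain ps qs where s: "gpath S (a # ps @ [b])" "gpath S (a # qs @ [b])"
    "distinct (a # b # ps @ qs)" "set C = {a, b} \<union> set ps \<union> set qs" "length C = 2 + length ps + length qs"
    "cedges C = pedges (a # ps @ [b]) \<union> pedges (a # qs @ [b])"
    using cyc_split[OF C r(1-3)] by metis
  have l: "ps \<noteq> [] \<or> qs \<noteq> []" using s(5) C by (auto simp: cyc_def)
  have l1: "ps \<noteq> [] \<or> rs \<noteq> []" and l2: "qs \<noteq> [] \<or> rs \<noteq> []" using r(6) s(6) by auto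
  have th: "theta S a b ps qs rs" unfolding theta_def using s r l l1 l2 by (auto simp: gpath_def)
  have d1: "distinct (a # b # ps @ rs)" "distinct (a # b # qs @ rs)" using th by (auto simp: theta_def)
  show ?thesis
    by (rule that[OF th cyc_join(1)[OF s(1) r(4) d1(1) l1] cyc_join(1)[OF s(2) r(4) d1(2) l2] s(6)
      cyc_join(2)[OF s(1) r(4) d1(1) l1] cyc_join(2)[OF s(2) r(4) d1(2) l2] s(5) _ _ r(7)]) auto
qed

section \<open>Counting edges of a plane graph\<close>

lemma finite_Ein_Vin: "finite S \<Longrightarrow> finite (Ein S C)" "finite S \<Longrightarrow> finite (Vin S C)"
  using finite_edg[of S] by (auto simp: Ein_def Vin_def)

lemma theta_mono: "theta S a b ps qs rs \<Longrightarrow> S \<subseteq> T \<Longrightarrow> theta T a b ps qs rs"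
  using gpath_mono unfolding theta_def by blast

text \<open>An ear with \<open>r\<close> inner vertices adds \<open>r + 1\<close> edges and
  \<open>r\<close> vertices to the interior and turns a cycle of length \<open>2 + p + q\<close>
  into cycles of lengths \<open>2 + p + r\<close> and \<open>2 + q + r\<close>. With these numbers
  the sum of the two induction hypotheses is the claim without loss. Girth is used only when the
  interior has no edges.\<close>

lemma inside_bound:
  assumes S: "S \<subseteq> V" and no: "\<And>C. cyc S C \<Longrightarrow> \<not> isolable S C"
    and g: "\<And>C. cyc S C \<Longrightarrow> 11 \<le> length C" and C: "cyc S C"
  shows "9 * card (Ein S C) + 11 \<le> length C + 11 * card (Vin S C)"
  using C
proof (induction "card (Ein S C)" arbitrary: C rule: less_induct)
  case less
  have fin: "finite S" using S finite_V finite_subset by blast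
  note finE = finite_Ein_Vin(1)[OF fin] and finV = finite_Ein_Vin(2)[OF fin]
  show ?case
  proof (cases "Ein S C = {}")
    case True
    then show ?thesis using g[OF less.prems] by simp
  next
    case False
    then obtain e where e: "e \<in> edg S" "mid e \<in> inside (img (cedges C))" by (auto simp: Ein_def)
    obtain a b ps qs rs C1 C2 where t: "theta S a b ps qs rs" and c1: "cyc S C1" and c2: "cyc S C2"
      and ce: "cedges C = pedges (a # ps @ [b]) \<union> pedges (a # qs @ [b])"
        "cedges C1 = pedges (a # ps @ [b]) \<union> pedges (a # rs @ [b])"
        "cedges C2 = pedges (a # qs @ [b]) \<union> pedges (a # rs @ [b])"
      and len: "length C = 2 + length ps + length qs"
        "length C1 = 2 + length ps + length rs" "length C2 = 2 + length qs + length rs"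
      and r: "\<And>f. f \<in> pedges (a # rs @ [b]) \<Longrightarrow> mid f \<in> inside (img (cedges C))"
      using ear_theta[OF S less.prems no[OF less.prems] _ e] by metis
    let ?Q = "a # rs @ [b]"
    have tV: "theta V a b ps qs rs" by (rule theta_mono[OF t S])
    have Qe: "pedges ?Q \<subseteq> edg S" using t pedges_edg[of ?Q S] unfolding theta_def gpath_def by blast
    then have QV: "pedges ?Q \<subseteq> edg V" using edg_mono[OF S] by blast
    have Qne: "pedges ?Q \<noteq> {}" using Union_pedges[of ?Q] by fastforce
    then obtain f where f: "f \<in> pedges ?Q" by blast
    then have "mid f \<in> img (pedges ?Q) \<inter> inside (img (cedges C))"
      using r[OF f] mid_in_img_iff[OF QV, of f] QV by blast
    then have meets: "img (pedges ?Q) \<inter> inside (img (cedges C)) \<noteq> {}" by blast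
    note ti = theta_inside[OF tV ce(1)[THEN arg_cong[where f=img], unfolded img_Un]
       ce(2)[THEN arg_cong[where f=img], unfolded img_Un] ce(3)[THEN arg_cong[where f=img], unfolded img_Un] meets]
    have dQ: "inside (img (cedges C1)) \<inter> img (pedges ?Q) = {}" "inside (img (cedges C2)) \<inter> img (pedges ?Q) = {}"
      using inside_no_overlap[of "img (cedges C1)"] inside_no_overlap[of "img (cedges C2)"] unfolding ce img_Un by blast+
    have ndQ: "distinct ?Q" using t by (auto simp: theta_def gpath_def)
    \<comment> \<open>The division of the interior omits the two branch points from the ear. No
      midpoint is a branch point, so no edge is lost in the count.\<close>
    have midab: "mid e \<noteq> pt a \<and> mid e \<noteq> pt b" if "e \<in> edg S" for e
    proof -
      have "e \<in> edg V" using that edg_mono[OF S] by blast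
      then have "mid e \<notin> pt ` V" using mid_interior[of e] edge_verts[of e] by blast
      moreover have "a \<in> V" "b \<in> V" using tV by (auto simp: theta_def gpath_def)
      ultimately show ?thesis by blast
    qed
    have Ei: "Ein S C = Ein S C1 \<union> Ein S C2 \<union> pedges ?Q"
    proof -
      have "mid e \<in> img (pedges ?Q) \<longleftrightarrow> e \<in> pedges ?Q" if "e \<in> edg S" for e
        using mid_in_img_iff[OF QV, of e] that edg_mono[OF S] by blast
      then show ?thesis using midab Qe unfolding Ein_def ti(2) by blast
    qed
    have Vi: "Vin S C = Vin S C1 \<union> Vin S C2 \<union> set rs"
    proof -
      have "pt v \<in> img (pedges ?Q) - {pt a, pt b} \<longleftrightarrow> v \<in> set rs" if "v \<in> S" for v
      proof -
        have "pt v \<in> img (pedges ?Q) \<longleftrightarrow> v \<in> set ?Q"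
          using pt_in_img_iff[OF QV, of v] Union_pedges[of ?Q] that S by auto
        moreover have "a \<in> V" "b \<in> V" "v \<in> V" using tV that S by (auto simp: theta_def gpath_def)
        then have "pt v = pt a \<longleftrightarrow> v = a" "pt v = pt b \<longleftrightarrow> v = b"
          using inj_pt by (auto simp: inj_on_eq_iff)
        ultimately show ?thesis using ndQ by auto
      qed
      moreover have "set rs \<subseteq> S" using t by (auto simp: theta_def gpath_def)
      ultimately show ?thesis unfolding Vin_def ti(2) by blast
    qed
    have disE: "Ein S C1 \<inter> Ein S C2 = {}" "(Ein S C1 \<union> Ein S C2) \<inter> pedges ?Q = {}"
      using ti(1) dQ mid_in_img_iff[OF QV] QV unfolding Ein_def by blast+
    have disV: "Vin S C1 \<inter> Vin S C2 = {}" "(Vin S C1 \<union> Vin S C2) \<inter> set rs = {}"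
    proof -
      show "Vin S C1 \<inter> Vin S C2 = {}" using ti(1) unfolding Vin_def by blast
      have "pt v \<in> img (pedges ?Q)" if "v \<in> set rs" for v
        using pt_in_img_iff[OF QV, of v] Union_pedges[of ?Q] that tV by (auto simp: theta_def gpath_def)
      then show "(Vin S C1 \<union> Vin S C2) \<inter> set rs = {}" using dQ unfolding Vin_def by blast
    qed
    have cE: "card (Ein S C) = card (Ein S C1) + card (Ein S C2) + (length rs + 1)"
      unfolding Ei using card_Un_disjoint[OF _ _ disE(1)] card_Un_disjoint[OF _ _ disE(2)]
        finE finite_pedges[of ?Q] card_pedges[OF ndQ] by simp
    have cV: "card (Vin S C) = card (Vin S C1) + card (Vin S C2) + length rs"
      unfolding Vi using card_Un_disjoint[OF _ _ disV(1)] card_Un_disjoint[OF _ _ disV(2)]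
        finV ndQ by (simp add: distinct_card)
    have "9 * card (Ein S C1) + 11 \<le> length C1 + 11 * card (Vin S C1)"
      by (rule less.hyps[OF _ c1]) (simp add: cE)
    moreover have "9 * card (Ein S C2) + 11 \<le> length C2 + 11 * card (Vin S C2)"
      by (rule less.hyps[OF _ c2]) (simp add: cE)
    ultimately show ?thesis unfolding cE cV len by simp
  qed
qed

text \<open>If an edge lay outside a cycle with maximal interior, there would be an ear outside, and
  by \<open>theta_outside\<close> one of the two cycles through this ear would have an interior at
  least as large, hence the same interior and the same curve. But it contains edges with midpoints
  outside.\<close>

lemma outer_cycle:
  assumes S: "S \<subseteq> V" and no: "\<And>C. cyc S C \<Longrightarrow> \<not> isolable S C" and ex: "\<exists>C. cyc S C"
  shows "\<exists>C. cyc S C \<and> (\<forall>e \<in> edg S. e \<in> cedges C \<or> e \<in> Ein S C)"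
proof -
  have fin: "finite S" using S finite_V finite_subset by blast
  let ?F = "(\<lambda>C. inside (img (cedges C))) ` {C. cyc S C}"
  obtain I where I: "I \<in> ?F" "\<And>J. J \<in> ?F \<Longrightarrow> I \<subseteq> J \<Longrightarrow> I = J"
    using finite_has_maximal[of ?F] finite_cycs[OF fin] ex by blast
  then obtain C where C: "cyc S C" "I = inside (img (cedges C))" by blast
  have CV: "cyc V C" by (rule cyc_mono[OF C(1) S])
  obtain h where h: "simple_path h" "pathfinish h = pathstart h" "path_image h = img (cedges C)"
    using cyc_curve[OF CV] by blast
  note J = Jordan_inside_outside[OF h(1,2), unfolded h(3)]
  have "e \<in> cedges C \<or> e \<in> Ein S C" if e: "e \<in> edg S" for e
  proof (rule ccontr)
    assume n: "\<not> ?thesis"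
    have "mid e \<notin> img (cedges C)" using mid_in_img_iff[OF cedges_edg[OF CV], of e] n e edg_mono[OF S] by blast
    then have "mid e \<in> outside (img (cedges C))" using n e J unfolding Ein_def by blast
    then obtain a b ps qs rs C1 C2 where t: "theta S a b ps qs rs" and c1: "cyc S C1" and c2: "cyc S C2"
      and ce: "cedges C = pedges (a # ps @ [b]) \<union> pedges (a # qs @ [b])"
        "cedges C1 = pedges (a # ps @ [b]) \<union> pedges (a # rs @ [b])"
        "cedges C2 = pedges (a # qs @ [b]) \<union> pedges (a # rs @ [b])"
      and r: "\<And>f. f \<in> pedges (a # rs @ [b]) \<Longrightarrow> mid f \<in> outside (img (cedges C))"
      using ear_theta[OF S C(1) no[OF C(1)] _ e] by metis
    let ?Q = "a # rs @ [b]"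
    have tV: "theta V a b ps qs rs" by (rule theta_mono[OF t S])
    have QV: "pedges ?Q \<subseteq> edg V" using tV pedges_edg[of ?Q V] unfolding theta_def gpath_def by blast
    have Qne: "pedges ?Q \<noteq> {}" using Union_pedges[of ?Q] by fastforce
    \<comment> \<open>So far only midpoints of the ear are known to be outside. The open edges
      follow because they are connected and miss the curve; a vertex of the ear is on the cycle or
      handled by \<open>side_step\<close>.\<close>
    have dis: "img (pedges ?Q) \<inter> inside (img (cedges C)) = {}"
    proof -
      have "path_image (\<gamma> f) \<inter> inside (img (cedges C)) = {}" if f: "f \<in> pedges ?Q" for f
      proof -
        have "mid f \<notin> img (cedges C)" "mid f \<notin> inside (img (cedges C))" using r[OF f] J by blast+
        have fV: "f \<in> edg V" using f QV by blast
        have fn: "f \<notin> cedges C" using mid_in_img_iff[OF cedges_edg[OF CV] fV] \<open>mid f \<notin> img (cedges C)\<close> by blast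
        let ?K = "path_image (\<gamma> f) - pt ` f"
        have "?K \<inter> img (cedges C) = {}"
        proof -
          have "?K \<inter> path_image (\<gamma> f') = {}" if "f' \<in> cedges C" for f'
            using edge_disj[OF fV, of f'] that cedges_edg[OF CV] fn by auto
          then show ?thesis unfolding img_def by blast
        qed
        moreover have "topological_space_class.connected ?K" unfolding edge_interior[OF fV]
          by (rule connected_continuous_image)
            (use arc_edge[OF fV] in \<open>auto simp: arc_def path_def intro: continuous_on_subset\<close>)
        ultimately have K: "?K \<inter> inside (img (cedges C)) = {}"
          using connectedD[of ?K "inside (img (cedges C))" "outside (img (cedges C))"] J r[OF f] mid_interior[OF fV] by blast
        moreover have "pt v \<notin> inside (img (cedges C))" if vf: "v \<in> f" for v
        proof (cases "v \<in> set C")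
          case True
          have "\<Union> (cedges C) = set C" using Union_pedges[of C] CV by (auto simp: cedges_def cyc_def gpath_def)
          then have "pt v \<in> img (cedges C)"
            using pt_in_img_iff[OF cedges_edg[OF CV], of v] True vf edg_subset[OF fV] by blast
          then show ?thesis using inside_no_overlap by blast
        next
          case False
          obtain u where "f = {v, u}" using edg_other[OF fV vf] by blast
          then show ?thesis using side_step[OF CV, of "inside (img (cedges C))" v u] fV False
              \<open>mid f \<notin> inside (img (cedges C))\<close> by simp
        qed
        ultimately show ?thesis by blast
      qed
      then show ?thesis unfolding img_def by blast
    qed
    have "I \<subseteq> inside (img (cedges C1)) \<or> I \<subseteq> inside (img (cedges C2))"
      unfolding C(2)
      by (rule theta_outside[OF tV CV cyc_mono[OF c1 S] cyc_mono[OF c2 S] ce(1)[THEN arg_cong[where f=img], unfolded img_Un]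
       ce(2)[THEN arg_cong[where f=img], unfolded img_Un] ce(3)[THEN arg_cong[where f=img], unfolded img_Un] dis])
    then obtain D where D: "cyc S D" "pedges ?Q \<subseteq> cedges D" "I \<subseteq> inside (img (cedges D))" using c1 c2 ce by blast
    then have eq: "inside (img (cedges C)) = inside (img (cedges D))" using I(2) C(2) by blast
    obtain k where k: "simple_path k" "pathfinish k = pathstart k" "path_image k = img (cedges D)"
      using cyc_curve[OF cyc_mono[OF D(1) S]] by blast
    \<comment> \<open>The curve is recovered as the frontier of its interior.\<close>
    have "img (cedges C) = img (cedges D)"
      using J Jordan_inside_outside[OF k(1,2), unfolded k(3)] eq by metis
    moreover obtain f where f: "f \<in> pedges ?Q" using Qne by blast
    have "mid f \<in> img (cedges D)"
      using f D(2) QV mid_in_img_iff[OF cedges_edg[OF cyc_mono[OF D(1) S]], of f] by blast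
    ultimately show False using r[OF f] J by blast
  qed
  then show ?thesis using C(1) by blast
qed

text \<open>Removing a vertex of degree at most 1 costs 9 and gains 11. Splitting at an isolable
  part counts at most one vertex twice, and this 11 is paid by the second additive constant.
  Otherwise some cycle encloses everything, and \<open>|C|\<close> is added to the edges and
  vertices of its interior.\<close>

theorem edge_bound:
  assumes "S \<subseteq> V" "S \<noteq> {}" and "\<And>C. cyc V C \<Longrightarrow> 11 \<le> length C"
  shows "9 * card (edg S) + 11 \<le> 11 * card S"
  using assms(1,2)
proof (induction "card S" arbitrary: S rule: less_induct)
  case less
  have fin: "finite S" using less.prems(1) finite_V finite_subset by blast
  show ?case
  proof (cases "\<forall>v\<in>S. 2 \<le> card (nbrs S v)")
    case False
    then obtain v where v: "v \<in> S" "card (nbrs S v) \<le> 1" by force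
    have "edg S \<subseteq> edg (S - {v}) \<union> (\<lambda>u. {v, u}) ` nbrs S v"
    proof
      fix e assume "e \<in> edg S"
      then obtain x y where xy: "e = {x, y}" "x \<in> S" "y \<in> S" "E x y" "x \<noteq> y" by (rule edg_E)
      show "e \<in> edg (S - {v}) \<union> (\<lambda>u. {v, u}) ` nbrs S v"
      proof (cases "v \<in> e")
        case True
        then show ?thesis using xy sym[of x y] unfolding nbrs_def by auto
      next
        case False
        then show ?thesis using xy by (auto simp: edg_iff)
      qed
    qed
    then have "card (edg S) \<le> card (edg (S - {v}) \<union> (\<lambda>u. {v, u}) ` nbrs S v)"
      using fin finite_edg[of "S - {v}"] by (intro card_mono) (auto simp: nbrs_def)
    also have "\<dots> \<le> card (edg (S - {v})) + card (nbrs S v)"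
      using card_Un_le[of "edg (S - {v})" "(\<lambda>u. {v, u}) ` nbrs S v"] card_image_le[of "nbrs S v" "\<lambda>u. {v,u}"] fin
      by (simp add: nbrs_def)
    finally have le: "card (edg S) \<le> card (edg (S - {v})) + card (nbrs S v)" .
    have cS: "card S = Suc (card (S - {v}))" using card.remove[OF fin v(1)] by simp
    show ?thesis
    proof (cases "S - {v} = {}")
      case True
      then have "nbrs S v = {}" using irrefl v by (auto simp: nbrs_def)
      moreover have "edg (S - {v}) = {}" unfolding True by (simp add: edg_def)
      ultimately show ?thesis using le cS by simp
    next
      case ne: False
      have "9 * card (edg (S - {v})) + 11 \<le> 11 * card (S - {v})"
        using less.hyps[of "S - {v}"] ne cS less.prems by auto
      then show ?thesis using le v(2) cS by linarith
    qed
  next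
    case True
    have ex: "\<exists>C. cyc S C" using min_degree_two_imp_cyc[OF fin less.prems(2)] True by blast
    show ?thesis
    proof (cases "\<exists>C. cyc S C \<and> isolable S C")
      case True
      then obtain C X N where C: "cyc S C" and X: "X \<noteq> {}" "X \<subseteq> S - set C" "N \<subseteq> set C" "card N \<le> 1"
        "\<And>x y. x \<in> X \<Longrightarrow> y \<in> S \<Longrightarrow> E x y \<Longrightarrow> y \<in> X \<union> N" unfolding isolable_def by blast
      have CS: "set C \<subseteq> S" "distinct C" "3 \<le> length C" using C by (auto simp: cyc_def gpath_def)
      then have "card (set C) \<ge> 3" by (simp add: distinct_card)
      then have "\<not> set C \<subseteq> N" using X(4) card_mono[of N "set C"] finite_subset[OF X(3)] by auto
      then have sub: "X \<union> N \<subset> S" "S - X \<subset> S" "S - X \<noteq> {}" using X CS by blast+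
      have "edg S \<subseteq> edg (X \<union> N) \<union> edg (S - X)"
      proof
        fix e assume "e \<in> edg S"
        then obtain x y where xy: "e = {x, y}" "x \<in> S" "y \<in> S" "E x y" "x \<noteq> y" by (rule edg_E)
        then show "e \<in> edg (X \<union> N) \<union> edg (S - X)"
          using X(5)[of x y] X(5)[of y x] sym[of x y] by (cases "x \<in> X \<or> y \<in> X") (auto simp: edg_iff)
      qed
      then have "card (edg S) \<le> card (edg (X \<union> N) \<union> edg (S - X))"
        using fin sub finite_subset finite_edg by (intro card_mono) (blast intro: finite_edg finite_subset)+
      then have e: "card (edg S) \<le> card (edg (X \<union> N)) + card (edg (S - X))"
        using card_Un_le[of "edg (X \<union> N)" "edg (S - X)"] by linarith
      have i1: "9 * card (edg (X \<union> N)) + 11 \<le> 11 * card (X \<union> N)"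
        using less.hyps[of "X \<union> N"] psubset_card_mono[OF fin sub(1)] sub less.prems X(1) by blast
      have i2: "9 * card (edg (S - X)) + 11 \<le> 11 * card (S - X)"
        using less.hyps[of "S - X"] psubset_card_mono[OF fin sub(2)] sub less.prems by blast
      have "card (X \<union> N) \<le> card X + 1" using card_Un_le[of X N] X(4) by linarith
      moreover have "card (S - X) + card X = card S"
        using X(2) fin by (metis Diff_subset card_Diff_subset card_mono finite_subset le_add_diff_inverse2 subset_trans)
      ultimately show ?thesis using e i1 i2 by linarith
    next
      case no: False
      obtain C where C: "cyc S C" "\<And>e. e \<in> edg S \<Longrightarrow> e \<in> cedges C \<or> e \<in> Ein S C"
        using outer_cycle[OF less.prems(1) _ ex] no by blast
      have CV: "cyc V C" by (rule cyc_mono[OF C(1) less.prems(1)])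
      have b: "9 * card (Ein S C) + 11 \<le> length C + 11 * card (Vin S C)"
        using inside_bound[OF less.prems(1) _ _ C(1)] no assms(3) cyc_mono[OF _ less.prems(1)] by blast
      have cs: "f \<subseteq> set C" if "f \<in> cedges C" for f
        using that pedges_subset[of f C] C(1) unfolding cedges_def cyc_def gpath_def by auto
      have "S \<subseteq> set C \<union> Vin S C"
      proof
        fix v assume v: "v \<in> S"
        show "v \<in> set C \<union> Vin S C"
        proof (cases "v \<in> set C")
          case False
          have "nbrs S v \<noteq> {}" using True v by fastforce
          then obtain u where "u \<in> S" "E v u" by (auto simp: nbrs_def)
          then have e: "{v, u} \<in> edg S" using v by (simp add: edg_iff)
          then have "mid {v, u} \<in> inside (img (cedges C))" using C(2)[OF e] cs False by (auto simp: Ein_def)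
          then show ?thesis using side_step[OF CV, of "inside (img (cedges C))" v u] e edg_mono[OF less.prems(1)] False v
            by (auto simp: Vin_def)
        qed simp
      qed
      moreover have "set C \<subseteq> S" using C(1) by (simp add: cyc_def gpath_def)
      moreover have "Vin S C \<inter> set C = {}"
      proof -
        have "\<Union> (cedges C) = set C" using Union_pedges[of C] CV by (auto simp: cedges_def cyc_def gpath_def)
        then have "pt v \<in> img (cedges C)" if "v \<in> set C" for v
          using pt_in_img_iff[OF cedges_edg[OF CV], of v] that CV by (auto simp: cyc_def gpath_def)
        then show ?thesis using inside_no_overlap[of "img (cedges C)"] unfolding Vin_def by blast
      qed
      ultimately have "S = set C \<union> Vin S C" "set C \<inter> Vin S C = {}" by (auto simp: Vin_def)
      then have cS: "card S = length C + card (Vin S C)"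
        using card_Un_disjoint[of "set C" "Vin S C"] finite_Ein_Vin(2)[OF fin, of C] C(1)
        by (simp add: distinct_card cyc_def gpath_def)
      have "card (edg S) \<le> card (cedges C \<union> Ein S C)"
        using C(2) finite_Ein_Vin(1)[OF fin, of C] finite_pedges[of C] by (intro card_mono) (auto simp: cedges_def)
      then have "card (edg S) \<le> length C + card (Ein S C)"
        using card_Un_le[of "cedges C" "Ein S C"] card_cedges[OF C(1)] by linarith
      moreover have "11 \<le> length C" using assms(3)[OF CV] .
      ultimately show ?thesis using b cS by linarith
    qed
  qed
qed

end

section \<open>Colouring threads\<close>

datatype col = C0 | C1 | C2 | C3

lemma UNIV_col: "UNIV = {C0, C1, C2, C3}"
  using col.exhaust by blast

lemma finite_col [simp]: "finite (A :: col set)"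
proof (rule finite_subset)
  show "A \<subseteq> {C0, C1, C2, C3}" using UNIV_col by blast
qed simp

lemma card_col: "card (UNIV :: col set) = 4"
  unfolding UNIV_col by simp

lemma ex_col: "(\<exists>x. P x) \<longleftrightarrow> P C0 \<or> P C1 \<or> P C2 \<or> P C3"
  by (metis col.exhaust)

lemma col_avoid: "\<exists>x. x \<noteq> p \<and> x \<noteq> q \<and> x \<noteq> (r :: col)"
  unfolding ex_col by (cases p; cases q; cases r; simp)

lemma exists_col_notin: "card (K :: col set) \<le> 3 \<Longrightarrow> \<exists>x. x \<notin> K"
  using card_col by (metis UNIV_eq_I numeral_le_iff semiring_norm(69) semiring_norm(72))

definition uniq :: "'a set \<Rightarrow> ('a \<Rightarrow> col) \<Rightarrow> bool" where
  "uniq N c \<longleftrightarrow> (\<exists>v\<in>N. \<forall>u\<in>N. u \<noteq> v \<longrightarrow> c u \<noteq> c v)"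

text \<open>\<open>opts k c t x a\<close>: a path with \<open>k\<close> inner vertices of degree 2 whose ends have colours \<open>x\<close>
  and \<open>c\<close> can be coloured such that the neighbour of the first end gets colour \<open>a\<close> and the
  neighbour of the second end does not get colour \<open>t\<close>.\<close>

definition opts :: "nat \<Rightarrow> col \<Rightarrow> col \<Rightarrow> col \<Rightarrow> col \<Rightarrow> bool" where
  "opts k c t x a \<longleftrightarrow> (\<exists>f. f 0 = x \<and> f (Suc 0) = a \<and> f (Suc k) = c \<and> f k \<noteq> t \<and>
     (\<forall>i\<le>k. f i \<noteq> f (Suc i)) \<and> (\<forall>i<k. f i \<noteq> f (Suc (Suc i))))"

lemma opts_neq: "opts k c t x a \<Longrightarrow> a \<noteq> x"
  unfolding opts_def by fastforce

lemma all_le_Suc: "(\<forall>i\<le>Suc k. P i) \<longleftrightarrow> P 0 \<and> (\<forall>i\<le>k. P (Suc i))"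
  by (metis Suc_le_mono not0_implies_Suc zero_le)

text \<open>Without inner vertices the centre itself is the neighbour of the end: \<open>t\<close>
  restricts \<open>x\<close>, and the colour seen by the centre is forced.\<close>

lemma opts_0: "x \<noteq> c \<Longrightarrow> x \<noteq> t \<Longrightarrow> opts 0 c t x c"
  unfolding opts_def by (rule exI[of _ "\<lambda>i. if i = 0 then x else c"]) auto

lemma opts_1: "x \<noteq> c \<Longrightarrow> a \<noteq> x \<Longrightarrow> a \<noteq> c \<Longrightarrow> a \<noteq> t \<Longrightarrow> opts 1 c t x a"
  unfolding opts_def by (rule exI[of _ "\<lambda>i. if i = 0 then x else if i = 1 then a else c"]) (auto simp: all_le_Suc)

lemma opts_2: "a \<noteq> x \<Longrightarrow> a \<noteq> c \<Longrightarrow> b \<noteq> x \<Longrightarrow> b \<noteq> a \<Longrightarrow> b \<noteq> c \<Longrightarrow> b \<noteq> t \<Longrightarrow> opts 2 c t x a"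
  unfolding opts_def
  by (rule exI[of _ "\<lambda>i. if i = 0 then x else if i = 1 then a else if i = 2 then b else c"])
    (auto simp: all_le_Suc All_less_Suc2 numeral_2_eq_2)

lemma opts_3:
  "a \<noteq> x \<Longrightarrow> b \<noteq> a \<Longrightarrow> b \<noteq> x \<Longrightarrow> b \<noteq> c \<Longrightarrow> d \<noteq> a \<Longrightarrow> d \<noteq> b \<Longrightarrow> d \<noteq> c \<Longrightarrow> d \<noteq> t \<Longrightarrow> opts 3 c t x a"
  unfolding opts_def
  by (rule exI[of _ "\<lambda>i. if i = 0 then x else if i = 1 then a else if i = 2 then b else if i = 3 then d else c"])
    (auto simp: all_le_Suc All_less_Suc2 numeral_3_eq_3 numeral_2_eq_2)

lemma opts_1_ex: "x \<noteq> c \<Longrightarrow> \<exists>a. opts 1 c t x a"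
  using col_avoid[of x c t] opts_1 by blast

lemma opts_2_neq: "opts 2 c t x a \<Longrightarrow> a \<noteq> c"
  unfolding opts_def by (force simp: All_less_Suc2 numeral_2_eq_2)

text \<open>The second inner vertex must avoid \<open>x\<close>, \<open>a\<close>, \<open>c\<close>
  and \<open>t\<close>. If \<open>x = c\<close>, these are at most three colours.\<close>

lemma opts_2_free: "a \<noteq> c \<Longrightarrow> opts 2 c t c a"
  using col_avoid[of a c t] opts_2[of a c c _ t] by blast

text \<open>Here \<open>t\<close> coincides with a colour that the second inner vertex avoids
  anyway.\<close>

lemma opts_2_two: "t = x \<or> t = c \<Longrightarrow> a \<noteq> x \<Longrightarrow> a \<noteq> c \<Longrightarrow> opts 2 c t x a"
  using col_avoid[of a c x] opts_2[of a x c _ t] by blast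

lemma opts_2_ex: "\<exists>a. opts 2 c t x a"
proof -
  obtain b where b: "b \<notin> {x, c, t}" using col_avoid[of "x" "c" "t"] by auto
  obtain a where "a \<notin> {x, c, b}" using col_avoid[of "x" "c" "b"] by auto
  then show ?thesis using b opts_2[of a x c b t] by blast
qed

text \<open>The critical case is that \<open>a\<close>, \<open>c\<close>, \<open>t\<close> are
  distinct: the last inner vertex then takes the fourth colour, and the middle one must be able to
  take \<open>t\<close>, which is possible because \<open>x\<close> is not \<open>t\<close>.\<close>

lemma opts_3_free: "x \<noteq> t \<Longrightarrow> a \<noteq> x \<Longrightarrow> opts 3 c t x a"
proof -
  assume "x \<noteq> t" "a \<noteq> x"
  then have "\<exists>b d. b \<noteq> a \<and> b \<noteq> x \<and> b \<noteq> c \<and> d \<noteq> a \<and> d \<noteq> b \<and> d \<noteq> c \<and> d \<noteq> t"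
    unfolding ex_col by (cases x; cases t; cases a; cases c; simp)
  then show ?thesis using opts_3 \<open>a \<noteq> x\<close> by blast
qed

lemma opts_3_ex: "\<exists>a. opts 3 c t x a"
proof -
  have "\<exists>a b d. a \<noteq> x \<and> b \<noteq> a \<and> b \<noteq> x \<and> b \<noteq> c \<and> d \<noteq> a \<and> d \<noteq> b \<and> d \<noteq> c \<and> d \<noteq> t"
    unfolding ex_col by (cases x; cases t; cases c; simp)
  then show ?thesis using opts_3 by blast
qed

section \<open>Unique colours in a neighbourhood\<close>

text \<open>The forbidden colour \<open>t\<close> is the colour that was unique before the new
  neighbour came. For empty \<open>N\<close> the new neighbour is unique by itself.\<close>

lemma uniq_insert:
  assumes "N = {} \<or> uniq N c" "r \<notin> N"
  shows "\<exists>t. \<forall>c'. (\<forall>u\<in>N. c' u = c u) \<longrightarrow> c' r \<noteq> t \<longrightarrow> uniq (insert r N) c'"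
proof (cases "N = {}")
  case True
  then show ?thesis by (auto simp: uniq_def)
next
  case False
  then obtain v where "v \<in> N" "\<And>u. u \<in> N \<Longrightarrow> u \<noteq> v \<Longrightarrow> c u \<noteq> c v" using assms by (auto simp: uniq_def)
  then show ?thesis by (intro exI[of _ "c v"]) (auto simp: uniq_def intro!: bexI[of _ v])
qed

lemma uniq_insert_two:
  assumes "card N = 2" "uniq N c" "r \<notin> N" "\<And>u. u \<in> N \<Longrightarrow> c' u = c u"
  shows "uniq (insert r N) c'"
proof -
  obtain p q where pq: "N = {p, q}" "p \<noteq> q" using assms(1) by (auto simp: card_2_iff)
  have "c p \<noteq> c q" using assms(2) pq by (auto simp: uniq_def)
  then have ne: "c' p \<noteq> c' q" using assms(4) pq by simp
  show ?thesis
  proof (cases "c' r = c' p")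
    case True
    then show ?thesis using ne pq assms(3) unfolding uniq_def by (intro bexI[of _ q]) auto
  next
    case False
    then show ?thesis using ne pq assms(3) unfolding uniq_def by (intro bexI[of _ p]) auto
  qed
qed

text \<open>Fix colours on \<open>N - F\<close>. Three colours differ from \<open>x\<close>, and
  five vertices cannot use each of them twice, so some colour \<open>k\<close> occurs there at most
  once. If it occurs once, all of \<open>F\<close> avoids it; if it does not occur, exactly one
  vertex of \<open>F\<close> takes it. In both cases \<open>k\<close> is unique.\<close>

lemma free_choice:
  assumes fin: "finite N" and F: "F \<subseteq> N" "F \<noteq> {}" "card (N - F) \<le> 5"
    and ne: "\<And>v. v \<in> N - F \<Longrightarrow> \<exists>a. P v a" and ax: "\<And>v a. P v a \<Longrightarrow> a \<noteq> (x::col)"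
    and free: "\<And>v a. v \<in> F \<Longrightarrow> a \<noteq> x \<Longrightarrow> P v a"
  shows "\<exists>a. (\<forall>v\<in>N. P v (a v)) \<and> uniq N a"
proof -
  obtain a0 where a0: "\<And>v. v \<in> N - F \<Longrightarrow> P v (a0 v)" using ne by metis
  define M where "M k = {v \<in> N - F. a0 v = k}" for k
  have finM: "finite (M k)" for k using fin by (simp add: M_def)
  have "\<exists>k. k \<noteq> x \<and> card (M k) \<le> 1"
  proof (rule ccontr)
    assume "\<not> ?thesis"
    then have 2: "2 \<le> card (M k)" if "k \<noteq> x" for k using that by force
    have "card (\<Union>k\<in>UNIV - {x}. M k) = (\<Sum>k\<in>UNIV - {x}. card (M k))"
      by (rule card_UN_disjoint) (use finM in \<open>auto simp: M_def\<close>)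
    moreover have "(\<Sum>k\<in>UNIV - {x}. 2) \<le> (\<Sum>k\<in>UNIV - {x}. card (M k))" by (rule sum_mono) (use 2 in auto)
    moreover have "(\<Sum>k\<in>UNIV - {x}. 2) = (6 :: nat)" using card_col by (simp add: card_Diff_singleton)
    ultimately have "6 \<le> card (\<Union>k\<in>UNIV - {x}. M k)" by simp
    moreover have "card (\<Union>k\<in>UNIV - {x}. M k) \<le> card (N - F)"
      by (rule card_mono) (use fin in \<open>auto simp: M_def\<close>)
    ultimately show False using F(3) by simp
  qed
  then obtain k where k: "k \<noteq> x" "card (M k) \<le> 1" by blast
  obtain k' where k': "k' \<noteq> k" "k' \<noteq> x" using col_avoid[of "k" "x" "x"] by auto
  show ?thesis
  proof (cases "M k = {}")
    case True
    obtain f where f: "f \<in> F" using F by blast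
    define a where "a v = (if v = f then k else if v \<in> F then k' else a0 v)" for v
    have "\<forall>v\<in>N. P v (a v)" using a0 free f k k' by (auto simp: a_def)
    moreover have "uniq N a" unfolding uniq_def
      using f F True k' by (intro bexI[of _ f]) (auto simp: a_def M_def)
    ultimately show ?thesis by blast
  next
    case False
    then obtain v0 where v0: "M k = {v0}" using k(2) finM by (metis card_le_Suc0_iff_eq One_nat_def all_not_in_conv insertI1 singletonD subsetI subset_antisym)
    then have v0N: "v0 \<in> N - F" "a0 v0 = k" by (auto simp: M_def)
    define a where "a v = (if v \<in> F then k' else a0 v)" for v
    have "\<forall>v\<in>N. P v (a v)" using a0 free k' by (auto simp: a_def)
    moreover have "uniq N a" unfolding uniq_def
    proof (intro bexI[of _ v0] ballI impI)
      fix u assume u: "u \<in> N" "u \<noteq> v0"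
      show "a u \<noteq> a v0"
      proof (cases "u \<in> F")
        case True then show ?thesis using v0N k' by (simp add: a_def)
      next
        case False
        then have "u \<notin> M k" using u v0 by blast
        then show ?thesis using False u v0N by (simp add: a_def M_def)
      qed
    qed (use v0N in simp)
    ultimately show ?thesis by blast
  qed
qed

text \<open>The colours \<open>x\<close> for which \<open>opts k c t x\<close> is empty.\<close>

definition kill :: "nat \<Rightarrow> col \<Rightarrow> col \<Rightarrow> col set" where
  "kill k c t = (if k = 0 then {c, t} else if k = 1 then {c} else {})"

lemma opts_ex:
  assumes "x \<notin> kill k c t" "k \<le> 3"
  shows "\<exists>a. opts k c t x a"
proof -
  consider "k = 0" | "k = 1" | "k = 2" | "k = 3" using assms(2) by linarith
  then show ?thesis
  proof cases
    case 1 then show ?thesis using assms opts_0 by (auto simp: kill_def)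
  next
    case 2 then show ?thesis using assms opts_1_ex by (auto simp: kill_def)
  qed (use opts_2_ex opts_3_ex in auto)
qed

text \<open>\<open>nj\<close> is the number of threads of length \<open>j\<close> at a vertex of
  degree \<open>D\<close>, and \<open>s\<close> their total length. The deficiency
  \<open>3 D - s = n2 + 2 n1 + 3 n0\<close> is at most 5, 3, 2, 1 for \<open>D\<close> = 4, 5, 6, 7.
  The five alternatives are those treated by separate colouring arguments below;
  \<open>2 n0 + n1\<close> bounds the number of colours that the short threads forbid at the
  centre.\<close>

lemma thread_counts:
  fixes D s n0 n1 n2 n3 :: nat
  assumes D: "D = n0 + n1 + n2 + n3" and s: "s = n1 + 2 * n2 + 3 * n3" and "4 \<le> D" "D \<le> 7"
    and h: "D = 4 \<longrightarrow> 7 \<le> s" "D = 5 \<longrightarrow> 12 \<le> s" "D = 6 \<longrightarrow> 16 \<le> s" "D = 7 \<longrightarrow> 20 \<le> s"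
  shows "1 \<le> n3 \<and> 2 * n0 + n1 \<le> 2 \<and> D \<le> 6 \<or> D = 7 \<and> 2 \<le> n3 \<and> n0 = 0 \<and> n1 = 0 \<or>
    D = 4 \<and> n2 = 4 \<or> D = 4 \<and> n2 = 3 \<and> n1 = 1 \<and> s = 7 \<or>
    D = 4 \<and> n3 = 2 \<and> n1 = 1 \<and> n0 = 1 \<and> s = 7"
proof -
  have "s + n2 + 2 * n1 + 3 * n0 = 3 * D" using D s by linarith
  consider "D = 4" | "D = 5" | "D = 6" | "D = 7" using assms(3,4) by linarith
  then show ?thesis
  proof cases
    case 1
    then have le: "n2 + 2 * n1 + 3 * n0 \<le> 5" "n0 + n1 + n2 + n3 = 4" using D s h(1) by linarith+
    then consider "n0 = 0" "1 \<le> n3" | "n0 = 0" "n3 = 0" | "n0 = 1" by linarith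
    then show ?thesis
    proof cases
      case a: 1
      then have "n1 \<le> 2" using le by linarith
      then show ?thesis using a 1 by simp
    next
      case a: 2
      then have "n1 = 0 \<and> n2 = 4 \<or> n1 = 1 \<and> n2 = 3" using le by linarith
      then show ?thesis using a 1 s by auto
    next
      case a: 3
      then have "n1 = 0 \<and> 1 \<le> n3 \<or> n1 = 1 \<and> n2 = 0 \<and> n3 = 2" using le by linarith
      then show ?thesis using a 1 s by auto
    qed
  next
    case 2 then show ?thesis using D s h(2) by auto
  next
    case 3 then show ?thesis using D s h(3) by auto
  next
    case 4 then show ?thesis using D s h(4) by auto
  qed
qed

section \<open>Which configurations of threads can be coloured\<close>

text \<open>Each thread at a vertex is named by its first vertex in \<open>N\<close>;
  \<open>x\<close> is the colour of the centre and \<open>a\<close> gives the colours it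
  sees.\<close>

definition extendable :: "'a set \<Rightarrow> ('a \<Rightarrow> nat) \<Rightarrow> ('a \<Rightarrow> col) \<Rightarrow> ('a \<Rightarrow> col) \<Rightarrow> bool" where
  "extendable N k c t \<longleftrightarrow> (\<exists>x a. (\<forall>v\<in>N. opts (k v) (c v) (t v) x (a v)) \<and> uniq N a)"

context
  fixes N :: "'a set" and k :: "'a \<Rightarrow> nat" and c t :: "'a \<Rightarrow> col"
  assumes fin: "finite N" and k3: "\<And>v. v \<in> N \<Longrightarrow> k v \<le> 3"
begin

abbreviation killed :: "col set" where
  "killed \<equiv> (\<Union>v\<in>N. kill (k v) (c v) (t v))"

text \<open>Only \<open>x\<close> has to be chosen: outside \<open>killed\<close> every thread has
  some colouring, and the threads of \<open>F\<close>, whose first colour is then arbitrary apart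
  from \<open>x\<close>, supply the unique colour at the centre.\<close>

lemma extendable_free:
  assumes "F \<subseteq> N" "F \<noteq> {}" "card (N - F) \<le> 5" "x \<notin> killed"
    and "\<And>v. v \<in> F \<Longrightarrow> k v = 3 \<and> x \<noteq> t v \<or> k v = 2 \<and> x = c v"
  shows "extendable N k c t"
proof -
  have "\<exists>a. (\<forall>v\<in>N. opts (k v) (c v) (t v) x (a v)) \<and> uniq N a"
  proof (rule free_choice[OF fin assms(1-3), where x = x])
    fix v assume "v \<in> N - F"
    then show "\<exists>a. opts (k v) (c v) (t v) x a" using assms(4) k3 by (intro opts_ex) auto
  next
    fix v a assume "v \<in> F" "a \<noteq> x"
    then show "opts (k v) (c v) (t v) x a" using assms(5) opts_3_free opts_2_free by metis
  qed (use opts_neq in blast)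
  then show ?thesis unfolding extendable_def by blast
qed

lemma extendable_3:
  assumes "F \<subseteq> N" "F \<noteq> {}" "card (N - F) \<le> 5" "\<And>v. v \<in> F \<Longrightarrow> k v = 3" "card (killed \<union> t ` F) \<le> 3"
  shows "extendable N k c t"
proof -
  obtain x where "x \<notin> killed \<union> t ` F" using exists_col_notin[OF assms(5)] by blast
  then show ?thesis using assms by (intro extendable_free[of F x]) auto
qed

abbreviation nlen :: "nat \<Rightarrow> nat" where
  "nlen j \<equiv> card {v \<in> N. k v = j}"

lemma threads_partition: "N = {v \<in> N. k v = 0} \<union> {v \<in> N. k v = 1} \<union> {v \<in> N. k v = 2} \<union> {v \<in> N. k v = 3}"
proof -
  have "k v = 0 \<or> k v = 1 \<or> k v = 2 \<or> k v = 3" if "v \<in> N" for v using k3[OF that] by linarith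
  then show ?thesis by blast
qed

lemma card_threads: "card N = nlen 0 + nlen 1 + nlen 2 + nlen 3"
proof -
  have "card ({v \<in> N. k v = 0} \<union> {v \<in> N. k v = 1} \<union> {v \<in> N. k v = 2} \<union> {v \<in> N. k v = 3}) = nlen 0 + nlen 1 + nlen 2 + nlen 3"
    using fin by (subst card_Un_disjoint; auto)+
  then show ?thesis using threads_partition by simp
qed

lemma sum_threads: "(\<Sum>v\<in>N. k v) = nlen 1 + 2 * nlen 2 + 3 * nlen 3"
proof -
  have "(\<Sum>v\<in>{v \<in> N. k v = 0} \<union> {v \<in> N. k v = 1} \<union> {v \<in> N. k v = 2} \<union> {v \<in> N. k v = 3}. k v) = nlen 1 + 2 * nlen 2 + 3 * nlen 3"
    using fin by (subst sum.union_disjoint; auto)+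
  then show ?thesis using threads_partition by simp
qed

lemma card_killed: "card killed \<le> 2 * nlen 0 + nlen 1"
proof -
  have "card killed \<le> (\<Sum>v\<in>N. card (kill (k v) (c v) (t v)))" by (rule card_UN_le[OF fin])
  also have "\<dots> \<le> (\<Sum>v\<in>N. (if k v = 0 then 2 else 0) + (if k v = 1 then 1 else 0))"
    by (rule sum_mono) (auto simp: kill_def card_insert_if)
  also have "\<dots> = 2 * nlen 0 + nlen 1"
    using fin by (simp add: sum.distrib sum.If_cases Int_def conj_commute)
  finally show ?thesis .
qed

lemma extendable_one_3:
  assumes "nlen 3 \<ge> 1" "2 * nlen 0 + nlen 1 \<le> 2" "card N \<le> 6"
  shows "extendable N k c t"
proof -
  obtain v where v: "v \<in> N" "k v = 3" using assms(1) by (metis (mono_tags, lifting) Collect_empty_eq card.empty not_one_le_zero)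
  show ?thesis
  proof (rule extendable_3[of "{v}"])
    show "card (N - {v}) \<le> 5" using v assms(3) by (simp add: card_Diff_singleton)
    have "card (killed \<union> t ` {v}) \<le> card killed + card (t ` {v})" by (rule card_Un_le)
    then show "card (killed \<union> t ` {v}) \<le> 3" using card_killed assms(2) by simp
  qed (use v in auto)
qed

text \<open>With seven threads two free ones are needed, since \<open>free_choice\<close> tolerates
  only five others. This costs two forbidden colours, and nothing is killed.\<close>

lemma extendable_seven:
  assumes "card N = 7" "nlen 3 \<ge> 2" "nlen 0 = 0" "nlen 1 = 0"
  shows "extendable N k c t"
proof -
  obtain F where F: "F \<subseteq> {v \<in> N. k v = 3}" "card F = 2" using assms(2) by (meson obtain_subset_with_card_n)
  then have FN: "F \<subseteq> N" by blast
  then have "finite F" using fin by (rule finite_subset)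
  note FN = FN this
  show ?thesis
  proof (rule extendable_3[of F])
    show "card (N - F) \<le> 5" using F FN assms(1) by (simp add: card_Diff_subset)
    have "card (killed \<union> t ` F) \<le> card killed + card (t ` F)" by (rule card_Un_le)
    then show "card (killed \<union> t ` F) \<le> 3" using card_killed assms(3,4) card_image_le[OF FN(2), of t] F(2) by linarith
  qed (use F in auto)
qed

text \<open>No colour is killed, so the centre may take the end colour of one thread, which makes
  this thread free.\<close>

lemma extendable_2222:
  assumes "card N = 4" "nlen 2 = 4"
  shows "extendable N k c t"
proof -
  have "{v \<in> N. k v = 2} = N" using assms fin by (intro card_subset_eq) auto
  then have k2: "\<And>v. v \<in> N \<Longrightarrow> k v = 2" by blast
  obtain v where v: "v \<in> N" using assms(1) by fastforce
  show ?thesis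
    by (rule extendable_free[of "{v}" "c v"]) (use v k2 assms(1) in \<open>auto simp: kill_def card_Diff_singleton\<close>)
qed

text \<open>If some 2-thread ends in a colour other than \<open>c v1\<close>, the centre takes that
  colour. Otherwise all ends have the same colour. Then \<open>x\<close> is chosen such that
  \<open>t v0\<close> restricts nothing; now \<open>v0\<close> and \<open>v1\<close> can each show
  both of the two remaining colours, and \<open>v2\<close> and \<open>v3\<close> show some of them.
  If \<open>v2\<close> and \<open>v3\<close> agree, so does \<open>v1\<close>, and \<open>v0\<close>
  is the exception; otherwise \<open>v3\<close> is.\<close>

lemma extendable_2221:
  assumes "card N = 4" "nlen 2 = 3" "nlen 1 = 1" and tc: "\<And>v. v \<in> N \<Longrightarrow> k v = 1 \<Longrightarrow> t v = c v"
  shows "extendable N k c t"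
proof -
  obtain v1 where v1: "{v \<in> N. k v = 1} = {v1}" using assms(3) card_1_singletonE by blast
  obtain v0 v2 v3 where v: "{v \<in> N. k v = 2} = {v0, v2, v3}" "v0 \<noteq> v2" "v0 \<noteq> v3" "v2 \<noteq> v3"
    using assms(2) by (auto simp: card_3_iff)
  have k: "k v1 = 1" "k v0 = 2" "k v2 = 2" "k v3 = 2" and vN: "v1 \<in> N" "v0 \<in> N" "v2 \<in> N" "v3 \<in> N" using v v1 by auto
  then have d: "v1 \<noteq> v0" "v1 \<noteq> v2" "v1 \<noteq> v3" by auto
  have N: "N = {v0, v1, v2, v3}"
    using vN v d assms(1) fin by (intro card_subset_eq[symmetric]) auto
  show ?thesis
  proof (cases "\<exists>v\<in>{v0, v2, v3}. c v \<noteq> c v1")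
    case True
    then obtain w where w: "w \<in> {v0, v2, v3}" "c w \<noteq> c v1" by blast
    then have kw: "k w = 2" "w \<in> N" using k vN by auto
    have "killed = {c v1}" unfolding N using k by (simp add: kill_def)
    moreover have "card (N - {w}) \<le> 5" using card_mono[OF fin, of "N - {w}"] assms(1) by auto
    ultimately show ?thesis using w kw by (intro extendable_free[of "{w}" "c w"]) auto
  next
    case False
    then have cc: "c v0 = c v1" "c v2 = c v1" "c v3 = c v1" by auto
    obtain x where x: "x \<noteq> c v1" "t v0 = x \<or> t v0 = c v1"
      using exists_col_notin[of "{c v1}"] by (cases "t v0 = c v1") auto
    obtain a2 where a2: "opts 2 (c v2) (t v2) x a2" using opts_2_ex by blast
    obtain a3 where a3: "opts 2 (c v3) (t v3) x a3" using opts_2_ex by blast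
    have n2: "a2 \<noteq> x" "a2 \<noteq> c v1" "a3 \<noteq> x" "a3 \<noteq> c v1"
      using opts_neq[OF a2] opts_neq[OF a3] opts_2_neq[OF a2] opts_2_neq[OF a3] cc by auto
    have o1: "opts 1 (c v1) (t v1) x a" if "a \<noteq> x" "a \<noteq> c v1" for a
      using opts_1 tc[OF vN(1) k(1)] x that by simp
    have o0: "opts 2 (c v0) (t v0) x a" if "a \<noteq> x" "a \<noteq> c v1" for a
      using opts_2_two[of "t v0" x "c v0" a] x that cc by auto
    obtain b where b: "b \<noteq> a2" "b \<noteq> x" "b \<noteq> c v1" using col_avoid[of "a2" "x" "c v1"] by auto
    define a0 where "a0 = (if a3 = a2 then b else a2)"
    define a where "a = (\<lambda>v. if v = v0 then a0 else if v = v1 then a2 else if v = v2 then a2 else a3)"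
    have av: "a v0 = a0" "a v1 = a2" "a v2 = a2" "a v3 = a3" using d v(2-4) by (auto simp: a_def)
    have o0': "opts 2 (c v0) (t v0) x a0" using o0[OF n2(1,2)] o0[OF b(2,3)] by (simp add: a0_def)
    have "\<forall>v\<in>N. opts (k v) (c v) (t v) x (a v)"
      unfolding N by (simp add: k av o0' o1[OF n2(1,2), simplified] a2 a3)
    moreover have "uniq N a"
    proof (cases "a3 = a2")
      case True
      then show ?thesis unfolding uniq_def N using b(1) by (intro bexI[of _ v0]) (auto simp: av a0_def)
    next
      case False
      then show ?thesis unfolding uniq_def N by (intro bexI[of _ v3]) (auto simp: av a0_def)
    qed
    ultimately show ?thesis unfolding extendable_def by blast
  qed
qed

text \<open>The short threads kill at most three colours. If some colour is left that also differs
  from \<open>t v2\<close>, the thread at \<open>v2\<close> is free. Otherwise \<open>c v0\<close>,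
  \<open>t v0\<close>, \<open>c v1\<close>, \<open>t v2\<close> are all four colours and the centre
  has to take \<open>t v2\<close>; the 1-thread can then show two colours because
  \<open>t v1 = c v1\<close>.\<close>

lemma extendable_3310:
  assumes "card N = 4" "nlen 3 = 2" "nlen 1 = 1" "nlen 0 = 1" and tc: "\<And>v. v \<in> N \<Longrightarrow> k v = 1 \<Longrightarrow> t v = c v"
  shows "extendable N k c t"
proof -
  obtain v1 where v1: "{v \<in> N. k v = 1} = {v1}" using assms(3) card_1_singletonE by blast
  obtain v0 where v0: "{v \<in> N. k v = 0} = {v0}" using assms(4) card_1_singletonE by blast
  obtain v2 v3 where v: "{v \<in> N. k v = 3} = {v2, v3}" "v2 \<noteq> v3"
    using assms(2) by (auto simp: card_2_iff)
  have k: "k v1 = 1" "k v0 = 0" "k v2 = 3" "k v3 = 3" and vN: "v1 \<in> N" "v0 \<in> N" "v2 \<in> N" "v3 \<in> N" using v v1 v0 by auto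
  then have d: "v1 \<noteq> v0" "v1 \<noteq> v2" "v1 \<noteq> v3" "v0 \<noteq> v2" "v0 \<noteq> v3" by auto
  have N: "N = {v0, v1, v2, v3}"
    using vN v d assms(1) fin by (intro card_subset_eq[symmetric]) auto
  have K: "killed = {c v0, t v0, c v1}" unfolding N using k by (auto simp: kill_def)
  show ?thesis
  proof (cases "card (killed \<union> t ` {v2}) \<le> 3")
    case True
    moreover have "card (N - {v2}) \<le> 5" using card_mono[OF fin, of "N - {v2}"] assms(1) by auto
    ultimately show ?thesis using k(3) vN(3) by (intro extendable_3[of "{v2}"]) auto
  next
    case False
    then have "card {c v0, t v0, c v1, t v2} = 4"
      using K card_mono[of UNIV "{c v0, t v0, c v1, t v2}"] card_col by (auto simp: insert_commute)
    then have dd: "c v0 \<noteq> t v0" "c v0 \<noteq> c v1" "t v0 \<noteq> c v1" "t v2 \<notin> {c v0, t v0, c v1}"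
      by (auto simp: card_insert_if split: if_splits)
    define x where "x = t v2"
    obtain a2 where a2: "opts 3 (c v2) (t v2) x a2" using opts_3_ex by blast
    obtain a3 where a3: "opts 3 (c v3) (t v3) x a3" using opts_3_ex by blast
    have o0: "opts 0 (c v0) (t v0) x (c v0)" using opts_0 dd x_def by auto
    have o1: "opts 1 (c v1) (t v1) x a" if "a = c v0 \<or> a = t v0" for a
      using opts_1 tc[OF vN(1) k(1)] dd x_def that by auto
    \<comment> \<open>\<open>v0\<close> shows \<open>c v0\<close>. If exactly one of
      \<open>v2\<close>, \<open>v3\<close> shows it as well, \<open>v1\<close> joins in and the
      other one is unique. If both do, \<open>v1\<close> is unique with \<open>t v0\<close>; if
      neither does, \<open>v0\<close> remains unique.\<close>
    define b where "b = (if (a2 = c v0) = (a3 = c v0) then t v0 else c v0)"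
    define a where "a = (\<lambda>v. if v = v0 then c v0 else if v = v1 then b else if v = v2 then a2 else a3)"
    have av: "a v0 = c v0" "a v1 = b" "a v2 = a2" "a v3 = a3" using d v(2) by (auto simp: a_def)
    have o1': "opts 1 (c v1) (t v1) x b" by (rule o1) (simp add: b_def)
    have "\<forall>v\<in>N. opts (k v) (c v) (t v) x (a v)"
      unfolding N by (simp add: k av o0 o1'[simplified] a2 a3)
    moreover have "uniq N a"
    proof -
      consider "a2 = c v0" "a3 = c v0" | "a2 \<noteq> c v0" "a3 \<noteq> c v0" | "a2 = c v0" "a3 \<noteq> c v0" | "a2 \<noteq> c v0" "a3 = c v0" by blast
      then show ?thesis unfolding uniq_def N
      proof cases
        case 1 then show "\<exists>v\<in>{v0, v1, v2, v3}. \<forall>u\<in>{v0, v1, v2, v3}. u \<noteq> v \<longrightarrow> a u \<noteq> a v"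
          using dd by (intro bexI[of _ v1]) (auto simp: av b_def)
      next
        case 2 then show "\<exists>v\<in>{v0, v1, v2, v3}. \<forall>u\<in>{v0, v1, v2, v3}. u \<noteq> v \<longrightarrow> a u \<noteq> a v"
          using dd by (intro bexI[of _ v0]) (auto simp: av b_def)
      next
        case 3 then show "\<exists>v\<in>{v0, v1, v2, v3}. \<forall>u\<in>{v0, v1, v2, v3}. u \<noteq> v \<longrightarrow> a u \<noteq> a v"
          using dd by (intro bexI[of _ v3]) (auto simp: av b_def)
      next
        case 4 then show "\<exists>v\<in>{v0, v1, v2, v3}. \<forall>u\<in>{v0, v1, v2, v3}. u \<noteq> v \<longrightarrow> a u \<noteq> a v"
          using dd by (intro bexI[of _ v2]) (auto simp: av b_def)
      qed
    qed
    ultimately show ?thesis unfolding extendable_def by blast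
  qed
qed

text \<open>Since \<open>t v0 = c v0\<close>, the thread at \<open>v0\<close> can show two colours
  and picks one different from that of \<open>v1\<close>. Whichever of the two \<open>v2\<close>
  shows, the other is unique.\<close>

lemma extendable_111:
  assumes "card N = 3" "\<And>v. v \<in> N \<Longrightarrow> k v = 1" "v0 \<in> N" "t v0 = c v0"
  shows "extendable N k c t"
proof -
  obtain v1 v2 where v: "N = {v0, v1, v2}" "v0 \<noteq> v1" "v0 \<noteq> v2" "v1 \<noteq> v2"
    using assms(1,3) by (auto simp: card_3_iff)
  obtain x where x: "x \<notin> {c v0, c v1, c v2}" using col_avoid[of "c v0" "c v1" "c v2"] by auto
  obtain a1 where a1: "opts 1 (c v1) (t v1) x a1" using opts_1_ex[of x "c v1"] x by auto
  obtain a2 where a2: "opts 1 (c v2) (t v2) x a2" using opts_1_ex[of x "c v2"] x by auto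
  obtain a0 where a0: "a0 \<noteq> x" "a0 \<noteq> c v0" "a0 \<noteq> a1" using col_avoid[of "x" "c v0" "a1"] by auto
  have o0: "opts 1 (c v0) (t v0) x a0" using a0 x assms(4) by (intro opts_1) auto
  define a where "a = (\<lambda>v. if v = v0 then a0 else if v = v1 then a1 else a2)"
  have "opts (k v) (c v) (t v) x (a v)" if "v \<in> N" for v
    using that assms(2)[OF that] v a1 a2 o0 by (auto simp: a_def)
  moreover have "uniq N a"
  proof (cases "a2 = a0")
    case True
    then show ?thesis unfolding uniq_def v(1) using a0 v by (intro bexI[of _ v1]) (auto simp: a_def)
  next
    case False
    then show ?thesis unfolding uniq_def v(1) using a0 v by (intro bexI[of _ v0]) (auto simp: a_def)
  qed
  ultimately show ?thesis unfolding extendable_def by blast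
qed

lemma extendable_1:
  assumes "N = {v}" "k v = 0"
  shows "extendable N k c t"
proof -
  obtain x where "x \<notin> {c v, t v}" using col_avoid[of "c v" "t v" "t v"] by auto
  then have "opts 0 (c v) (t v) x (c v)" using opts_0 by auto
  then show ?thesis unfolding extendable_def unfolding assms(1) uniq_def using assms(2)
    by (intro exI[of _ x] exI[of _ c]) simp
qed

lemma extendable_2:
  assumes "N = {v, w}" "v \<noteq> w" "opts (k v) (c v) (t v) x a" "opts (k w) (c w) (t w) x b" "a \<noteq> b"
  shows "extendable N k c t"
  unfolding extendable_def unfolding assms(1) uniq_def
  using assms(2-5) by (intro exI[of _ x] exI[of _ "\<lambda>u. if u = v then a else b"]) auto

text \<open>The centre colour is made to leave the 2-thread every colour except \<open>x\<close> and
  \<open>c w\<close>: it is \<open>c w\<close> if that differs from \<open>c v\<close>, and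
  otherwise a colour that makes \<open>t w\<close> harmless. Then \<open>w\<close> can avoid the
  colour shown by \<open>v\<close>.\<close>

lemma extendable_2_12:
  assumes "N = {v, w}" "v \<noteq> w" "k v = 1" "k w = 2"
  shows "extendable N k c t"
proof -
  have "\<exists>x. x \<noteq> c v \<and> (\<forall>b. b \<noteq> x \<longrightarrow> b \<noteq> c w \<longrightarrow> opts 2 (c w) (t w) x b)"
  proof (cases "c w = c v")
    case True
    obtain x where "x \<noteq> c w" "t w = x \<or> t w = c w"
      using col_avoid[of "c w" "c w" "c w"] by (cases "t w = c w") auto
    then show ?thesis using opts_2_two True by metis
  next
    case False
    then show ?thesis using opts_2_free by metis
  qed
  then obtain x where x: "x \<noteq> c v" "\<And>b. b \<noteq> x \<Longrightarrow> b \<noteq> c w \<Longrightarrow> opts 2 (c w) (t w) x b" by blast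
  obtain a where a: "opts 1 (c v) (t v) x a" using opts_1_ex[OF x(1)] by blast
  obtain b where "b \<noteq> x" "b \<noteq> c w" "b \<noteq> a" using col_avoid[of x "c w" a] by blast
  then show ?thesis using x a assms by (intro extendable_2[of v w x a b]) auto
qed

text \<open>The side without inner vertices forces the colour \<open>c v\<close>, so the inner
  vertex on the other side is coloured before the centre. As \<open>t v = c v\<close>, the centre
  has only \<open>c v\<close>, \<open>c w\<close> and \<open>b\<close> to avoid.\<close>

lemma extendable_2_01:
  assumes "N = {v, w}" "v \<noteq> w" "k v = 0" "t v = c v" "k w = 1"
  shows "extendable N k c t"
proof -
  obtain b where b: "b \<notin> {c v, c w, t w}" using col_avoid[of "c v" "c w" "t w"] by auto
  obtain x where x: "x \<notin> {c v, c w, b}" using col_avoid[of "c v" "c w" "b"] by auto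
  show ?thesis using assms b x opts_0[of x "c v" "t v"] opts_1[of x "c w" b "t w"]
    by (intro extendable_2[of v w x "c v" b]) auto
qed

text \<open>Total length 7 in degree 4 is the boundary case. It is solvable by these arguments
  because one 1-thread has \<open>t v = c v\<close>; in the two exceptional distributions of lengths
  it is the only 1-thread.\<close>

lemma extendable_degree_ge_4:
  assumes "4 \<le> card N" "card N \<le> 7"
    and "card N = 4 \<Longrightarrow> 8 \<le> (\<Sum>v\<in>N. k v) \<or>
      (\<Sum>v\<in>N. k v) = 7 \<and> (\<exists>v\<in>N. k v = 1 \<and> t v = c v)"
    and "card N = 5 \<Longrightarrow> 12 \<le> (\<Sum>v\<in>N. k v)" "card N = 6 \<Longrightarrow> 16 \<le> (\<Sum>v\<in>N. k v)"
    "card N = 7 \<Longrightarrow> 20 \<le> (\<Sum>v\<in>N. k v)"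
  shows "extendable N k c t"
proof -
  note s = sum_threads and cN = card_threads
  have "card N = 4 \<longrightarrow> 7 \<le> (\<Sum>v\<in>N. k v)" using assms(3) by linarith
  moreover have "card N = 5 \<longrightarrow> 12 \<le> (\<Sum>v\<in>N. k v)" "card N = 6 \<longrightarrow> 16 \<le> (\<Sum>v\<in>N. k v)"
    "card N = 7 \<longrightarrow> 20 \<le> (\<Sum>v\<in>N. k v)" using assms(4-6) by simp_all
  note thread_counts[OF cN s assms(1,2) calculation this]
  then consider "nlen 3 \<ge> 1" "2 * nlen 0 + nlen 1 \<le> 2" "card N \<le> 6" | "card N = 7" "nlen 3 \<ge> 2" "nlen 0 = 0" "nlen 1 = 0"
    | "card N = 4" "nlen 2 = 4" | "card N = 4" "nlen 2 = 3" "nlen 1 = 1" "(\<Sum>v\<in>N. k v) = 7"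
    | "card N = 4" "nlen 3 = 2" "nlen 1 = 1" "nlen 0 = 1" "(\<Sum>v\<in>N. k v) = 7"
    by (elim disjE conjE) simp_all
  then show ?thesis
  proof cases
    case 1 then show ?thesis by (rule extendable_one_3)
  next
    case 2 then show ?thesis by (rule extendable_seven)
  next
    case 3 then show ?thesis by (rule extendable_2222)
  next
    case 4
    then obtain v where v: "v \<in> N" "k v = 1" "t v = c v" using assms(3) by auto
    have "t u = c u" if "u \<in> N" "k u = 1" for u
      using 4(3) v that by (metis (mono_tags, lifting) card_1_singletonE mem_Collect_eq singletonD)
    then show ?thesis using 4 by (intro extendable_2221) auto
  next
    case 5
    then obtain v where v: "v \<in> N" "k v = 1" "t v = c v" using assms(3) by auto
    have "t u = c u" if "u \<in> N" "k u = 1" for u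
      using 5(3) v that by (metis (mono_tags, lifting) card_1_singletonE mem_Collect_eq singletonD)
    then show ?thesis using 5 by (intro extendable_3310) auto
  qed
qed

end

section \<open>Deleting a star of threads\<close>

context sgraph begin

definition deg :: "'a set \<Rightarrow> 'a \<Rightarrow> nat" where
  "deg S v = card (nbrs S v)"

definition pcf :: "'a set \<Rightarrow> ('a \<Rightarrow> col) \<Rightarrow> bool" where
  "pcf S c \<longleftrightarrow> (\<forall>u\<in>S. \<forall>v\<in>S. E u v \<longrightarrow> c u \<noteq> c v) \<and>
     (\<forall>v\<in>S. nbrs S v \<noteq> {} \<longrightarrow> uniq (nbrs S v) c)"

text \<open>Only meaningful if \<open>v\<close> has degree 2 and \<open>u\<close> is one of its neighbours; then it is the other one.\<close>

definition nxt :: "'a set \<Rightarrow> 'a \<Rightarrow> 'a \<Rightarrow> 'a" where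
  "nxt S u v = (SOME w. w \<in> nbrs S v \<and> w \<noteq> u)"

text \<open>The walk that leaves \<open>u\<close> through \<open>v\<close> and never turns back.
  Position 0 is \<open>u\<close>, so a thread of length \<open>k\<close> has its inner vertices at 1
  to \<open>k\<close> and its end at \<open>k + 1\<close>.\<close>

fun wk :: "'a set \<Rightarrow> 'a \<Rightarrow> 'a \<Rightarrow> nat \<Rightarrow> 'a" where
  "wk S u v 0 = u"
| "wk S u v (Suc 0) = v"
| "wk S u v (Suc (Suc i)) = nxt S (wk S u v i) (wk S u v (Suc i))"

lemma nbrs_sym: "u \<in> S \<Longrightarrow> v \<in> S \<Longrightarrow> u \<in> nbrs S v \<longleftrightarrow> v \<in> nbrs S u"
  using sym by (auto simp: nbrs_def)

lemma nxt:
  assumes "deg S v = 2" "u \<in> nbrs S v"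
  shows "nbrs S v = {u, nxt S u v}" "nxt S u v \<noteq> u"
proof -
  obtain p q where pq: "nbrs S v = {p, q}" "p \<noteq> q" using assms(1) by (auto simp: deg_def card_2_iff)
  then have "\<exists>w. w \<in> nbrs S v \<and> w \<noteq> u" by blast
  then have "nxt S u v \<in> nbrs S v \<and> nxt S u v \<noteq> u" unfolding nxt_def by (rule someI_ex)
  then show "nbrs S v = {u, nxt S u v}" "nxt S u v \<noteq> u" using pq assms(2) by auto
qed

text \<open>The length \<open>k\<close> need not be maximal: the end may again have degree 2. This
  allows a star to be cut to the shape of a colouring lemma.\<close>

definition thread :: "'a set \<Rightarrow> 'a \<Rightarrow> 'a \<Rightarrow> nat \<Rightarrow> bool" where
  "thread S u v k \<longleftrightarrow> u \<in> S \<and> v \<in> nbrs S u \<and> (\<forall>i. 1 \<le> i \<longrightarrow> i \<le> k \<longrightarrow> deg S (wk S u v i) = 2)"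

lemma wk_props:
  assumes th: "thread S u v k" and "i \<le> k"
  shows "wk S u v i \<in> S \<and> wk S u v (Suc i) \<in> nbrs S (wk S u v i)"
  using assms(2)
proof (induction i)
  case 0
  then show ?case using th by (simp add: thread_def)
next
  case (Suc i)
  then have IH: "wk S u v i \<in> S" "wk S u v (Suc i) \<in> nbrs S (wk S u v i)" by auto
  then have S: "wk S u v (Suc i) \<in> S" by (simp add: nbrs_def)
  then have "wk S u v i \<in> nbrs S (wk S u v (Suc i))" using IH nbrs_sym by blast
  then show ?case using nxt[of S "wk S u v (Suc i)" "wk S u v i"] Suc.prems S th by (auto simp: thread_def)
qed

lemma wk_nbrs:
  assumes th: "thread S u v k" and "i < k"
  shows "nbrs S (wk S u v (Suc i)) = {wk S u v i, wk S u v (Suc (Suc i))}" "wk S u v (Suc (Suc i)) \<noteq> wk S u v i"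
proof -
  have p: "wk S u v i \<in> S \<and> wk S u v (Suc i) \<in> nbrs S (wk S u v i)" "wk S u v (Suc i) \<in> S"
    using wk_props[OF th, of i] wk_props[OF th, of "Suc i"] assms(2) by auto
  then have "wk S u v i \<in> nbrs S (wk S u v (Suc i))" using nbrs_sym by blast
  then show "nbrs S (wk S u v (Suc i)) = {wk S u v i, wk S u v (Suc (Suc i))}" "wk S u v (Suc (Suc i)) \<noteq> wk S u v i"
    using nxt[of S "wk S u v (Suc i)" "wk S u v i"] assms(2) th by (auto simp: thread_def)
qed

section \<open>Short walks without backtracking\<close>

definition nonback :: "'a list \<Rightarrow> bool" where
  "nonback xs \<longleftrightarrow> successively E xs \<and> (\<forall>i. i + 2 < length xs \<longrightarrow> xs ! i \<noteq> xs ! (i + 2))"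

text \<open>Dropping either end leaves a shorter walk of this kind, so only the first and last
  vertices could coincide. They would close a cycle with one vertex fewer than the list, hence at
  most 10.\<close>

lemma nonback_distinct:
  assumes "nonback xs" "set xs \<subseteq> S" "length xs \<le> 11" and g: "\<And>C. cyc S C \<Longrightarrow> 11 \<le> length C"
  shows "distinct xs"
  using assms(1-3)
proof (induction "length xs" arbitrary: xs rule: less_induct)
  case less
  show ?case
  proof (cases "length xs \<le> 1")
    case True
    then show ?thesis by (cases xs) auto
  next
    case False
    then obtain x zs y where xs: "xs = x # zs @ [y]"
      by (cases xs; cases "tl xs" rule: rev_exhaust) auto
    have s: "successively E xs" and nb: "\<And>i. i + 2 < length xs \<Longrightarrow> xs ! i \<noteq> xs ! (i + 2)"
      using less.prems by (auto simp: nonback_def)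
    have s1: "successively E (x # zs)" using s xs successively_append_iff[of E "x # zs" "[y]"] by simp
    have s2: "successively E (zs @ [y])" using s xs by (cases "zs @ [y]") auto
    have E: "E (last (x # zs)) y" using s xs successively_append_iff[of E "x # zs" "[y]"] by simp
    have "nonback (x # zs)" unfolding nonback_def
    proof (intro conjI allI impI)
      fix i assume "i + 2 < length (x # zs)"
      then show "(x # zs) ! i \<noteq> (x # zs) ! (i + 2)"
        using nb[of i] nth_append[of "x # zs" "[y]" i] nth_append[of "x # zs" "[y]" "i + 2"] xs by simp
    qed (rule s1)
    then have d1: "distinct (x # zs)" using less.hyps[of "x # zs"] less.prems xs by auto
    have "nonback (zs @ [y])" unfolding nonback_def
    proof (intro conjI allI impI)
      fix i assume "i + 2 < length (zs @ [y])"
      then show "(zs @ [y]) ! i \<noteq> (zs @ [y]) ! (i + 2)" using nb[of "Suc i"] xs by simp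
    qed (rule s2)
    then have d2: "distinct (zs @ [y])" using less.hyps[of "zs @ [y]"] less.prems xs by auto
    have "x \<noteq> y"
    proof
      assume xy: "x = y"
      have "length zs \<noteq> 0" using E xy irrefl by auto
      moreover have "length zs \<noteq> 1" using nb[of 0] xs xy by (cases zs) auto
      ultimately have "2 \<le> length zs" by linarith
      then have "cyc S (x # zs)" using s1 d1 E xy xs less.prems(2) by (auto simp: cyc_def gpath_def)
      then show False using g less.prems(3) xs by fastforce
    qed
    then show ?thesis using d1 d2 xs by auto
  qed
qed

lemma nonback_rev: "nonback (rev xs) \<longleftrightarrow> nonback xs"
proof -
  have "nonback (rev xs)" if "nonback xs" for xs
    unfolding nonback_def successively_rev_E
  proof (intro conjI allI impI)
    show "successively E xs" using that by (simp add: nonback_def)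
    fix i assume i: "i + 2 < length (rev xs)"
    then have "xs ! (length xs - Suc (i + 2)) \<noteq> xs ! (length xs - Suc (i + 2) + 2)"
      using that by (simp add: nonback_def)
    moreover have "length xs - Suc (i + 2) + 2 = length xs - Suc i" using i by simp
    ultimately show "rev xs ! i \<noteq> rev xs ! (i + 2)" using i by (simp add: rev_nth)
  qed
  from this[of xs] this[of "rev xs"] show ?thesis by auto
qed

lemma nonback_join:
  assumes "nonback (x # xs @ [u])" "nonback (u # y # ys)" "last (x # xs) \<noteq> y"
  shows "nonback (x # xs @ u # y # ys)"
  unfolding nonback_def
proof (intro conjI allI impI)
  show "successively E (x # xs @ u # y # ys)"
    using assms(1,2) successively_append_iff[of E "x # xs" "[u]"] successively_append_iff[of E "x # xs" "u # y # ys"]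
    by (simp add: nonback_def)
  fix i assume i: "i + 2 < length (x # xs @ u # y # ys)"
  let ?A = "x # xs" and ?n = "Suc (length xs)"
  consider "i + 2 < ?n + 1" | "i + 2 = ?n + 1" | "i \<ge> ?n" by linarith
  then show "(x # xs @ u # y # ys) ! i \<noteq> (x # xs @ u # y # ys) ! (i + 2)"
  proof cases
    case 1
    then have "(?A @ [u]) ! i \<noteq> (?A @ [u]) ! (i + 2)" using assms(1) by (simp add: nonback_def)
    then show ?thesis using 1 nth_append[of "?A @ [u]" "y # ys" i] nth_append[of "?A @ [u]" "y # ys" "i + 2"] by simp
  next
    case 2
    then have "(x # xs @ u # y # ys) ! i = last ?A" "(x # xs @ u # y # ys) ! (i + 2) = y"
      using nth_append[of ?A "u # y # ys" i] nth_append[of ?A "u # y # ys" "i + 2"] last_conv_nth[of ?A] by auto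
    then show ?thesis using assms(3) by simp
  next
    case 3
    then have "(u # y # ys) ! (i - ?n) \<noteq> (u # y # ys) ! (i - ?n + 2)" using assms(2) i by (simp add: nonback_def)
    moreover have "i - ?n + 2 = i + 2 - ?n" using 3 by simp
    ultimately show ?thesis
      using 3 nth_append[of ?A "u # y # ys" i] nth_append[of ?A "u # y # ys" "i + 2"] by simp
  qed
qed

abbreviation wl :: "'a set \<Rightarrow> 'a \<Rightarrow> 'a \<Rightarrow> nat \<Rightarrow> 'a list" where
  "wl S u v k \<equiv> map (wk S u v) [1..<Suc (Suc k)]"

lemma wk_nonback:
  assumes th: "thread S u v k"
  shows "nonback (u # wl S u v k)" "set (u # wl S u v k) \<subseteq> S"
proof -
  have eq: "u # wl S u v k = map (wk S u v) [0..<Suc (Suc k)]"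
    by (subst (2) upt_conv_Cons) auto
  have p: "wk S u v i \<in> S" "E (wk S u v i) (wk S u v (Suc i))" if "i \<le> k" for i
    using wk_props[OF th, of i] that by (auto simp: nbrs_def)
  have p': "wk S u v i \<in> S" if "i \<le> Suc k" for i
    using wk_props[OF th, of "i - 1"] that th by (cases i) (auto simp: nbrs_def thread_def)
  show "set (u # wl S u v k) \<subseteq> S" unfolding eq using p' by auto
  show "nonback (u # wl S u v k)" unfolding eq nonback_def
  proof (intro conjI allI impI)
    show "successively E (map (wk S u v) [0..<Suc (Suc k)])"
      using p(2) by (auto simp: successively_conv_nth simp del: upt_Suc)
    fix i assume "i + 2 < length (map (wk S u v) [0..<Suc (Suc k)])"
    then have "i < k" by simp
    then show "map (wk S u v) [0..<Suc (Suc k)] ! i \<noteq> map (wk S u v) [0..<Suc (Suc k)] ! (i + 2)"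
      using wk_nbrs(2)[OF th, of i] by (simp del: upt_Suc wk.simps)
  qed
qed

section \<open>Stars of threads and their removal\<close>

definition star :: "'a set \<Rightarrow> 'a \<Rightarrow> ('a \<Rightarrow> nat) \<Rightarrow> bool" where
  "star S u k \<longleftrightarrow> u \<in> S \<and> (\<forall>v\<in>nbrs S u. k v \<le> 3 \<and> thread S u v (k v))"

context
  fixes S :: "'a set" and u :: 'a and k :: "'a \<Rightarrow> nat"
  assumes st: "star S u k" and fin: "finite S" and g: "\<And>C. cyc S C \<Longrightarrow> 11 \<le> length C"
begin

lemma center_in: "u \<in> S" using st by (simp add: star_def)

lemma star_le_3: "v \<in> nbrs S u \<Longrightarrow> k v \<le> 3"
  using st by (simp add: star_def)

lemma star_thread: "v \<in> nbrs S u \<Longrightarrow> thread S u v (k v)"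
  using st by (simp add: star_def)

lemma wk_ne_center:
  assumes "v \<in> nbrs S u" "1 \<le> i" "i \<le> Suc (k v)"
  shows "wk S u v i \<noteq> u"
proof -
  have "distinct (u # wl S u v (k v))"
    using wk_nonback[OF star_thread[OF assms(1)]] star_le_3[OF assms(1)] g by (intro nonback_distinct[of _ S]) auto
  moreover have "wk S u v i \<in> set (wl S u v (k v))" using assms by (auto simp del: upt_Suc)
  ultimately show ?thesis by (auto simp del: upt_Suc)
qed

text \<open>One thread read backwards, then \<open>u\<close>, then another thread is a walk without
  backtracking. It has at most 4 + 1 + 4 vertices, few enough for the girth. Ends are included, so
  different threads have different ends.\<close>

lemma wk_inj:
  assumes "v \<in> nbrs S u" "1 \<le> i" "i \<le> Suc (k v)" "w \<in> nbrs S u" "1 \<le> j" "j \<le> Suc (k w)"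
    and eq: "wk S u v i = wk S u w j"
  shows "v = w \<and> i = j"
proof (cases "v = w")
  case True
  have "distinct (u # wl S u v (k v))"
    using wk_nonback[OF star_thread[OF assms(1)]] star_le_3[OF assms(1)] g by (intro nonback_distinct[of _ S]) auto
  then have "inj_on (wk S u v) {1..<Suc (Suc (k v))}" by (simp add: distinct_map del: upt_Suc)
  then show ?thesis using True eq assms by (auto simp: inj_on_def)
next
  case False
  have c: "\<exists>xs. wl S u v m = v # xs" for v m
    by (simp add: upt_conv_Cons del: upt_Suc)
  obtain xs where xs: "wl S u v (k v) = v # xs" using c[of v "k v"] by (elim exE)
  obtain ys where ys: "wl S u w (k w) = w # ys" using c[of w "k w"] by (elim exE)
  have "nonback (rev (u # wl S u v (k v)))"
    unfolding nonback_rev by (rule wk_nonback[OF star_thread[OF assms(1)]])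
  then have 1: "nonback (rev (v # xs) @ [u])" unfolding xs by simp
  have 2: "nonback (u # w # ys)" using wk_nonback(1)[OF star_thread[OF assms(4)]] unfolding ys by simp
  obtain z zs where z: "rev (v # xs) = z # zs" by (cases "rev (v # xs)") auto
  have "last (z # zs) = v" using z by (metis last.simps last_rev list.sel(1) rev.simps(1) list.distinct(1))
  then have "nonback (z # zs @ u # w # ys)" using 1 2 False unfolding z by (intro nonback_join) auto
  moreover have "length (z # zs) = Suc (k v)" using arg_cong[OF z, of length] arg_cong[OF xs, of length] by (simp del: upt_Suc)
  moreover have "length (w # ys) = Suc (k w)" using arg_cong[OF ys, of length] by (simp del: upt_Suc)
  moreover have sz: "set (z # zs) = set (wl S u v (k v))" using arg_cong[OF z, of set] xs by simp
  moreover have "set (wl S u v (k v)) \<subseteq> S" "set (wl S u w (k w)) \<subseteq> S"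
    using wk_nonback(2)[OF star_thread[OF assms(1)]] wk_nonback(2)[OF star_thread[OF assms(4)]] by (auto simp del: upt_Suc)
  then have "set (z # zs) \<subseteq> S" "set (w # ys) \<subseteq> S" unfolding sz ys .
  then have "set ((z # zs) @ u # w # ys) \<subseteq> S" using center_in by simp
  ultimately have "distinct ((z # zs) @ u # w # ys)"
    using star_le_3[OF assms(1)] star_le_3[OF assms(4)] g by (intro nonback_distinct[of _ S]) auto
  then have "set (z # zs) \<inter> set (w # ys) = {}" by auto
  then have "set (wl S u v (k v)) \<inter> set (wl S u w (k w)) = {}" unfolding sz ys .
  moreover have "wk S u v i \<in> set (wl S u v (k v))" "wk S u w j \<in> set (wl S u w (k w))"
    using assms(1-6) by (auto simp del: upt_Suc)
  ultimately have False unfolding eq by blast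
  then show ?thesis ..
qed

definition star_set :: "'a set" where
  "star_set = insert u {wk S u v i | v i. v \<in> nbrs S u \<and> 1 \<le> i \<and> i \<le> k v}"

lemma wk_in_star_set: "v \<in> nbrs S u \<Longrightarrow> i \<le> k v \<Longrightarrow> wk S u v i \<in> star_set"
  unfolding star_set_def by (cases "i = 0") auto

lemma star_set_cases:
  assumes "y \<in> star_set"
  obtains "y = u" | v i where "v \<in> nbrs S u" "i < k v" "y = wk S u v (Suc i)"
proof -
  consider "y = u" | v i where "v \<in> nbrs S u" "1 \<le> i" "i \<le> k v" "y = wk S u v i"
    using assms by (auto simp: star_set_def)
  then show thesis
  proof cases
    case (2 v i)
    then show thesis using that(2)[of v "i - 1"] by auto
  qed (use that(1) in blast)
qed

abbreviation star_end :: "'a \<Rightarrow> 'a" where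
  "star_end v \<equiv> wk S u v (Suc (k v))"

lemma star_end_notin:
  assumes "v \<in> nbrs S u"
  shows "star_end v \<in> S - star_set"
proof -
  have "star_end v \<in> S" using wk_props[OF star_thread[OF assms], of "k v"] by (auto simp: nbrs_def)
  moreover have "star_end v \<notin> star_set"
  proof
    assume "star_end v \<in> star_set"
    then show False
    proof (cases rule: star_set_cases)
      case 1 then show False using wk_ne_center[OF assms, of "Suc (k v)"] by simp
    next
      case (2 w i)
      then show False using wk_inj[OF assms, of "Suc (k v)" w "Suc i"] by auto
    qed
  qed
  ultimately show ?thesis by blast
qed

lemma star_set_adjacent:
  assumes "r \<in> star_set" "y \<in> S - star_set" "E r y"
  shows "\<exists>v\<in>nbrs S u. y = star_end v \<and> r = wk S u v (k v)"
  using assms(1)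
proof (cases rule: star_set_cases)
  case 1
  then have "y \<in> nbrs S u" using assms by (auto simp: nbrs_def)
  moreover have "k y = 0"
  proof (rule ccontr)
    assume "k y \<noteq> 0"
    then have "wk S u y 1 \<in> star_set" using wk_in_star_set[of y 1] \<open>y \<in> nbrs S u\<close> by simp
    then show False using assms(2) by simp
  qed
  ultimately show ?thesis using 1 by (intro bexI[of _ y]) auto
next
  case (2 v i)
  moreover have "y \<in> nbrs S (wk S u v (Suc i))" using 2 assms by (auto simp: nbrs_def)
  ultimately have "y \<in> {wk S u v i, wk S u v (Suc (Suc i))}"
    using wk_nbrs(1)[OF star_thread[OF 2(1)], of i] by simp
  moreover have "wk S u v i \<in> star_set" using wk_in_star_set 2 by simp
  ultimately have y: "y = wk S u v (Suc (Suc i))" using assms(2) by blast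
  then have "\<not> Suc (Suc i) \<le> k v" using wk_in_star_set[OF 2(1)] assms(2) by blast
  then have "k v = Suc i" using 2(2) by simp
  then show ?thesis using y 2 by (intro bexI[of _ v]) auto
qed

lemma star_set_subset: "star_set \<subseteq> S" "u \<in> star_set"
proof -
  show "u \<in> star_set" by (simp add: star_set_def)
  show "star_set \<subseteq> S"
  proof
    fix y assume "y \<in> star_set"
    then show "y \<in> S"
    proof (cases rule: star_set_cases)
      case (2 v i)
      then show ?thesis using wk_props[OF star_thread[OF 2(1)], of "Suc i"] by simp
    qed (use center_in in simp)
  qed
qed

text \<open>Because different threads have different ends, each end loses exactly one neighbour.
  This is why one forbidden colour per thread describes the whole interaction.\<close>

lemma nbrs_end:
  assumes "v \<in> nbrs S u"
  shows "nbrs S (star_end v) = insert (wk S u v (k v)) (nbrs (S - star_set) (star_end v))" "wk S u v (k v) \<notin> nbrs (S - star_set) (star_end v)"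
proof -
  have p: "wk S u v (k v) \<in> S" "star_end v \<in> nbrs S (wk S u v (k v))"
    using wk_props[OF star_thread[OF assms], of "k v"] by auto
  have e: "star_end v \<in> S - star_set" by (rule star_end_notin[OF assms])
  have "wk S u v (k v) \<in> nbrs S (star_end v)" using p e nbrs_sym by blast
  moreover have "y = wk S u v (k v)" if yR: "y \<in> star_set" and yn: "y \<in> nbrs S (star_end v)" for y
  proof -
    have "E y (star_end v)" using yn sym by (auto simp: nbrs_def)
    then obtain w where w: "w \<in> nbrs S u" "star_end v = star_end w" "y = wk S u w (k w)"
      using star_set_adjacent[OF yR e] by blast
    then have "v = w" using wk_inj[OF assms, of "Suc (k v)" w "Suc (k w)"] by auto
    then show ?thesis using w by simp
  qed
  ultimately show "nbrs S (star_end v) = insert (wk S u v (k v)) (nbrs (S - star_set) (star_end v))"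
    by (auto simp: nbrs_def)
  show "wk S u v (k v) \<notin> nbrs (S - star_set) (star_end v)" using wk_in_star_set[OF assms, of "k v"] by (auto simp: nbrs_def)
qed

lemma star_extend:
  assumes c: "pcf (S - star_set) c"
    and t: "\<And>v c'. v \<in> nbrs S u \<Longrightarrow> (\<forall>w\<in>nbrs (S - star_set) (star_end v). c' w = c w) \<Longrightarrow> c' (wk S u v (k v)) \<noteq> t v
      \<Longrightarrow> uniq (nbrs S (star_end v)) c'"
    and x: "\<And>v. v \<in> nbrs S u \<Longrightarrow> opts (k v) (c (star_end v)) (t v) x (a v)"
    and un: "nbrs S u = {} \<or> uniq (nbrs S u) a"
  shows "\<exists>c'. pcf S c'"
proof -
  have "\<forall>v\<in>nbrs S u. \<exists>f. f 0 = x \<and> f (Suc 0) = a v \<and> f (Suc (k v)) = c (star_end v) \<and> f (k v) \<noteq> t v \<and>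
     (\<forall>i\<le>k v. f i \<noteq> f (Suc i)) \<and> (\<forall>i<k v. f i \<noteq> f (Suc (Suc i)))"
    using x unfolding opts_def by blast
  from bchoice[OF this] obtain f where f: "\<And>v. v \<in> nbrs S u \<Longrightarrow> f v 0 = x" "\<And>v. v \<in> nbrs S u \<Longrightarrow> f v (Suc 0) = a v"
    "\<And>v. v \<in> nbrs S u \<Longrightarrow> f v (Suc (k v)) = c (star_end v)" "\<And>v. v \<in> nbrs S u \<Longrightarrow> f v (k v) \<noteq> t v"
    "\<And>v i. v \<in> nbrs S u \<Longrightarrow> i \<le> k v \<Longrightarrow> f v i \<noteq> f v (Suc i)"
    "\<And>v i. v \<in> nbrs S u \<Longrightarrow> i < k v \<Longrightarrow> f v i \<noteq> f v (Suc (Suc i))"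
    by auto
  \<comment> \<open>The choice is unambiguous: by \<open>wk_inj\<close> an inner vertex determines
    its thread and its position.\<close>
  define c' where "c' y = (if y = u then x else if y \<in> star_set then
      (SOME b. \<exists>v i. v \<in> nbrs S u \<and> 1 \<le> i \<and> i \<le> k v \<and> y = wk S u v i \<and> b = f v i) else c y)" for y
  have cT: "c' y = c y" if "y \<in> S - star_set" for y using that star_set_subset by (auto simp: c'_def)
  have cu: "c' u = x" by (simp add: c'_def)
  have cw: "c' (wk S u v i) = f v i" if v: "v \<in> nbrs S u" and i: "i \<le> Suc (k v)" for v i
  proof -
    consider "i = 0" | "1 \<le> i" "i \<le> k v" | "i = Suc (k v)" using i by linarith
    then show ?thesis
    proof cases
      case 1 then show ?thesis using cu f(1)[OF v] by simp
    next
      case 2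
      have ne: "wk S u v i \<noteq> u" using wk_ne_center[OF v 2(1)] 2 by simp
      have "(SOME b. \<exists>w j. w \<in> nbrs S u \<and> 1 \<le> j \<and> j \<le> k w \<and> wk S u v i = wk S u w j \<and> b = f w j) = f v i"
      proof (rule some_equality)
        show "\<exists>w j. w \<in> nbrs S u \<and> 1 \<le> j \<and> j \<le> k w \<and> wk S u v i = wk S u w j \<and> f v i = f w j" using v 2 by blast
        fix b assume "\<exists>w j. w \<in> nbrs S u \<and> 1 \<le> j \<and> j \<le> k w \<and> wk S u v i = wk S u w j \<and> b = f w j"
        then obtain w j where wj: "w \<in> nbrs S u" "1 \<le> j" "j \<le> k w" "wk S u v i = wk S u w j" "b = f w j" by blast
        have "v = w \<and> i = j" by (rule wk_inj[OF v 2(1) i wj(1,2) _ wj(4)]) (use wj in simp)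
        then show "b = f v i" using wj by simp
      qed
      then show ?thesis using ne wk_in_star_set[OF v 2(2)] by (simp add: c'_def)
    next
      case 3 then show ?thesis using cT[OF star_end_notin[OF v]] f(3)[OF v] by simp
    qed
  qed
  have proper_R: "c' y \<noteq> c' z" if yz: "y \<in> star_set" "z \<in> S" "E y z" for y z
    using yz(1)
  proof (cases rule: star_set_cases)
    case 1
    then have z: "z \<in> nbrs S u" using yz by (simp add: nbrs_def)
    then have "c' z = f z 1" using cw[of z 1] by simp
    then show ?thesis using f(1)[OF z] f(5)[OF z, of 0] cu 1 by simp
  next
    case (2 v i)
    moreover have "z \<in> nbrs S (wk S u v (Suc i))" using 2 yz by (auto simp: nbrs_def)
    ultimately have "z = wk S u v i \<or> z = wk S u v (Suc (Suc i))"
      using wk_nbrs(1)[OF star_thread[OF 2(1)], of i] by simp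
    then show ?thesis
      using cw[OF 2(1), of i] cw[OF 2(1), of "Suc i"] cw[OF 2(1), of "Suc (Suc i)"] 2 f(5)[OF 2(1), of i] f(5)[OF 2(1), of "Suc i"]
      by auto
  qed
  have "c' y \<noteq> c' z" if yz: "y \<in> S" "z \<in> S" "E y z" for y z
  proof (cases "y \<in> star_set \<or> z \<in> star_set")
    case True
    then show ?thesis using proper_R[of y z] proper_R[of z y] yz sym[of y z] by auto
  next
    case False
    then show ?thesis using c yz cT by (auto simp: pcf_def)
  qed
  moreover have "uniq (nbrs S y) c'" if y: "y \<in> S" "nbrs S y \<noteq> {}" for y
  proof (cases "y \<in> star_set")
    case True
    then show ?thesis
    proof (cases rule: star_set_cases)
      case 1
      then have "uniq (nbrs S u) a" using un y by blast
      moreover have "c' v = a v" if "v \<in> nbrs S u" for v using cw[OF that, of 1] f(2)[OF that] by simp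
      ultimately show ?thesis using 1 by (simp add: uniq_def)
    next
      case (2 v i)
      note nn = wk_nbrs[OF star_thread[OF 2(1)], of i]
      have "c' (wk S u v i) \<noteq> c' (wk S u v (Suc (Suc i)))"
        using cw[OF 2(1), of i] cw[OF 2(1), of "Suc (Suc i)"] 2 f(6)[OF 2(1), of i] by auto
      then show ?thesis using nn 2 by (auto simp: uniq_def)
    qed
  next
    case yR: False
    show ?thesis
    proof (cases "\<exists>r\<in>star_set. E r y")
      case True
      then obtain v where v: "v \<in> nbrs S u" "y = star_end v" using star_set_adjacent yR y by blast
      have "\<forall>w\<in>nbrs (S - star_set) (star_end v). c' w = c w" using cT by (auto simp: nbrs_def)
      moreover have "c' (wk S u v (k v)) \<noteq> t v" using cw[OF v(1), of "k v"] f(4)[OF v(1)] by simp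
      ultimately show ?thesis using t v by blast
    next
      case False
      then have "nbrs S y = nbrs (S - star_set) y" using sym by (auto simp: nbrs_def)
      moreover have "uniq (nbrs (S - star_set) y) c" using c y yR calculation by (auto simp: pcf_def)
      moreover have "c' w = c w" if "w \<in> nbrs (S - star_set) y" for w using that cT by (auto simp: nbrs_def)
      ultimately show ?thesis by (simp add: uniq_def)
    qed
  qed
  ultimately have "pcf S c'" by (simp add: pcf_def)
  then show ?thesis by blast
qed

text \<open>At an end of degree 3 no colour has to be forbidden. This is expressed by setting
  \<open>t\<close> to the colour of the end itself, which the last thread vertex must avoid
  anyway.\<close>

lemma star_not_extendable:
  assumes no: "\<not> (\<exists>c. pcf S c)" and sub: "\<And>T. T \<subset> S \<Longrightarrow> \<exists>c. pcf T c"
  obtains cc t where "\<And>v. v \<in> nbrs S u \<Longrightarrow> deg S (star_end v) = 3 \<Longrightarrow> t v = cc v"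
    "nbrs S u \<noteq> {}" "\<not> extendable (nbrs S u) k cc t"
proof -
  have "S - star_set \<subset> S" using star_set_subset by blast
  then obtain c where c: "pcf (S - star_set) c" using sub by blast
  have finN: "finite (nbrs T v)" if "T \<subseteq> S" for T v
    by (rule finite_subset[OF _ fin]) (use that in \<open>auto simp: nbrs_def\<close>)
  have "\<forall>v\<in>nbrs S u. \<exists>t. (\<forall>c'. (\<forall>w\<in>nbrs (S - star_set) (star_end v). c' w = c w) \<longrightarrow> c' (wk S u v (k v)) \<noteq> t
      \<longrightarrow> uniq (nbrs S (star_end v)) c') \<and> (deg S (star_end v) = 3 \<longrightarrow> t = c (star_end v))"
  proof
    fix v assume v: "v \<in> nbrs S u"
    let ?N = "nbrs (S - star_set) (star_end v)"
    have u: "?N = {} \<or> uniq ?N c" using c star_end_notin[OF v] by (auto simp: pcf_def)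
    note ne = nbrs_end[OF v]
    show "\<exists>t. (\<forall>c'. (\<forall>w\<in>?N. c' w = c w) \<longrightarrow> c' (wk S u v (k v)) \<noteq> t
      \<longrightarrow> uniq (nbrs S (star_end v)) c') \<and> (deg S (star_end v) = 3 \<longrightarrow> t = c (star_end v))"
    proof (cases "deg S (star_end v) = 3")
      case True
      then have 2: "card ?N = 2" using ne finN[of "S - star_set" "star_end v"] by (simp add: deg_def)
      then have "uniq ?N c" using u by auto
      then show ?thesis unfolding ne(1) using uniq_insert_two[OF 2 _ ne(2)] by blast
    next
      case False
      then show ?thesis unfolding ne(1) using uniq_insert[OF u ne(2)] by blast
    qed
  qed
  then obtain t where t: "\<And>v c'. v \<in> nbrs S u \<Longrightarrow> (\<forall>w\<in>nbrs (S - star_set) (star_end v). c' w = c w) \<Longrightarrow> c' (wk S u v (k v)) \<noteq> t v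
      \<Longrightarrow> uniq (nbrs S (star_end v)) c'" "\<And>v. v \<in> nbrs S u \<Longrightarrow> deg S (star_end v) = 3 \<Longrightarrow> t v = c (star_end v)"
    by metis
  \<comment> \<open>\<open>uniq\<close> fails for the empty set, so non-extendability says nothing
    about an isolated centre; that case is excluded directly.\<close>
  have ne: "nbrs S u \<noteq> {}"
  proof
    assume "nbrs S u = {}"
    then have "\<exists>c'. pcf S c'" using star_extend[OF c t(1)] by blast
    then show False using no by blast
  qed
  have "\<not> extendable (nbrs S u) k (\<lambda>v. c (star_end v)) t"
  proof
    assume "extendable (nbrs S u) k (\<lambda>v. c (star_end v)) t"
    then obtain x a where "\<And>v. v \<in> nbrs S u \<Longrightarrow> opts (k v) (c (star_end v)) (t v) x (a v)" "uniq (nbrs S u) a"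
      unfolding extendable_def by blast
    then have "\<exists>c'. pcf S c'" using star_extend[OF c t(1)] by blast
    then show False using no by blast
  qed
  then show thesis using that[of t "\<lambda>v. c (star_end v)"] t(2) ne by blast
qed

end

subsection \<open>Discharging\<close>

text \<open>The length of the thread that leaves \<open>u\<close> through \<open>v\<close>, truncated at \<open>n\<close>.\<close>

fun tlen :: "'a set \<Rightarrow> nat \<Rightarrow> 'a \<Rightarrow> 'a \<Rightarrow> nat" where
  "tlen S 0 u v = 0"
| "tlen S (Suc n) u v = (if deg S v = 2 then Suc (tlen S n v (nxt S u v)) else 0)"

lemma tlen_le: "tlen S n u v \<le> n"
  by (induction n arbitrary: u v) auto

lemma wk_shift: "wk S u v (Suc i) = wk S v (nxt S u v) i"
  by (induction i rule: induct_nat_012) auto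

lemma deg_tlen: "1 \<le> i \<Longrightarrow> i \<le> tlen S n u v \<Longrightarrow> deg S (wk S u v i) = 2"
proof (induction n arbitrary: u v i)
  case (Suc n)
  then have d: "deg S v = 2" "i \<le> Suc (tlen S n v (nxt S u v))" by (auto split: if_splits)
  show ?case
  proof (cases "i = 1")
    case True
    then show ?thesis using d by simp
  next
    case False
    then obtain j where j: "i = Suc j" "1 \<le> j" using Suc.prems(1) by (cases i) auto
    then show ?thesis using Suc.IH[of j v "nxt S u v"] d wk_shift by simp
  qed
qed simp

lemma star_tlen: "u \<in> S \<Longrightarrow> star S u (tlen S 3 u)"
  using deg_tlen tlen_le[of S 3] by (auto simp: star_def thread_def)

lemma handshake:
  assumes "finite S"
  shows "(\<Sum>v\<in>S. deg S v) = 2 * card (edg S)"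
proof -
  have fN: "finite (nbrs S v)" for v using assms by (auto simp: nbrs_def)
  have "(\<Sum>v\<in>S. deg S v) = card (Sigma S (nbrs S))"
    unfolding deg_def using assms fN by (subst card_SigmaI) auto
  also have "Sigma S (nbrs S) = (\<Union>e\<in>edg S. {(u, v). {u, v} = e})"
    by (auto simp: nbrs_def edg_iff)
  also have "card \<dots> = (\<Sum>e\<in>edg S. card {(u, v). {u, v} = e})"
  proof (rule card_UN_disjoint)
    show "finite (edg S)" using finite_edg assms by blast
    have "{(u, v). {u, v} = e} \<subseteq> e \<times> e" for e :: "'a set" by auto
    moreover have "finite e" if "e \<in> edg S" for e using that by (auto simp: edg_def)
    ultimately show "\<forall>e\<in>edg S. finite {(u, v). {u, v} = e}" by (meson finite_SigmaI finite_subset)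
  qed auto
  also have "\<dots> = (\<Sum>e\<in>edg S. 2)"
  proof (rule sum.cong[OF refl])
    fix e assume "e \<in> edg S"
    then obtain u v where e: "e = {u, v}" "u \<noteq> v" by (rule edg_E)
    then have "{(x, y). {x, y} = e} = {(u, v), (v, u)}" by (auto simp: doubleton_eq_iff)
    then show "card {(x, y). {x, y} = e} = 2" using e by simp
  qed
  finally show ?thesis by simp
qed

section \<open>Reducible configurations\<close>

definition critical :: "'a set \<Rightarrow> bool" where
  "critical S \<longleftrightarrow> finite S \<and> \<not> (\<exists>c. pcf S c) \<and> (\<forall>T. T \<subset> S \<longrightarrow> (\<exists>c. pcf T c))"

context
  fixes S :: "'a set"
  assumes crit: "critical S" and g: "\<And>C. cyc S C \<Longrightarrow> 11 \<le> length C"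
begin

lemma finS: "finite S" using crit by (simp add: critical_def)

lemma fin_nbrs: "finite (nbrs S v)" using finS by (simp add: nbrs_def)

lemma star_critical:
  assumes "star S u k"
  obtains cc t where "\<And>v. v \<in> nbrs S u \<Longrightarrow> deg S (wk S u v (Suc (k v))) = 3 \<Longrightarrow> t v = cc v"
    "nbrs S u \<noteq> {}" "\<not> extendable (nbrs S u) k cc t"
proof (rule star_not_extendable[OF assms finS])
  show "11 \<le> length C" if "cyc S C" for C using that by (rule g)
  show "\<not> (\<exists>c. pcf S c)" using crit by (simp add: critical_def)
  show "\<exists>c. pcf T c" if "T \<subset> S" for T using crit that by (simp add: critical_def)
qed (rule that)

lemma star_k3: "star S u k \<Longrightarrow> v \<in> nbrs S u \<Longrightarrow> k v \<le> 3"
  by (simp add: star_def)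

text \<open>The star of length 0 deletes only \<open>u\<close>; a single neighbour leaves enough
  colours.\<close>

lemma deg_ge_2:
  assumes "u \<in> S"
  shows "2 \<le> deg S u"
proof (rule ccontr)
  assume n: "\<not> ?thesis"
  have st: "star S u (\<lambda>_. 0)" using assms by (auto simp: star_def thread_def)
  obtain cc t where "nbrs S u \<noteq> {}" and ne: "\<not> extendable (nbrs S u) (\<lambda>_. 0) cc t" using star_critical[OF st] by metis
  then have "card (nbrs S u) = 1" using n fin_nbrs[of u] by (auto simp: deg_def card_gt_0_iff not_le less_2_cases_iff)
  then obtain v where "nbrs S u = {v}" by (rule card_1_singletonE)
  then show False using ne extendable_1[OF fin_nbrs, where k = "\<lambda>_. 0" and v = v] by auto
qed

text \<open>The star is centred at the second of the four vertices, with one inner vertex on the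
  side of \<open>u\<close> and two on the other. The result makes truncation of thread lengths at 3
  harmless.\<close>

lemma no_four_consecutive:
  assumes "u \<in> S" "v \<in> nbrs S u" "deg S u = 2" "deg S v = 2" "deg S (nxt S u v) = 2"
  shows "deg S (nxt S v (nxt S u v)) \<noteq> 2"
proof
  assume d: "deg S (nxt S v (nxt S u v)) = 2"
  have vS: "v \<in> S" using assms by (simp add: nbrs_def)
  then have uv: "u \<in> nbrs S v" using assms nbrs_sym by blast
  note nx = nxt[OF assms(4) uv]
  let ?k = "\<lambda>z. if z = u then 1 else 2 :: nat"
  have "deg S (wk S v (nxt S u v) i) = 2" if "1 \<le> i" "i \<le> 2" for i
  proof -
    have "i = 1 \<or> i = Suc (Suc 0)" using that by auto
    then show ?thesis using assms d by auto
  qed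
  moreover have "deg S (wk S v u i) = 2" if "1 \<le> i" "i \<le> 1" for i
  proof -
    have "i = 1" using that by simp
    then show ?thesis using assms by simp
  qed
  ultimately have st: "star S v ?k" using vS nx uv by (auto simp: star_def thread_def)
  obtain cc t where ne: "\<not> extendable (nbrs S v) ?k cc t" using star_critical[OF st] by metis
  have "extendable (nbrs S v) ?k cc t"
    by (rule extendable_2_12[OF fin_nbrs star_k3[OF st] nx(1)]) (use nx in auto)
  then show False using ne by simp
qed

text \<open>The star is centred at \<open>v\<close>, not at \<open>u\<close>: towards
  \<open>u\<close> its thread is empty, and the end \<open>u\<close> of degree 3 gives
  \<open>t u = cc u\<close>.\<close>

lemma three_vertex_thread:
  assumes "u \<in> S" "v \<in> nbrs S u" "deg S u = 3" "deg S v = 2"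
  shows "deg S (nxt S u v) \<noteq> 2"
proof
  assume d: "deg S (nxt S u v) = 2"
  have vS: "v \<in> S" using assms by (simp add: nbrs_def)
  then have uv: "u \<in> nbrs S v" using assms nbrs_sym by blast
  note nx = nxt[OF assms(4) uv]
  let ?k = "\<lambda>z. if z = u then 0 else 1 :: nat"
  have "deg S (wk S v (nxt S u v) i) = 2" if "1 \<le> i" "i \<le> 1" for i
  proof -
    have "i = 1" using that by simp
    then show ?thesis using d by simp
  qed
  then have st: "star S v ?k" using vS nx uv by (auto simp: star_def thread_def)
  obtain cc t where t: "\<And>z. z \<in> nbrs S v \<Longrightarrow> deg S (wk S v z (Suc (?k z))) = 3 \<Longrightarrow> t z = cc z"
    and ne: "\<not> extendable (nbrs S v) ?k cc t" using star_critical[OF st] by metis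
  have "t u = cc u" using t[OF uv] assms by simp
  then have "extendable (nbrs S v) ?k cc t"
    by (intro extendable_2_01[OF fin_nbrs star_k3[OF st] nx(1)]) (use nx in auto)
  then show False using ne by simp
qed

definition bad :: "'a \<Rightarrow> bool" where
  "bad u \<longleftrightarrow> u \<in> S \<and> deg S u = 3 \<and> (\<forall>v\<in>nbrs S u. deg S v = 2)"

text \<open>An end of degree 3 would make one of the three 1-threads unrestricted, as
  \<open>extendable_111\<close> requires. This guarantees that whoever has to help a bad vertex has
  degree at least 4.\<close>

lemma bad_ends:
  assumes "bad u" "v \<in> nbrs S u"
  shows "4 \<le> deg S (nxt S u v)"
proof -
  have b: "u \<in> S" "deg S u = 3" "\<And>v. v \<in> nbrs S u \<Longrightarrow> deg S v = 2" using assms by (auto simp: bad_def)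
  have vS: "v \<in> S" using assms by (simp add: nbrs_def)
  then have uv: "u \<in> nbrs S v" using assms b nbrs_sym by blast
  have "deg S (nxt S u v) \<noteq> 3"
  proof
    assume d: "deg S (nxt S u v) = 3"
    have "deg S (wk S u w i) = 2" if "1 \<le> i" "i \<le> 1" "w \<in> nbrs S u" for i w
    proof -
      have "i = 1" using that by simp
      then show ?thesis using b that by simp
    qed
    then have st: "star S u (\<lambda>_. 1)" using b by (auto simp: star_def thread_def)
    obtain cc t where t: "\<And>z. z \<in> nbrs S u \<Longrightarrow> deg S (wk S u z (Suc 1)) = 3 \<Longrightarrow> t z = cc z"
      and ne: "\<not> extendable (nbrs S u) (\<lambda>_. 1) cc t" using star_critical[OF st] by metis
    have "t v = cc v" using t[OF assms(2)] d by simp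
    then have "extendable (nbrs S u) (\<lambda>_. 1) cc t"
      using b(2) assms(2) by (intro extendable_111[OF fin_nbrs, where ?v0.0 = v]) (auto simp: deg_def)
    then show False using ne by simp
  qed
  moreover have "deg S (nxt S u v) \<noteq> 2" using three_vertex_thread[OF b(1) assms(2) b(2)] b(3) assms(2) by blast
  moreover have "nxt S u v \<in> S" using nxt[of S v u] uv b(3)[OF assms(2)] by (auto simp: nbrs_def)
  ultimately show ?thesis using deg_ge_2[of "nxt S u v"] by linarith
qed

section \<open>Charges\<close>

definition load :: "'a \<Rightarrow> nat" where
  "load u = (\<Sum>v\<in>nbrs S u. tlen S 3 u v)"

text \<open>The threads along which \<open>u\<close> sends the extra charge 1/27 to the bad vertex
  at the other end.\<close>

definition aid :: "'a \<Rightarrow> 'a set" where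
  "aid u = {v \<in> nbrs S u. tlen S 3 u v = 1 \<and> bad (nxt S u v)}"

text \<open>Each thread costs at most 18 of the 27 units that its edge contributes. As
  \<open>9 D >= 66\<close> for \<open>D >= 8\<close>, only degrees up to 7 remain to be
  examined.\<close>

lemma aid_load: "6 * load u + card (aid u) \<le> 18 * deg S u"
proof -
  have "card (aid u) = (\<Sum>v\<in>nbrs S u. if v \<in> aid u then 1 else 0)"
    using fin_nbrs[of u] by (simp add: sum.If_cases aid_def Int_def)
  then have "6 * load u + card (aid u) = (\<Sum>v\<in>nbrs S u. 6 * tlen S 3 u v + (if v \<in> aid u then 1 else 0))"
    by (simp add: load_def sum_distrib_left sum.distrib)
  also have "\<dots> \<le> (\<Sum>v\<in>nbrs S u. 18)"
  proof (rule sum_mono)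
    fix v assume "v \<in> nbrs S u"
    show "6 * tlen S 3 u v + (if v \<in> aid u then 1 else 0) \<le> 18"
      using tlen_le[of S 3 u v] by (auto simp: aid_def)
  qed
  finally show ?thesis by (simp add: deg_def)
qed

text \<open>\<open>h\<close> counts threads of length 1, so it cannot be large together with
  \<open>s\<close>; this is why the help given to bad vertices does not lower these bounds.\<close>

lemma discharge_arith:
  fixes D s h n0 n1 n2 n3 :: nat
  assumes "D = n0 + n1 + n2 + n3" "s = n1 + 2 * n2 + 3 * n3" "h \<le> n1" "27 * D < 66 + 6 * s + h"
  shows "D = 4 \<Longrightarrow> 7 \<le> s" "D = 5 \<Longrightarrow> 12 \<le> s" "D = 6 \<Longrightarrow> 16 \<le> s" "D = 7 \<Longrightarrow> 20 \<le> s"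
  using assms by linarith+

lemma discharge_big:
  assumes u: "u \<in> S" "4 \<le> deg S u"
  shows "66 + 6 * load u + card (aid u) \<le> 27 * deg S u"
proof (rule ccontr)
  assume n: "\<not> ?thesis"
  note st = star_tlen[OF u(1)]
  have le: "deg S u \<le> 7" using n aid_load[of u] by linarith
  obtain cc t where t: "\<And>z. z \<in> nbrs S u \<Longrightarrow> deg S (wk S u z (Suc (tlen S 3 u z))) = 3 \<Longrightarrow> t z = cc z"
    and ne: "\<not> extendable (nbrs S u) (tlen S 3 u) cc t" using star_critical[OF st] by metis
  have k3: "\<And>v. v \<in> nbrs S u \<Longrightarrow> tlen S 3 u v \<le> 3" using tlen_le by blast
  let ?n = "\<lambda>j. card {v \<in> nbrs S u. tlen S 3 u v = j}"
  note cN = card_threads[OF fin_nbrs k3, of u] and sN = sum_threads[OF fin_nbrs k3, of u]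
  have h1: "card (aid u) \<le> ?n 1" by (rule card_mono) (use fin_nbrs in \<open>auto simp: aid_def\<close>)
  have c: "deg S u = ?n 0 + ?n 1 + ?n 2 + ?n 3" "load u = ?n 1 + 2 * ?n 2 + 3 * ?n 3"
    using cN sN by (simp_all add: deg_def load_def)
  have "27 * deg S u < 66 + 6 * load u + card (aid u)" using n by simp
  note ar = discharge_arith[OF c h1 this]
  have "extendable (nbrs S u) (tlen S 3 u) cc t"
  proof (rule extendable_degree_ge_4[OF fin_nbrs k3])
    show "4 \<le> card (nbrs S u)" "card (nbrs S u) \<le> 7" using u le by (simp_all add: deg_def)
    show "12 \<le> sum (tlen S 3 u) (nbrs S u)" if "card (nbrs S u) = 5"
      using ar(2) that by (simp add: load_def deg_def)
    show "16 \<le> sum (tlen S 3 u) (nbrs S u)" if "card (nbrs S u) = 6"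
      using ar(3) that by (simp add: load_def deg_def)
    show "20 \<le> sum (tlen S 3 u) (nbrs S u)" if "card (nbrs S u) = 7"
      using ar(4) that by (simp add: load_def deg_def)
    show "8 \<le> sum (tlen S 3 u) (nbrs S u) \<or> sum (tlen S 3 u) (nbrs S u) = 7 \<and>
      (\<exists>v\<in>nbrs S u. tlen S 3 u v = 1 \<and> t v = cc v)" if 4: "card (nbrs S u) = 4"
    proof -
      have d4: "deg S u = 4" using 4 by (simp add: deg_def)
      have 7: "7 \<le> load u" by (rule ar(1)[OF d4])
      show ?thesis
      proof (cases "8 \<le> load u")
        case True then show ?thesis by (simp add: load_def)
      next
        case False
        then have l7: "load u = 7" using 7 by simp
        \<comment> \<open>In degree 4 the value 7 balances exactly,
          \<open>27 * 4 = 66 + 6 * 7\<close>, so a deficit needs a thread to a bad vertex. That end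
          has degree 3, which gives \<open>t v = cc v\<close>.\<close>
        then have "card (aid u) > 0" using n d4 by linarith
        then obtain v where v: "v \<in> aid u" by (metis card.empty ex_in_conv less_numeral_extra(3))
        then have v': "v \<in> nbrs S u" "tlen S 3 u v = 1" "deg S (nxt S u v) = 3" by (auto simp: aid_def bad_def)
        then have "t v = cc v" using t[OF v'(1)] by simp
        then show ?thesis using l7 v' unfolding load_def by blast
      qed
    qed
  qed
  then show False using ne by simp
qed

text \<open>Threads at a 3-vertex have at most one vertex. Two of them cost 12 of the 15 spare
  units; three cost 18, and the 3 missing units are what a bad vertex receives.\<close>

lemma discharge_three:
  assumes u: "u \<in> S" "deg S u = 3"
  shows "66 + 6 * load u \<le> 81 + (if bad u then 3 else 0)"
proof -
  have k1: "tlen S 3 u v \<le> (if deg S v = 2 then 1 else 0)" if "v \<in> nbrs S u" for v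
    using three_vertex_thread[OF u(1) that u(2)] by (auto simp: numeral_3_eq_3)
  have "load u \<le> (\<Sum>v\<in>nbrs S u. if deg S v = 2 then 1 else 0)" unfolding load_def by (rule sum_mono) (rule k1)
  also have "\<dots> = card {v \<in> nbrs S u. deg S v = 2}" using fin_nbrs[of u] by (simp add: sum.If_cases Int_def conj_commute)
  finally have l: "load u \<le> card {v \<in> nbrs S u. deg S v = 2}" .
  have c3: "card (nbrs S u) = 3" using u by (simp add: deg_def)
  show ?thesis
  proof (cases "bad u")
    case True
    have "card {v \<in> nbrs S u. deg S v = 2} \<le> 3" using card_mono[OF fin_nbrs[of u], of "{v \<in> nbrs S u. deg S v = 2}"] c3 by auto
    then show ?thesis using True l by simp
  next
    case False
    then have "{v \<in> nbrs S u. deg S v = 2} \<subset> nbrs S u" using u by (auto simp: bad_def)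
    then have "card {v \<in> nbrs S u. deg S v = 2} < 3" using psubset_card_mono[OF fin_nbrs] c3 by metis
    then show ?thesis using l by simp
  qed
qed

text \<open>Truncation would break this recursion if a thread had four vertices, since one step
  along it shortens the bound as well; \<open>no_four_consecutive\<close> rules this out.\<close>

lemma tlen_rec:
  assumes "u \<in> S" "v \<in> nbrs S u" "deg S v = 2"
  shows "tlen S 3 u v = Suc (tlen S 3 v (nxt S u v))"
proof -
  have vS: "v \<in> S" using assms by (simp add: nbrs_def)
  then have uv: "u \<in> nbrs S v" using assms nbrs_sym by blast
  have w: "nxt S u v \<in> nbrs S v" unfolding nxt(1)[OF assms(3) uv] by simp
  have eq: "tlen S 2 v w = tlen S 3 v w" if "\<not> (deg S w = 2 \<and> deg S (nxt S v w) = 2 \<and> deg S (nxt S w (nxt S v w)) = 2)" for w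
    using that by (simp add: numeral_3_eq_3 numeral_2_eq_2)
  have e: "tlen S 2 v (nxt S u v) = tlen S 3 v (nxt S u v)"
    by (rule eq) (use no_four_consecutive[OF vS w assms(3)] in simp)
  have "tlen S 3 u v = Suc (tlen S 2 v (nxt S u v))"
    using assms(3) by (simp add: numeral_3_eq_3 numeral_2_eq_2)
  then show ?thesis by (simp only: e)
qed

text \<open>Pairs of adjacent vertices are directed edges. Going straight on through a vertex of
  degree 2 maps those entering such a vertex to those leaving one, and the same rule walked
  backwards is the inverse.\<close>

lemma turn_bij:
  "bij_betw (\<lambda>(u, v). (v, nxt S u v)) {(u, v). u \<in> S \<and> v \<in> nbrs S u \<and> deg S v = 2}
     {(u, v). u \<in> S \<and> v \<in> nbrs S u \<and> deg S u = 2}"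
proof (rule bij_betw_byWitness[where f' = "\<lambda>(v, w). (nxt S w v, v)"])
  have key: "nxt S u v \<in> nbrs S v \<and> nxt S u v \<in> S \<and> nxt S (nxt S u v) v = u \<and> v \<in> nbrs S (nxt S u v)"
    if "u \<in> nbrs S v" "v \<in> S" "deg S v = 2" for u v
  proof -
    note n1 = nxt[OF that(3,1)]
    have i: "nxt S u v \<in> nbrs S v" by (simp add: n1(1))
    then have iS: "nxt S u v \<in> S" by (simp add: nbrs_def)
    note n2 = nxt[OF that(3) i]
    have "nxt S (nxt S u v) v = u" using n1 n2 by (metis doubleton_eq_iff)
    then show ?thesis using i iS nbrs_sym that(2) by blast
  qed
  have mem: "v \<in> S \<and> u \<in> nbrs S v" if "u \<in> S" "v \<in> nbrs S u" for u v
  proof -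
    have "v \<in> S" using that by (simp add: nbrs_def)
    then show ?thesis using that nbrs_sym by blast
  qed
  let ?H = "{(u, v). u \<in> S \<and> v \<in> nbrs S u \<and> deg S v = 2}" and ?T = "{(u, v). u \<in> S \<and> v \<in> nbrs S u \<and> deg S u = 2}"
  have H: "(v, nxt S u v) \<in> ?T \<and> nxt S (nxt S u v) v = u" if "(u, v) \<in> ?H" for u v
    using key[of u v] mem[of u v] that by simp
  have T: "(nxt S w v, v) \<in> ?H \<and> nxt S (nxt S w v) v = w" if "(v, w) \<in> ?T" for v w
    using key[of w v] that by simp
  show "\<forall>a\<in>?H. (case case a of (u, v) \<Rightarrow> (v, nxt S u v) of (v, w) \<Rightarrow> (nxt S w v, v)) = a"
  proof
    fix a assume "a \<in> ?H"
    then show "(case case a of (u, v) \<Rightarrow> (v, nxt S u v) of (v, w) \<Rightarrow> (nxt S w v, v)) = a"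
      using H[of "fst a" "snd a"] by (simp add: case_prod_beta)
  qed
  show "\<forall>a\<in>?T. (case case a of (v, w) \<Rightarrow> (nxt S w v, v) of (u, v) \<Rightarrow> (v, nxt S u v)) = a"
  proof
    fix a assume "a \<in> ?T"
    then show "(case case a of (v, w) \<Rightarrow> (nxt S w v, v) of (u, v) \<Rightarrow> (v, nxt S u v)) = a"
      using T[of "fst a" "snd a"] by (simp add: case_prod_beta)
  qed
  show "(\<lambda>(u, v). (v, nxt S u v)) ` ?H \<subseteq> ?T"
  proof (rule image_subsetI)
    fix a assume "a \<in> ?H"
    then show "(\<lambda>(u, v). (v, nxt S u v)) a \<in> ?T" using H[of "fst a" "snd a"] by (simp add: case_prod_beta)
  qed
  show "(\<lambda>(v, w). (nxt S w v, v)) ` ?T \<subseteq> ?H"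
  proof (rule image_subsetI)
    fix a assume "a \<in> ?T"
    then show "(\<lambda>(v, w). (nxt S w v, v)) a \<in> ?H" using T[of "fst a" "snd a"] by (simp add: case_prod_beta)
  qed
qed

text \<open>Threads need not be listed. Summing \<open>tlen\<close> over all directed edges and
  applying \<open>tlen_rec\<close> and \<open>turn_bij\<close> gives the sum over those that leave a
  2-vertex plus the number of these. Cancelling leaves the directed edges at other vertices, with
  total twice the number of 2-vertices.\<close>

lemma sum_load: "(\<Sum>u\<in>{u \<in> S. deg S u \<noteq> 2}. load u) = 2 * card {u \<in> S. deg S u = 2}"
proof -
  let ?D = "Sigma S (nbrs S)" and ?H = "{(u, v). u \<in> S \<and> v \<in> nbrs S u \<and> deg S v = 2}"
    and ?T = "{(u, v). u \<in> S \<and> v \<in> nbrs S u \<and> deg S u = 2}"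
  let ?k = "\<lambda>(u, v). tlen S 3 u v"
  have finD: "finite ?D" using finS fin_nbrs by simp
  have HD: "?H \<subseteq> ?D" "?T \<subseteq> ?D" by auto
  have finH: "finite ?H" "finite ?T" using HD finD by (meson finite_subset)+
  have "sum ?k ?D = sum ?k ?H"
    using HD finD by (intro sum.mono_neutral_right) (auto simp: numeral_3_eq_3 split: if_splits)
  also have "\<dots> = (\<Sum>d\<in>?H. 1 + ?k (case d of (u, v) \<Rightarrow> (v, nxt S u v)))"
  proof (rule sum.cong[OF refl])
    fix d assume "d \<in> ?H"
    then obtain u v where d: "d = (u, v)" "u \<in> S" "v \<in> nbrs S u" "deg S v = 2" by auto
    show "?k d = 1 + ?k (case d of (u, v) \<Rightarrow> (v, nxt S u v))" using tlen_rec[OF d(2-4)] d(1) by simp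
  qed
  also have "\<dots> = card ?H + (\<Sum>d\<in>?H. ?k (case d of (u, v) \<Rightarrow> (v, nxt S u v)))"
    by (simp only: sum.distrib) simp
  also have "(\<Sum>d\<in>?H. ?k (case d of (u, v) \<Rightarrow> (v, nxt S u v))) = sum ?k ?T"
    by (rule sum.reindex_bij_betw[OF turn_bij])
  also have "card ?H = card ?T" by (rule bij_betw_same_card[OF turn_bij])
  finally have 1: "sum ?k ?D = card ?T + sum ?k ?T" .
  have T: "?T = Sigma {u \<in> S. deg S u = 2} (nbrs S)" by auto
  have "card ?T = (\<Sum>u\<in>{u \<in> S. deg S u = 2}. card (nbrs S u))"
    unfolding T using finS fin_nbrs by (subst card_SigmaI) auto
  also have "\<dots> = (\<Sum>u\<in>{u \<in> S. deg S u = 2}. 2)" by (rule sum.cong) (auto simp: deg_def)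
  finally have 2: "card ?T = 2 * card {u \<in> S. deg S u = 2}" by simp
  have 3: "sum ?k ?T = (\<Sum>u\<in>{u \<in> S. deg S u = 2}. load u)"
    unfolding T load_def using finS fin_nbrs by (subst sum.Sigma) auto
  have "sum ?k ?D = (\<Sum>u\<in>S. load u)"
    unfolding load_def using finS fin_nbrs by (subst sum.Sigma) auto
  also have "\<dots> = (\<Sum>u\<in>{u \<in> S. deg S u = 2}. load u) + (\<Sum>u\<in>{u \<in> S. deg S u \<noteq> 2}. load u)"
    using finS by (subst sum.union_disjoint[symmetric]) (auto intro: sum.cong)
  finally show ?thesis using 1 2 3 by linarith
qed

text \<open>Each of the three threads at a bad vertex is sent to its other end, which helps by
  \<open>bad_ends\<close>. Walking back through the same \<open>v\<close> recovers the bad vertex,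
  so no help is counted twice.\<close>

lemma sum_aid: "3 * card {u \<in> S. bad u} \<le> (\<Sum>w\<in>{w \<in> S. 4 \<le> deg S w}. card (aid w))"
proof -
  let ?B = "Sigma {u \<in> S. bad u} (nbrs S)" and ?W = "Sigma {w \<in> S. 4 \<le> deg S w} aid"
  have finW: "finite ?W" using finS fin_nbrs by (auto simp: aid_def)
  have key: "nxt S u v \<in> S \<and> 4 \<le> deg S (nxt S u v) \<and> v \<in> aid (nxt S u v) \<and> nxt S (nxt S u v) v = u"
    if b: "bad u" and v: "v \<in> nbrs S u" for u v
  proof -
    have bu: "u \<in> S" "deg S u = 3" "deg S v = 2" using b v by (auto simp: bad_def)
    have vS: "v \<in> S" using v by (simp add: nbrs_def)
    then have uv: "u \<in> nbrs S v" using v bu nbrs_sym by blast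
    note n1 = nxt[OF bu(3) uv]
    have i: "nxt S u v \<in> nbrs S v" by (simp add: n1(1))
    then have iS: "nxt S u v \<in> S" by (simp add: nbrs_def)
    note n2 = nxt[OF bu(3) i]
    have e: "nxt S (nxt S u v) v = u" using n1 n2 by (metis doubleton_eq_iff)
    have "v \<in> nbrs S (nxt S u v)" using i iS nbrs_sym vS by blast
    moreover have "tlen S 3 (nxt S u v) v = 1" using bu e by (simp add: numeral_3_eq_3)
    ultimately have "v \<in> aid (nxt S u v)" using e b by (simp add: aid_def)
    then show ?thesis using iS bad_ends[OF b v] e by blast
  qed
  have "card ?B = (\<Sum>u\<in>{u \<in> S. bad u}. card (nbrs S u))"
    using finS fin_nbrs by (subst card_SigmaI) auto
  also have "\<dots> = (\<Sum>u\<in>{u \<in> S. bad u}. 3)" by (rule sum.cong) (auto simp: bad_def deg_def)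
  finally have "3 * card {u \<in> S. bad u} = card ?B" by simp
  also have "\<dots> \<le> card ?W"
  proof (rule card_inj_on_le[OF _ _ finW])
    show "inj_on (\<lambda>(u, v). (nxt S u v, v)) ?B"
    proof (rule inj_onI)
      fix p q assume pq: "p \<in> ?B" "q \<in> ?B" "(\<lambda>(u, v). (nxt S u v, v)) p = (\<lambda>(u, v). (nxt S u v, v)) q"
      obtain u v u' v' where e: "p = (u, v)" "q = (u', v')" by fastforce
      then have eq: "v = v'" "nxt S u v = nxt S u' v'" using pq(3) by auto
      have "nxt S (nxt S u v) v = u" "nxt S (nxt S u' v') v' = u'" using key[of u v] key[of u' v'] pq(1,2) e by auto
      then have "u = u'" using eq by metis
      then show "p = q" using e eq by simp
    qed
    show "(\<lambda>(u, v). (nxt S u v, v)) ` ?B \<subseteq> ?W"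
    proof (rule image_subsetI)
      fix p assume "p \<in> ?B"
      then show "(\<lambda>(u, v). (nxt S u v, v)) p \<in> ?W" using key[of "fst p" "snd p"] by (auto simp: case_prod_beta)
    qed
  qed
  also have "\<dots> = (\<Sum>w\<in>{w \<in> S. 4 \<le> deg S w}. card (aid w))"
    using finS fin_nbrs by (subst card_SigmaI) (auto simp: aid_def)
  finally show ?thesis .
qed

text \<open>In units of 1/27 each vertex must end with 66. A 2-vertex has 54 and receives 6 from
  each of the two thread ends; the other vertices keep enough by \<open>discharge_three\<close> and
  \<open>discharge_big\<close>.\<close>

lemma critical_dense: "66 * card S \<le> 27 * (\<Sum>v\<in>S. deg S v)"
proof -
  have discharge: "66 + (if deg S v \<noteq> 2 then 6 * load v else 0) + (if 4 \<le> deg S v then card (aid v) else 0)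
    \<le> 27 * deg S v + (if deg S v = 2 then 12 else 0) + (if bad v then 3 else 0)" if v: "v \<in> S" for v
  proof -
    consider "deg S v = 2" | "deg S v = 3" | "4 \<le> deg S v" using deg_ge_2[OF v] by linarith
    then show ?thesis
    proof cases
      case 1 then show ?thesis by simp
    next
      case 2 then show ?thesis using discharge_three[OF v 2] by simp
    next
      case 3 then show ?thesis using discharge_big[OF v 3] by simp
    qed
  qed
  have "(\<Sum>v\<in>S. 66 + (if deg S v \<noteq> 2 then 6 * load v else 0) + (if 4 \<le> deg S v then card (aid v) else 0))
    \<le> (\<Sum>v\<in>S. 27 * deg S v + (if deg S v = 2 then 12 else 0) + (if bad v then 3 else 0))"
    by (rule sum_mono) (rule discharge)
  moreover have "(\<Sum>v\<in>S. 66 + (if deg S v \<noteq> 2 then 6 * load v else 0) + (if 4 \<le> deg S v then card (aid v) else 0))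
    = 66 * card S + 6 * (\<Sum>v\<in>{v \<in> S. deg S v \<noteq> 2}. load v) + (\<Sum>v\<in>{v \<in> S. 4 \<le> deg S v}. card (aid v))"
    unfolding sum.distrib sum_distrib_left sum.inter_filter[OF finS, symmetric] by simp
  moreover have "(\<Sum>v\<in>S. 27 * deg S v + (if deg S v = 2 then 12 else 0) + (if bad v then 3 else 0))
    = 27 * (\<Sum>v\<in>S. deg S v) + 12 * card {v \<in> S. deg S v = 2} + 3 * card {v \<in> S. bad v}"
    unfolding sum.distrib sum_distrib_left sum.inter_filter[OF finS, symmetric] by simp
  ultimately show ?thesis using sum_load sum_aid by linarith
qed

end

text \<open>A minimal uncolourable vertex set would satisfy
  \<open>66 * card S <= 54 * card (edg S)\<close> by the handshake lemma, that is 11 times the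
  vertices is at most 9 times the edges. Sparsity is needed for all subsets because this set is not
  known in advance.\<close>

theorem sparse_imp_pcf:
  assumes "finite V" and g: "\<And>C. cyc V C \<Longrightarrow> 11 \<le> length C"
    and sparse: "\<And>S. S \<subseteq> V \<Longrightarrow> S \<noteq> {} \<Longrightarrow> 9 * card (edg S) + 11 \<le> 11 * card S"
  shows "\<exists>c. pcf V c"
proof -
  have "\<exists>c. pcf S c" if "S \<subseteq> V" for S
  proof -
    have "finite S" using that assms(1) finite_subset by blast
    then show ?thesis using that
    proof (induction S rule: finite_psubset_induct)
      case (psubset S)
      show ?case
      proof (rule ccontr)
        assume n: "\<not> (\<exists>c. pcf S c)"
        then have c: "critical S" using psubset unfolding critical_def by (meson dual_order.trans psubset_imp_subset)
        have "S \<noteq> {}" using n by (auto simp: pcf_def)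
        then have "9 * card (edg S) + 11 \<le> 11 * card S" using sparse psubset.prems by blast
        moreover have "cyc V C" if "cyc S C" for C using that psubset.prems by (auto simp: cyc_def gpath_def)
        then have "66 * card S \<le> 27 * (\<Sum>v\<in>S. deg S v)" using critical_dense[OF c] g by blast
        ultimately show False using handshake[OF psubset.hyps(1)] by linarith
      qed
    qed
  qed
  then show ?thesis by blast
qed

end

section \<open>Planar graphs of girth 11\<close>

lemma (in graph) sgraph_dominates: "sgraph (\<lambda>u v. u \<rightarrow>\<^bsub>G\<^esub> v)"
proof
  fix u v
  show "u \<rightarrow>\<^bsub>G\<^esub> v \<Longrightarrow> v \<rightarrow>\<^bsub>G\<^esub> u" using sym_arcs by (auto simp: symmetric_def dest: symD)
  show "\<not> v \<rightarrow>\<^bsub>G\<^esub> v" using no_loops by (auto simp: arcs_ends_def arc_to_ends_def)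
qed

lemma (in graph) cyc_length_ge_girth:
  assumes "sgraph.cyc (\<lambda>u v. u \<rightarrow>\<^bsub>G\<^esub> v) (verts G) C"
  shows "girth G \<le> enat (length C)"
proof -
  interpret sgraph "\<lambda>u v. u \<rightarrow>\<^bsub>G\<^esub> v"
    by (rule sgraph_dominates)
  have walk: "\<exists>p. set p \<subseteq> arcs G \<and> cas x p (last (x # xs)) \<and> awalk_verts x p = x # xs"
    if "successively (\<lambda>u v. u \<rightarrow>\<^bsub>G\<^esub> v) (x # xs)" for x xs
    using that
  proof (induction xs arbitrary: x)
    case Nil
    then show ?case by (intro exI[of _ "[]"]) simp
  next
    case (Cons y ys)
    then obtain p where p: "set p \<subseteq> arcs G" "cas y p (last (y # ys))" "awalk_verts y p = y # ys" by auto
    obtain a where "a \<in> arcs G" "tail G a = x" "head G a = y"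
      using Cons.prems by (auto simp: arcs_ends_def arc_to_ends_def)
    then show ?case using p by (intro exI[of _ "a # p"]) simp
  qed
  obtain x xs where C: "C = x # xs" using assms by (cases C) (auto simp: cyc_def)
  have c: "successively (\<lambda>u v. u \<rightarrow>\<^bsub>G\<^esub> v) C" "last C \<rightarrow>\<^bsub>G\<^esub> x" "distinct C" "set C \<subseteq> verts G" "3 \<le> length C"
    using assms C by (auto simp: cyc_def gpath_def)
  have "successively (\<lambda>u v. u \<rightarrow>\<^bsub>G\<^esub> v) (C @ [x])"
    unfolding successively_append_iff using c(1,2) by simp
  then obtain p where p: "set p \<subseteq> arcs G" "cas x p x" "awalk_verts x p = x # xs @ [x]"
    using walk[of x "xs @ [x]"] C by auto
  have len: "length p = length C" using arg_cong[OF p(3), of length] C by (simp add: length_awalk_verts)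
  have "cycle p" unfolding cycle_def
    using p c C len by (intro exI[of _ x]) (auto simp: awalk_def)
  then have "girth G \<le> enat (length p)" unfolding girth_def
    using len c(5) by (intro Inf_lower CollectI exI[of _ p]) simp
  then show ?thesis using len by simp
qed

theorem theorem1p2:
  fixes G :: "('a, 'b) pre_digraph"
  assumes "graph G"
    and "planar G"
    and "11 \<le> girth G"
  shows "pcf_chromatic_number G \<le> 4"
proof -
  interpret graph G by fact
  obtain pt \<gamma> where dr: "plane_drawing G pt \<gamma>" using assms(2) by (auto simp: planar_def)
  interpret s: sgraph "\<lambda>u v. u \<rightarrow>\<^bsub>G\<^esub> v" by (rule sgraph_dominates)
  have edg: "s.edg (verts G) = edges G"
    unfolding s.edg_def edges_def by (auto dest: adj_in_verts)
  interpret plane_graph "\<lambda>u v. u \<rightarrow>\<^bsub>G\<^esub> v" "verts G" pt \<gamma>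
    using dr unfolding plane_drawing_def by unfold_locales (auto simp: edg)
  have g: "11 \<le> length C" if "s.cyc (verts G) C" for C
  proof -
    have "11 \<le> enat (length C)" using order.trans[OF assms(3) cyc_length_ge_girth[OF that]] .
    then show ?thesis by (simp add: enat_ord_number)
  qed
  obtain c where c: "s.pcf (verts G) c"
    using s.sparse_imp_pcf[OF finite_verts g edge_bound[OF _ _ g]] by blast
  define f :: "col \<Rightarrow> nat" where "f = rec_col 0 1 2 3"
  have inj: "f x = f y \<longleftrightarrow> x = y" for x y by (cases x; cases y) (simp_all add: f_def)
  have "pcf_coloring G (f \<circ> c)"
    unfolding pcf_coloring_def proper_coloring_def
  proof (intro conjI allI impI ballI)
    fix u v assume uv: "u \<rightarrow>\<^bsub>G\<^esub> v"
    then show "(f \<circ> c) u \<noteq> (f \<circ> c) v" using c adj_in_verts[OF uv] by (simp add: s.pcf_def inj)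
  next
    fix v assume v: "v \<in> verts G" "\<exists>u. v \<rightarrow>\<^bsub>G\<^esub> u"
    have nb: "u \<in> s.nbrs (verts G) v \<longleftrightarrow> v \<rightarrow>\<^bsub>G\<^esub> u" for u by (auto simp: s.nbrs_def dest: adj_in_verts)
    then have "s.nbrs (verts G) v \<noteq> {}" using v by blast
    then have "uniq (s.nbrs (verts G) v) c" using c v by (simp add: s.pcf_def)
    then obtain w where "v \<rightarrow>\<^bsub>G\<^esub> w" "\<And>u. v \<rightarrow>\<^bsub>G\<^esub> u \<Longrightarrow> u \<noteq> w \<Longrightarrow> c u \<noteq> c w"
      unfolding uniq_def Ball_def Bex_def nb by blast
    then show "\<exists>k. \<exists>!u. v \<rightarrow>\<^bsub>G\<^esub> u \<and> (f \<circ> c) u = k"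
      by (intro exI[of _ "f (c w)"] ex1I[of _ w]) (auto simp: inj)
  qed
  then have "pcf_chromatic_number G \<le> enat (card ((f \<circ> c) ` verts G))"
    unfolding pcf_chromatic_number_def by (intro Inf_lower CollectI exI[of _ "f \<circ> c"] conjI refl)
  also have "card ((f \<circ> c) ` verts G) \<le> card (range f)"
    by (rule card_mono) auto
  also have "card (range f) \<le> 4" using card_image_le[of UNIV f] card_col by simp
  finally show ?thesis by (simp add: numeral_eq_enat)
qed

end
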